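(* Let $n\ge1$ and let a coherent family of ensembles on the spaces $W_{n,d}$, $d\ge1$, with rescaling exponent $\lambda$ be given. Let $f\in W_{n,d}$ be the random polynomial of the family and $X=\{[x]\in\mathbb{R}\mathrm{P}^n: f(x)=0\}$. There exists a constant $c>0$, independent of $d$, such that $$\mathbb{E}\,b_0(X)\ge c\,d^{\lambda n}$$ for all sufficiently large $d$.
   Context: $W_{n,d}$ is the space of real homogeneous polynomials of degree $d$ in $n+1$ variables. $b_0(\cdot)$ denotes the number of connected components. For each $\ell\ge 0$ let $\{Y_\ell^j\}_{j\in J_\ell}$ be an $L^2(S^n)$-orthonormal basis of the space of real spherical harmonics of degree $\ell$ on the unit sphere $S^n\subset\mathbb{R}^{n+1}$. Given weights $p_d(\ell)\ge 0$, indexed by integers $0\le \ell\le d$ with $d-\ell$ even, the associated random invariant polynomial is $$f(x)=\sum_{d-\ell\in 2\mathbb{N}} p_d(\ell)\sum_{j\in J_\ell}\xi_\ell^j\,\|x\|^{d-\ell}\,Y_\ell^j\!\left(\frac{x}{\|x\|}\right)\in W_{n,d},$$ with $\xi_\ell^j$ independent standard Gaussian random variables. Coherent family: a choice of such weights for every $d\ge 1$ satisfying (i) $\sum_{d-\ell\in 2\mathbb{N}} p_d(\ell)=1$ for every $d$; (ii) extend $p_d$ to $[0,\infty)$ as a step function supported on $[0,d]$: on each interval $(k,k+1)\subset[0,d]$ with $k$ an integer it is constant, equal to whichever of $p_d(k)$, $p_d(k+1)$ is defined (exactly one of $k,k+1$ has the parity of $d$), and at an integer in $[0,d]$ of the wrong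 parity it equals the value on an adjacent interval. Then there exist $0<\lambda\le 1$ and an integrable nonzero function $\psi:[0,\infty)\to\mathbb{R}$ such that $P_{d,\lambda}(x):=d^{\lambda}p_d(d^{\lambda}x)$ converges to $\psi(x)$ pointwise as $d\to\infty$, and there are constants $a_1,a_2>0$ with $P_{d,\lambda}(x)\le a_1e^{-a_2x^2}$ for all $d$ and all $x\ge 0$. The number $\lambda$ is the rescaling exponent and $\psi$ the rescaling limit of the family.
   Formalization: The factor ‖x‖^{d-ℓ} Y(x/‖x‖) in the random polynomial, which is not homogeneous of degree d, is read as ‖x‖^d Y(x/‖x‖), so that f lies in W_{n,d}; the two agree on the unit sphere. *)

theory Defs
  imports "HOL-Probability.Probability"
begin

section \<open>Homogeneous polynomials and spherical harmonics\<close>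

definition homogeneous_polynomials :: "nat \<Rightarrow> ('a::euclidean_space \<Rightarrow> real) set" where
  "homogeneous_polynomials d =
     {f. real_polynomial_function f \<and> (\<forall>t x. f (t *\<^sub>R x) = t ^ d * f x)}"

definition laplacian :: "('a::euclidean_space \<Rightarrow> real) \<Rightarrow> 'a \<Rightarrow> real" where
  "laplacian f x = (\<Sum>b\<in>Basis. (deriv ^^ 2) (\<lambda>t. f (x + t *\<^sub>R b)) 0)"

text \<open>
  Functions on the unit sphere are represented by their extension by zero, so that equality of
  functions on the sphere is equality in HOL.
\<close>

definition spherical_harmonics :: "nat \<Rightarrow> ('a::euclidean_space \<Rightarrow> real) set" where
  "spherical_harmonics l =
     {\<lambda>x. if x \<in> sphere 0 1 then h x else 0 | h.
        h \<in> homogeneous_polynomials l \<and> (\<forall>x. laplacian h x = 0)}"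

text \<open>
  Surface measure of the unit sphere of an \<open>m\<close>-dimensional space, obtained from Lebesgue measure by
  polar coordinates: the area of \<open>A\<close> is \<open>m\<close> times the volume of the cone
  \<open>{t *\<^sub>R x | t x. 0 < t \<and> t \<le> 1 \<and> x \<in> A}\<close>.
\<close>

definition sphere_measure :: "'a::euclidean_space measure" where
  "sphere_measure =
     scale_measure (of_nat DIM('a))
       (distr (restrict_space lborel (cball 0 1 - {0})) borel (\<lambda>x. x /\<^sub>R norm x))"

definition sphere_inner :: "('a::euclidean_space \<Rightarrow> real) \<Rightarrow> ('a \<Rightarrow> real) \<Rightarrow> real" where
  "sphere_inner f g = (\<integral>x. f x * g x \<partial>sphere_measure)"

definition orthonormal_harmonic_basis ::
    "nat \<Rightarrow> 'j set \<Rightarrow> ('j \<Rightarrow> 'a::euclidean_space \<Rightarrow> real) \<Rightarrow> bool" where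
  "orthonormal_harmonic_basis l J Y \<longleftrightarrow>
     finite J \<and>
     (\<forall>j\<in>J. Y j \<in> spherical_harmonics l) \<and>
     (\<forall>i\<in>J. \<forall>j\<in>J. sphere_inner (Y i) (Y j) = (if i = j then 1 else 0)) \<and>
     (\<forall>h\<in>spherical_harmonics l. \<exists>c. h = (\<lambda>x. \<Sum>j\<in>J. c j * Y j x))"


section \<open>Random invariant polynomials\<close>

definition harmonic_degrees :: "nat \<Rightarrow> nat set" where
  "harmonic_degrees d = {l. l \<le> d \<and> even (d - l)}"

lemma harmonic_degrees_halves: "l \<in> harmonic_degrees d \<Longrightarrow> d = l + 2 * ((d - l) div 2)"
  unfolding harmonic_degrees_def
  by (metis (no_types, lifting) dvd_mult_div_cancel le_add_diff_inverse mem_Collect_eq)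

text \<open>
  The degree-\<open>l\<close> part of \<open>f\<close> is \<open>\<parallel>x\<parallel>^(d - l) h x\<close> with \<open>h\<close> the solid harmonic of degree \<open>l\<close> restricting
  to \<open>Y\<close>, that is \<open>\<parallel>x\<parallel>^d Y (x / \<parallel>x\<parallel>)\<close>.  The factor \<open>\<parallel>x\<parallel>^(d - l) Y (x / \<parallel>x\<parallel>)\<close>, as it is sometimes
  written, would only be homogeneous of degree \<open>d - l\<close>; the two agree on the unit sphere.
\<close>

definition invariant_polynomial ::
    "nat \<Rightarrow> (nat \<Rightarrow> real) \<Rightarrow> (nat \<Rightarrow> 'j set) \<Rightarrow> (nat \<Rightarrow> 'j \<Rightarrow> 'a::euclidean_space \<Rightarrow> real)
      \<Rightarrow> (nat \<Rightarrow> 'j \<Rightarrow> real) \<Rightarrow> 'a \<Rightarrow> real" where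
  "invariant_polynomial d q J Y a x =
     (\<Sum>l\<in>harmonic_degrees d. q l *
        (\<Sum>j\<in>J l. a l j * norm x ^ d * Y l j (x /\<^sub>R norm x)))"

lemma invariant_polynomial_homogeneous:
  fixes Y :: "nat \<Rightarrow> 'j \<Rightarrow> 'a::euclidean_space \<Rightarrow> real"
  assumes "\<And>l. orthonormal_harmonic_basis l (J l) (Y l)" and "d \<ge> 1"
  shows "invariant_polynomial d q J Y a \<in> homogeneous_polynomials d"
proof -
  have "\<exists>h. h \<in> homogeneous_polynomials l \<and> Y l j = (\<lambda>x. if x \<in> sphere 0 1 then h x else 0)"
    if "j \<in> J l" for l j
    using assms(1)[of l] that
    by (fastforce simp: orthonormal_harmonic_basis_def spherical_harmonics_def)
  then have "\<forall>l j. \<exists>h. j \<in> J l \<longrightarrow>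
      h \<in> homogeneous_polynomials l \<and> Y l j = (\<lambda>x. if x \<in> sphere 0 1 then h x else 0)"
    by blast
  then obtain h where h: "\<And>l j. j \<in> J l \<Longrightarrow> h l j \<in> homogeneous_polynomials l"
    and Y: "\<And>l j. j \<in> J l \<Longrightarrow> Y l j = (\<lambda>x. if x \<in> sphere 0 1 then h l j x else 0)"
    unfolding choice_iff by blast
  have fin: "finite (J l)" for l
    using assms(1) by (simp add: orthonormal_harmonic_basis_def)
  have finH: "finite (harmonic_degrees d)"
    by (rule finite_subset[of _ "{..d}"]) (auto simp: harmonic_degrees_def)
  have hom: "h l j (t *\<^sub>R x) = t ^ l * h l j x" if "j \<in> J l" for l j t x
    using h[OF that] by (simp add: homogeneous_polynomials_def)
  have term_eq: "norm x ^ d * Y l j (x /\<^sub>R norm x) = (x \<bullet> x) ^ ((d - l) div 2) * h l j x"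
    if l: "l \<in> harmonic_degrees d" and j: "j \<in> J l" for l j x
  proof -
    define k where "k = (d - l) div 2"
    with l have d: "d = l + 2 * k"
      using harmonic_degrees_halves by blast
    show ?thesis
    proof (cases "x = 0")
      case True
      have "h l j 0 = 0 ^ l * h l j 0"
        using hom[OF j, of 0 0] by simp
      then have "k = 0 \<Longrightarrow> h l j 0 = 0"
        using assms(2) d by (simp add: power_0_left)
      then show ?thesis
        using True d by (cases "k = 0") (simp_all add: Y[OF j] power_0_left)
    next
      case False
      have "h l j x = norm x ^ l * h l j (x /\<^sub>R norm x)"
        using hom[OF j, of "norm x" "x /\<^sub>R norm x"] False by simp
      moreover have "(x \<bullet> x) ^ k = norm x ^ (2 * k)"
        by (simp add: dot_square_norm power_mult)
      ultimately show ?thesis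
        using False d by (simp add: Y[OF j] power_add)
    qed
  qed
  have eq: "invariant_polynomial d q J Y a =
      (\<lambda>x. \<Sum>l\<in>harmonic_degrees d. q l *
        (\<Sum>j\<in>J l. a l j * ((x \<bullet> x) ^ ((d - l) div 2) * h l j x)))"
    unfolding invariant_polynomial_def
    by (intro ext sum.cong arg_cong[where f = "(*) (q _)"] refl)
       (simp only: term_eq mult.assoc)
  have inner_poly: "real_polynomial_function (\<lambda>x::'a. x \<bullet> x)"
  proof -
    have "real_polynomial_function (\<lambda>x::'a. \<Sum>b\<in>Basis. (x \<bullet> b) * (x \<bullet> b))"
      by (intro real_polynomial_function_sum finite_Basis real_polynomial_function.intros(4)
            real_polynomial_function.intros(1) bounded_linear_inner_left)
    then show ?thesis
      by (simp add: euclidean_inner[symmetric])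
  qed
  have "real_polynomial_function (invariant_polynomial d q J Y a)"
    unfolding eq
  proof (intro real_polynomial_function_sum real_polynomial_function.intros(4)
      real_polynomial_function.intros(2) real_polynomial_function_power inner_poly fin finH)
    show "real_polynomial_function (h l j)" if "j \<in> J l" for l j
      using h[OF that] by (simp add: homogeneous_polynomials_def)
  qed
  moreover have "invariant_polynomial d q J Y a (t *\<^sub>R x) =
      t ^ d * invariant_polynomial d q J Y a x" for t x
  proof -
    have "((t *\<^sub>R x) \<bullet> (t *\<^sub>R x)) ^ ((d - l) div 2) * h l j (t *\<^sub>R x) =
        t ^ d * ((x \<bullet> x) ^ ((d - l) div 2) * h l j x)"
      if l: "l \<in> harmonic_degrees d" and j: "j \<in> J l" for l j
    proof -
      have "t ^ d = t ^ (l + 2 * ((d - l) div 2))"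
        using harmonic_degrees_halves[OF l] by simp
      then have "(t * t) ^ ((d - l) div 2) * t ^ l = t ^ d"
        by (simp add: power_add power_mult power2_eq_square)
      moreover have "(t *\<^sub>R x) \<bullet> (t *\<^sub>R x) = (t * t) * (x \<bullet> x)"
        by (simp add: mult.assoc)
      ultimately show ?thesis
        by (simp add: hom[OF j] power_mult_distrib mult_ac)
    qed
    then show ?thesis
      unfolding eq sum_distrib_left
      by (intro sum.cong refl) (simp only: mult.left_commute)
  qed
  ultimately show ?thesis
    by (simp add: homogeneous_polynomials_def)
qed

definition iid_standard_gaussian :: "'w measure \<Rightarrow> 'i set \<Rightarrow> ('i \<Rightarrow> 'w \<Rightarrow> real) \<Rightarrow> bool" where
  "iid_standard_gaussian M I X \<longleftrightarrow>
     prob_space M \<and>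
     prob_space.indep_vars M (\<lambda>_. borel) X I \<and>
     (\<forall>i\<in>I. distributed M lborel (X i) std_normal_density)"


section \<open>Coherent families\<close>

text \<open>
  \<open>step_extension d q Q\<close>: on \<open>[0,\<infinity>)\<close> the function \<open>Q\<close> is a step function extending the weights
  \<open>q\<close>.  At an integer of the wrong parity, \<open>Q\<close> may take the value from either adjacent interval;
  values of \<open>Q\<close> at negative arguments are irrelevant.
\<close>

definition step_extension :: "nat \<Rightarrow> (nat \<Rightarrow> real) \<Rightarrow> (real \<Rightarrow> real) \<Rightarrow> bool" where
  "step_extension d q Q \<longleftrightarrow>
     (\<forall>l\<in>harmonic_degrees d. Q (real l) = q l) \<and>
     (\<forall>k<d. \<forall>x\<in>{real k<..<real (k + 1)}.
        Q x = (if k \<in> harmonic_degrees d then q k else q (k + 1))) \<and>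
     (\<forall>m\<le>d. m \<notin> harmonic_degrees d \<longrightarrow>
        (\<exists>k<d. (m = k \<or> m = k + 1) \<and> (\<forall>x\<in>{real k<..<real (k + 1)}. Q (real m) = Q x))) \<and>
     (\<forall>x>real d. Q x = 0)"

definition coherent_family ::
    "(nat \<Rightarrow> nat \<Rightarrow> real) \<Rightarrow> real \<Rightarrow> (real \<Rightarrow> real) \<Rightarrow> bool" where
  "coherent_family p lam psi \<longleftrightarrow>
     (\<forall>d\<ge>1. \<forall>l\<in>harmonic_degrees d. p d l \<ge> 0) \<and>
     (\<forall>d\<ge>1. (\<Sum>l\<in>harmonic_degrees d. p d l) = 1) \<and>
     0 < lam \<and> lam \<le> 1 \<and>
     set_integrable lborel {0..} psi \<and> (\<exists>x\<ge>0. psi x \<noteq> 0) \<and>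
     (\<exists>Q. (\<forall>d\<ge>1. step_extension d (p d) (Q d)) \<and>
        (\<forall>x\<ge>0. (\<lambda>d. real d powr lam * Q d (real d powr lam * x)) \<longlonglongrightarrow> psi x) \<and>
        (\<exists>a1>0. \<exists>a2>0. \<forall>d\<ge>1. \<forall>x\<ge>0.
           real d powr lam * Q d (real d powr lam * x) \<le> a1 * exp (- a2 * x\<^sup>2)))"


section \<open>Hypersurfaces in real projective space\<close>

text \<open>The point \<open>[x]\<close> is the line \<open>span {x}\<close>; projective space carries the quotient topology.\<close>

definition proj_point :: "'a::euclidean_space \<Rightarrow> 'a set" where
  "proj_point x = span {x}"

definition proj_topology :: "'a::euclidean_space set topology" where
  "proj_topology =
     topology (\<lambda>U. U \<subseteq> proj_point ` (- {0}) \<and> open {x. x \<noteq> 0 \<and> proj_point x \<in> U})"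

lemma openin_proj_topology:
  "openin proj_topology U \<longleftrightarrow>
     U \<subseteq> proj_point ` (- {0 :: 'a::euclidean_space}) \<and> open {x. x \<noteq> 0 \<and> proj_point x \<in> U}"
proof -
  have "istopology (\<lambda>U. U \<subseteq> proj_point ` (- {0 :: 'a}) \<and> open {x. x \<noteq> 0 \<and> proj_point x \<in> U})"
    unfolding istopology_def
  proof (intro conjI allI impI)
    fix S T :: "'a set set"
    assume "S \<subseteq> proj_point ` (- {0}) \<and> open {x. x \<noteq> 0 \<and> proj_point x \<in> S}"
      and "T \<subseteq> proj_point ` (- {0}) \<and> open {x. x \<noteq> 0 \<and> proj_point x \<in> T}"
    moreover have "{x. x \<noteq> 0 \<and> proj_point x \<in> S \<inter> T} =
        {x. x \<noteq> 0 \<and> proj_point x \<in> S} \<inter> {x. x \<noteq> 0 \<and> proj_point x \<in> T}"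
      by auto
    ultimately show "S \<inter> T \<subseteq> proj_point ` (- {0})" "open {x. x \<noteq> 0 \<and> proj_point x \<in> S \<inter> T}"
      by (auto intro: open_Int)
  next
    fix K :: "'a set set set"
    assume K: "\<forall>S\<in>K. S \<subseteq> proj_point ` (- {0}) \<and> open {x. x \<noteq> 0 \<and> proj_point x \<in> S}"
    then show "\<Union>K \<subseteq> proj_point ` (- {0})"
      by blast
    have "{x. x \<noteq> 0 \<and> proj_point x \<in> \<Union>K} = (\<Union>S\<in>K. {x. x \<noteq> 0 \<and> proj_point x \<in> S})"
      by auto
    then show "open {x. x \<noteq> 0 \<and> proj_point x \<in> \<Union>K}"
      using K by (auto intro: open_UN)
  qed
  then show ?thesis
    by (simp add: proj_topology_def topology_inverse')
qed

lemma topspace_proj_topology: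
  "topspace proj_topology = proj_point ` (- {0 :: 'a::euclidean_space})"
proof -
  have "{x :: 'a. x \<noteq> 0 \<and> proj_point x \<in> proj_point ` (- {0})} = - {0}"
    by auto
  then have "openin proj_topology (proj_point ` (- {0 :: 'a}))"
    by (simp add: openin_proj_topology open_Compl)
  then show ?thesis
    by (auto simp: topspace_def openin_proj_topology)
qed

lemma quotient_map_proj_point:
  "quotient_map (top_of_set (- {0 :: 'a::euclidean_space})) proj_topology proj_point"
proof -
  have "openin (top_of_set (- {0 :: 'a})) {x \<in> - {0}. proj_point x \<in> U} \<longleftrightarrow>
      open {x. x \<noteq> 0 \<and> proj_point x \<in> U}" for U
    by (subst openin_open_eq) (auto intro: open_Compl)
  then show ?thesis
    unfolding quotient_map_def topspace_proj_topology
    by (simp add: openin_proj_topology)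
qed

definition proj_zero_set :: "('a::euclidean_space \<Rightarrow> real) \<Rightarrow> 'a set set" where
  "proj_zero_set f = {proj_point x | x. x \<noteq> 0 \<and> f x = 0}"

definition num_components :: "'b topology \<Rightarrow> enat" where
  "num_components T =
     (if finite (connected_components_of T) then enat (card (connected_components_of T)) else \<infinity>)"

definition b0 :: "'a::euclidean_space set set \<Rightarrow> enat" where
  "b0 X = num_components (subtopology proj_topology X)"

end

theory Submission
  imports Defs
begin

text \<open>
  The proof is the barrier method of Nazarov and Sodin, carried out at the scale \<open>1 / D\<close> with
  \<open>D = d powr \<lambda>\<close>. If \<open>f\<close> is positive at a unit vector \<open>u\<close> and negative on the rim of a
  cone of aperture \<open>\<rho>\<close> around \<open>u\<close>, then the zero set in projective space has a component
  inside that cone. About \<open>\<rho> powr - n\<close> such cones fit disjointly into projective space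
  (\<open>disjoint_cones_packing\<close>). So it is enough to find \<open>\<rho>\<close> of order \<open>1 / D\<close> and a constant \<open>\<pi> > 0\<close>
  such that each of these sign patterns has probability at least \<open>\<pi>\<close>, and to add up expectations.

  To produce the sign pattern, replace \<open>f\<close> by the function \<open>F\<close> in which every spherical harmonic is
  extended to a solid harmonic: it agrees with \<open>f\<close> on the sphere and is harmonic on the whole space.
  Let \<open>Z\<^sub>l\<close> be the reproducing kernel of the harmonics of degree \<open>l\<close>. The barrier is
  \<open>g * (\<Sum>l\<in>B. p\<^sub>d l * Z\<^sub>l u x)\<close> with \<open>l\<close> running through a band \<open>B\<close> of comparable degrees. It is
  positive at \<open>u\<close>. Near \<open>u\<close>, the kernel \<open>Z\<^sub>l u x\<close> is its value at \<open>u\<close> times a profile close to a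
  Bessel function of \<open>l\<close> times the angle between \<open>u\<close> and \<open>x\<close> (\<open>zonal_profile_near_bessel\<close>). This
  Bessel function is negative somewhere, so one aperture \<open>\<rho>\<close> makes all kernels of a sufficiently
  narrow band negative on the rim (\<open>zonal_profile_negative_band\<close>). The Gaussian bound and the
  normalisation of the weights give such a band, with degrees of order \<open>D\<close>, that carries a fixed
  fraction of the total weight (\<open>weight_estimates\<close>).

  The barrier is \<open>F\<close> for a particular coefficient vector, whose norm \<open>\<beta>\<close> is bounded independently
  of \<open>d\<close> if \<open>g\<close> is of order \<open>D powr - n / 2\<close>. Translating a Gaussian vector by a vector of norm \<open>\<beta>\<close>
  costs only a factor depending on \<open>\<beta>\<close> in the probability that the vector lies in a set of
  probability at least three quarters (\<open>gaussian_shifted_small_ball\<close>). So it remains to see that with such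
  a probability the untranslated \<open>F\<close> is smaller than the barrier on the cap of radius \<open>\<rho>\<close>. As \<open>F\<close> is
  harmonic, its square at a point of the cap is at most its mean square over a ball of radius \<open>1 / D\<close>
  (\<open>square_le_ball_average\<close>). The expectation of the latter is computed from \<open>Z\<^sub>l x x\<close>, and Markov's
  inequality bounds the fluctuation on the whole cap at once.

  Both estimates need the value \<open>Z\<^sub>l u u\<close> up to constants. It grows like \<open>l ^ (n - 1)\<close>. This comes
  from a three-term recurrence of the zonal harmonics together with the orthogonality of the zonal
  harmonics of degrees \<open>l\<close> and \<open>l + 2\<close> (\<open>mass_recurrence\<close>, \<open>mass_bounds\<close>). Invariance under rotations
  is used only through reflections: they are explicit, and any two vectors of equal length are
  exchanged by one.
\<close>

section \<open>Polynomials along lines and the Laplacian\<close>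

text \<open>
  Harmonic polynomials on the whole space, without the restriction to the sphere: the mean value
  property needs them there.
\<close>

definition solid_harmonics :: "nat \<Rightarrow> ('a::euclidean_space \<Rightarrow> real) set" where
  "solid_harmonics l = {h \<in> homogeneous_polynomials l. \<forall>x. laplacian h x = 0}"

lemma deriv2_poly: "(deriv ^^ 2) (poly p) (0::real) = 2 * coeff p 2"
proof -
  have *: "deriv (poly q) = poly (pderiv q)" for q :: "real poly"
    by (rule ext) (rule DERIV_imp_deriv, rule poly_DERIV)
  have "(deriv ^^ 2) (poly p) 0 = poly (pderiv (pderiv p)) 0"
    by (simp add: numeral_2_eq_2 *)
  also have "\<dots> = 2 * coeff p 2"
    by (simp add: poly_0_coeff_0 coeff_pderiv numeral_2_eq_2)
  finally show ?thesis .
qed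

text \<open>
  Restricting a polynomial to lines through a point turns its differential and half of its Hessian
  into coefficients of univariate polynomials. The differential is carried along only because the
  Hessian of a product involves it.
\<close>

lemma polynomial_second_order:
  fixes f :: "'a::euclidean_space \<Rightarrow> real"
  assumes "real_polynomial_function f"
  shows "\<exists>g Q. linear g \<and> bilinear Q \<and>
     (\<forall>v. \<exists>p. (\<forall>t. f (x + t *\<^sub>R v) = poly p t) \<and> coeff p 1 = g v \<and> coeff p 2 = Q v v)"
  using assms
proof induction
  case (linear f)
  then have l: "linear f" by (rule bounded_linear.linear)
  have "\<exists>p. (\<forall>t. f (x + t *\<^sub>R v) = poly p t) \<and> coeff p 1 = f v \<and> coeff p 2 = 0" for v
    by (rule exI[of _ "[:f x, f v:]"])
       (simp add: linear_add[OF l] linear_scale[OF l] numeral_2_eq_2)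
  moreover have "bilinear (\<lambda>v w::'a. 0::real)"
    by (simp add: bilinear_def linear_iff)
  ultimately show ?case using l by blast
next
  case (const c)
  have "\<exists>p. (\<forall>t. c = poly p t) \<and> coeff p 1 = 0 \<and> coeff p 2 = 0"
    by (rule exI[of _ "[:c:]"]) (simp add: numeral_2_eq_2)
  moreover have "bilinear (\<lambda>v w::'a. 0::real)" "linear (\<lambda>v::'a. 0::real)"
    by (simp_all add: bilinear_def linear_iff)
  ultimately show ?case by blast
next
  case (add f1 f2)
  from add obtain g1 Q1 where 1: "linear g1" "bilinear Q1"
    "\<And>v. \<exists>p. (\<forall>t. f1 (x + t *\<^sub>R v) = poly p t) \<and> coeff p 1 = g1 v \<and> coeff p 2 = Q1 v v" by blast
  from add obtain g2 Q2 where 2: "linear g2" "bilinear Q2"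
    "\<And>v. \<exists>p. (\<forall>t. f2 (x + t *\<^sub>R v) = poly p t) \<and> coeff p 1 = g2 v \<and> coeff p 2 = Q2 v v" by blast
  have "linear (\<lambda>v. g1 v + g2 v)" using 1 2 by (intro linear_compose_add)
  moreover have "bilinear (\<lambda>v w. Q1 v w + Q2 v w)"
    using 1 2 by (simp add: bilinear_def linear_compose_add)
  moreover have "\<exists>p. (\<forall>t. f1 (x + t *\<^sub>R v) + f2 (x + t *\<^sub>R v) = poly p t) \<and>
      coeff p 1 = g1 v + g2 v \<and> coeff p 2 = Q1 v v + Q2 v v" for v
  proof -
    from 1(3)[of v] 2(3)[of v] obtain p1 p2 where
      "\<And>t. f1 (x + t *\<^sub>R v) = poly p1 t" "coeff p1 1 = g1 v" "coeff p1 2 = Q1 v v"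
      "\<And>t. f2 (x + t *\<^sub>R v) = poly p2 t" "coeff p2 1 = g2 v" "coeff p2 2 = Q2 v v" by blast
    then show ?thesis by (intro exI[of _ "p1 + p2"]) simp
  qed
  ultimately show ?case by blast
next
  case (mult f1 f2)
  from mult obtain g1 Q1 where 1: "linear g1" "bilinear Q1"
    "\<And>v. \<exists>p. (\<forall>t. f1 (x + t *\<^sub>R v) = poly p t) \<and> coeff p 1 = g1 v \<and> coeff p 2 = Q1 v v" by blast
  from mult obtain g2 Q2 where 2: "linear g2" "bilinear Q2"
    "\<And>v. \<exists>p. (\<forall>t. f2 (x + t *\<^sub>R v) = poly p t) \<and> coeff p 1 = g2 v \<and> coeff p 2 = Q2 v v" by blast
  have "linear (\<lambda>v. f1 x * g2 v + g1 v * f2 x)" using 1 2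
    by (auto simp: linear_iff algebra_simps)
  moreover have "bilinear (\<lambda>v w. f1 x * Q2 v w + g1 v * g2 w + Q1 v w * f2 x)"
    using 1 2 by (auto simp: bilinear_def linear_iff algebra_simps)
  moreover have "\<exists>p. (\<forall>t. f1 (x + t *\<^sub>R v) * f2 (x + t *\<^sub>R v) = poly p t) \<and>
      coeff p 1 = f1 x * g2 v + g1 v * f2 x \<and>
      coeff p 2 = f1 x * Q2 v v + g1 v * g2 v + Q1 v v * f2 x" for v
  proof -
    from 1(3)[of v] 2(3)[of v] obtain p1 p2 where
      p: "\<And>t. f1 (x + t *\<^sub>R v) = poly p1 t" "coeff p1 1 = g1 v" "coeff p1 2 = Q1 v v"
      "\<And>t. f2 (x + t *\<^sub>R v) = poly p2 t" "coeff p2 1 = g2 v" "coeff p2 2 = Q2 v v" by blast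
    have "coeff p1 0 = f1 x" "coeff p2 0 = f2 x"
      using p(1)[of 0] p(4)[of 0] by (simp_all add: poly_0_coeff_0)
    then show ?thesis using p by (intro exI[of _ "p1 * p2"])
      (simp add: coeff_mult numeral_2_eq_2)
  qed
  ultimately show ?case by blast
qed

lemma polynomial_on_line:
  fixes f :: "'a::euclidean_space \<Rightarrow> real"
  assumes "real_polynomial_function f"
  obtains p where "\<And>t. f (x + t *\<^sub>R v) = poly p t"
  using polynomial_second_order[OF assms, of x] by blast

lemma deriv2_line:
  fixes f :: "'a::euclidean_space \<Rightarrow> real"
  assumes "\<And>t. f (x + t *\<^sub>R v) = poly p t"
  shows "(deriv ^^ 2) (\<lambda>t. f (x + t *\<^sub>R v)) 0 = 2 * coeff p 2"
proof -
  have "(\<lambda>t. f (x + t *\<^sub>R v)) = poly p" using assms by auto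
  then show ?thesis by (simp only: deriv2_poly)
qed

lemma hessian_exists:
  fixes f :: "'a::euclidean_space \<Rightarrow> real"
  assumes "real_polynomial_function f"
  obtains Q where "bilinear Q" "\<And>v. (deriv ^^ 2) (\<lambda>t. f (x + t *\<^sub>R v)) 0 = Q v v"
proof -
  obtain g Q where Q: "bilinear Q" and
    *: "\<And>v. \<exists>p. (\<forall>t. f (x + t *\<^sub>R v) = poly p t) \<and> coeff p 1 = g v \<and> coeff p 2 = Q v v"
    using polynomial_second_order[OF assms, of x] by blast
  have "bilinear (\<lambda>v w. 2 * Q v w)" using Q by (auto simp: bilinear_def linear_iff algebra_simps)
  moreover have "(deriv ^^ 2) (\<lambda>t. f (x + t *\<^sub>R v)) 0 = 2 * Q v v" for v
    using *[of v] deriv2_line by metis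
  ultimately show ?thesis by (rule that)
qed

text \<open>
  The Laplacian is the trace of the Hessian form, and the trace of a bilinear form can be computed in
  the orthonormal basis \<open>T ` Basis\<close> as well as in \<open>Basis\<close>.
\<close>

lemma laplacian_orthogonal:
  fixes f :: "'a::euclidean_space \<Rightarrow> real" and T :: "'a \<Rightarrow> 'a"
  assumes f: "real_polynomial_function f" and T: "orthogonal_transformation T"
  shows "laplacian (\<lambda>y. f (T y)) x = laplacian f (T x)"
proof -
  have lT: "linear T" using T by (rule orthogonal_transformation_linear)
  obtain Q where Q: "bilinear Q"
    and D: "\<And>v. (deriv ^^ 2) (\<lambda>t. f (T x + t *\<^sub>R v)) 0 = Q v v"
    by (rule hessian_exists[OF f, where x = "T x"]) blast
  have "laplacian (\<lambda>y. f (T y)) x = (\<Sum>b\<in>Basis. Q (T b) (T b))"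
    unfolding laplacian_def by (simp add: linear_add[OF lT] linear_scale[OF lT] D)
  also have "\<dots> = (\<Sum>b\<in>Basis. \<Sum>c\<in>Basis. \<Sum>c'\<in>Basis. ((T b \<bullet> c) * (T b \<bullet> c')) * Q c c')"
  proof (rule sum.cong[OF refl])
    fix b :: 'a
    have "Q (T b) (T b) = Q (\<Sum>c\<in>Basis. (T b \<bullet> c) *\<^sub>R c) (\<Sum>c'\<in>Basis. (T b \<bullet> c') *\<^sub>R c')"
      by (simp only: euclidean_representation)
    also have "\<dots> = (\<Sum>c\<in>Basis. \<Sum>c'\<in>Basis. ((T b \<bullet> c) * (T b \<bullet> c')) * Q c c')"
      unfolding bilinear_sum[OF Q] sum.cartesian_product[symmetric]
      by (simp add: bilinear_lmul[OF Q] bilinear_rmul[OF Q] mult_ac)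
    finally show "Q (T b) (T b) = \<dots>" .
  qed
  also have "\<dots> = (\<Sum>c\<in>Basis. \<Sum>c'\<in>Basis. (\<Sum>b\<in>Basis. (T b \<bullet> c) * (T b \<bullet> c')) * Q c c')"
    unfolding sum_distrib_right
    by (subst sum.swap, rule sum.cong[OF refl], rule sum.swap)
  also have "\<dots> = (\<Sum>c\<in>Basis. \<Sum>c'\<in>Basis. (c \<bullet> c') * Q c c')"
  proof (intro sum.cong refl arg_cong2[where f = "(*)"])
    fix c c' :: 'a
    obtain S where S: "\<And>y. T (S y) = y"
      using orthogonal_transformation_surj[OF T] by (metis surjD)
    have TS: "T b \<bullet> y = b \<bullet> S y" for b y
      using T S[of y] unfolding orthogonal_transformation_def by metis
    have "(\<Sum>b\<in>Basis. (T b \<bullet> c) * (T b \<bullet> c')) = S c \<bullet> S c'"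
      unfolding TS by (subst (3) euclidean_inner) (simp add: inner_commute)
    also have "\<dots> = c \<bullet> c'"
      using T S unfolding orthogonal_transformation_def by metis
    finally show "(\<Sum>b\<in>Basis. (T b \<bullet> c) * (T b \<bullet> c')) = c \<bullet> c'" .
  qed
  also have "\<dots> = (\<Sum>c\<in>Basis. Q c c)"
    by (simp add: inner_Basis if_distrib[of "\<lambda>x. x * _"] sum.delta cong: if_cong)
  also have "\<dots> = laplacian f (T x)"
    unfolding laplacian_def by (simp add: D)
  finally show ?thesis .
qed

lemma laplacian_coeff:
  fixes f :: "'a::euclidean_space \<Rightarrow> real"
  assumes "\<And>b t. b \<in> Basis \<Longrightarrow> f (x + t *\<^sub>R b) = poly (p b) t"
  shows "laplacian f x = 2 * (\<Sum>b\<in>Basis. coeff (p b) 2)"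
  unfolding laplacian_def sum_distrib_left
  by (intro sum.cong refl deriv2_line assms)

lemma laplacian_linear_combination:
  fixes f :: "'i \<Rightarrow> 'a::euclidean_space \<Rightarrow> real"
  assumes "\<And>i. i \<in> I \<Longrightarrow> real_polynomial_function (f i)"
  shows "laplacian (\<lambda>x. \<Sum>i\<in>I. c i * f i x) x = (\<Sum>i\<in>I. c i * laplacian (f i) x)"
proof -
  have "\<exists>p. \<forall>t. f i (x + t *\<^sub>R b) = poly p t" if "i \<in> I" for i b
    using polynomial_on_line[OF assms[OF that]] by metis
  then obtain p where p: "\<And>i b t. i \<in> I \<Longrightarrow> f i (x + t *\<^sub>R b) = poly (p i b) t" by metis
  have "laplacian (\<lambda>x. \<Sum>i\<in>I. c i * f i x) x = 2 * (\<Sum>b\<in>Basis. coeff (\<Sum>i\<in>I. smult (c i) (p i b)) 2)"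
    by (rule laplacian_coeff) (simp add: poly_sum p)
  also have "\<dots> = (\<Sum>i\<in>I. c i * (2 * (\<Sum>b\<in>Basis. coeff (p i b) 2)))"
    by (simp add: coeff_sum sum_distrib_left mult_ac) (rule sum.swap)
  also have "\<dots> = (\<Sum>i\<in>I. c i * laplacian (f i) x)"
    by (intro sum.cong refl arg_cong2[where f="(*)"] laplacian_coeff[symmetric]) (simp add: p)
  finally show ?thesis .
qed

lemma solid_harmonicsD:
  assumes "h \<in> solid_harmonics l"
  shows "real_polynomial_function h" "h (t *\<^sub>R x) = t ^ l * h x" "laplacian h x = 0"
  using assms by (auto simp: solid_harmonics_def homogeneous_polynomials_def)

lemma solid_harmonics_combination:
  assumes "\<And>i. i \<in> I \<Longrightarrow> f i \<in> solid_harmonics l" "finite I"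
  shows "(\<lambda>x. \<Sum>i\<in>I. c i * f i x) \<in> solid_harmonics l"
proof -
  have "real_polynomial_function (\<lambda>x. \<Sum>i\<in>I. c i * f i x)"
    using assms by (intro real_polynomial_function_sum real_polynomial_function.intros(2,4))
      (auto intro: solid_harmonicsD)
  moreover have "(\<Sum>i\<in>I. c i * f i (t *\<^sub>R x)) = t ^ l * (\<Sum>i\<in>I. c i * f i x)" for t x
    unfolding sum_distrib_left
    by (intro sum.cong refl) (simp add: solid_harmonicsD(2)[OF assms(1)])
  moreover have "laplacian (\<lambda>x. \<Sum>i\<in>I. c i * f i x) x = 0" for x
    by (subst laplacian_linear_combination)
      (simp_all add: solid_harmonicsD(1)[OF assms(1)] solid_harmonicsD(3)[OF assms(1)])
  ultimately show ?thesis by (simp add: solid_harmonics_def homogeneous_polynomials_def)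
qed

lemma real_polynomial_function_compose_linear:
  fixes f :: "'a::euclidean_space \<Rightarrow> real" and T :: "'a \<Rightarrow> 'a"
  assumes "real_polynomial_function f" "linear T"
  shows "real_polynomial_function (\<lambda>x. f (T x))"
  using assms(1)
proof induction
  case (linear f)
  then show ?case
    using assms(2) by (intro real_polynomial_function.intros)
      (auto intro: bounded_linear_compose linear_conv_bounded_linear[THEN iffD1])
qed (auto intro: real_polynomial_function.intros)

lemma solid_harmonics_orthogonal:
  fixes T :: "'a::euclidean_space \<Rightarrow> 'a"
  assumes h: "h \<in> solid_harmonics l" and T: "orthogonal_transformation T"
  shows "(\<lambda>x. h (T x)) \<in> solid_harmonics l"
proof -
  have lT: "linear T" using T by (rule orthogonal_transformation_linear)
  show ?thesis
    using solid_harmonicsD[OF h] real_polynomial_function_compose_linear[OF solid_harmonicsD(1)[OF h] lT]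
    by (simp add: solid_harmonics_def homogeneous_polynomials_def linear_scale[OF lT]
        laplacian_orthogonal[OF _ T])
qed

lemma solid_harmonics_eqI:
  fixes g h :: "'a::euclidean_space \<Rightarrow> real"
  assumes g: "g \<in> solid_harmonics l" and h: "h \<in> solid_harmonics l"
    and eq: "\<And>x. norm x = 1 \<Longrightarrow> g x = h x"
  shows "g = h"
proof
  fix x
  obtain e :: 'a where e: "norm e = 1" using nonempty_Basis norm_Basis by blast
  show "g x = h x"
  proof (cases "x = 0")
    case True
    then show ?thesis
      using solid_harmonicsD(2)[OF g, of 0 e] solid_harmonicsD(2)[OF h, of 0 e] eq[OF e] by simp
  next
    case False
    then have "norm (x /\<^sub>R norm x) = 1" "x = norm x *\<^sub>R (x /\<^sub>R norm x)" by simp_all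
    then show ?thesis
      using solid_harmonicsD(2)[OF g] solid_harmonicsD(2)[OF h] eq by metis
  qed
qed

section \<open>Reflections and the surface measure of the sphere\<close>

text \<open>
  For \<open>v = 0\<close> this is the identity. The vector \<open>x - y\<close> can therefore be used to
  exchange \<open>x\<close> and \<open>y\<close> without assuming that they are different.
\<close>

definition reflection :: "'a::euclidean_space \<Rightarrow> 'a \<Rightarrow> 'a" where
  "reflection v x = x - (2 * (x \<bullet> v) / (v \<bullet> v)) *\<^sub>R v"

lemma orthogonal_reflection: "orthogonal_transformation (reflection v)"
proof (cases "v = 0")
  case True
  then have "reflection v = (\<lambda>x. x)" by (auto simp: reflection_def)
  then show ?thesis by simp
next
  case False
  have "linear (reflection v)"
    by (rule linearI) (simp_all add: reflection_def algebra_simps add_divide_distrib)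
  moreover have "reflection v x \<bullet> reflection v y = x \<bullet> y" for x y
    using False by (simp add: reflection_def inner_diff_left inner_diff_right inner_commute field_simps)
  ultimately show ?thesis by (simp add: orthogonal_transformation_def)
qed

lemma reflection_reflection [simp]: "reflection v (reflection v x) = x"
  by (cases "v = 0") (simp_all add: reflection_def inner_diff_left algebra_simps)

lemma reflection_fixes: "x \<bullet> v = 0 \<Longrightarrow> reflection v x = x"
  by (simp add: reflection_def)

lemma reflection_swaps:
  assumes "norm x = norm y"
  shows "reflection (x - y) x = y"
proof (cases "x = y")
  case True then show ?thesis by (simp add: reflection_def)
next
  case False
  have "x \<bullet> x = y \<bullet> y" using assms by (simp add: dot_square_norm)
  then have "2 * (x \<bullet> (x - y)) = (x - y) \<bullet> (x - y)"
    by (simp add: algebra_simps inner_commute)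
  then show ?thesis using False by (simp add: reflection_def)
qed

lemma reflection_swaps':
  assumes "norm x = norm y"
  shows "reflection (x - y) y = x"
  using reflection_swaps[OF assms] reflection_reflection by metis

lemma norm_reflection [simp]: "norm (reflection v x) = norm x"
  using orthogonal_reflection by (rule orthogonal_transformation_norm)

lemma linear_reflection: "linear (reflection v)"
  using orthogonal_reflection by (rule orthogonal_transformation_linear)

lemma measurable_reflection [measurable]: "reflection v \<in> borel_measurable borel"
  by (intro borel_measurable_continuous_onI linear_continuous_on linear_conv_bounded_linear[THEN iffD1]
      linear_reflection)

text \<open>
  Lebesgue measure is characterised by translation invariance up to a factor, and a reflection
  preserves the class of translation invariant measures. The factor is one because the unit ball is
  mapped to itself. Concretely, Fubini's theorem is applied to the pair of a set and the ball.
\<close>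

lemma distr_lborel_reflection: "distr lborel borel (reflection v) = (lborel :: 'a::euclidean_space measure)"
proof (rule measure_eqI)
  let ?T = "reflection v :: 'a \<Rightarrow> 'a" and ?B = "ball 0 1 :: 'a set"
  show "sets (distr lborel borel ?T) = sets lborel" by simp
  have [measurable]: "?B \<in> sets borel" by auto
  fix A :: "'a set" assume "A \<in> sets (distr lborel borel ?T)"
  then have A [measurable]: "A \<in> sets borel" by simp
  have shift: "(\<integral>\<^sup>+x. g (?T x + y) \<partial>lborel) = (\<integral>\<^sup>+x. g (?T x) \<partial>lborel)"
    if [measurable]: "g \<in> borel_measurable borel" for g :: "'a \<Rightarrow> ennreal" and y
  proof -
    have "(\<integral>\<^sup>+x. g (?T x) \<partial>lborel) = (\<integral>\<^sup>+x. g (?T x) \<partial>(distr lborel borel ((+) (?T y))))"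
      by (simp add: lborel_distr_plus)
    also have "\<dots> = (\<integral>\<^sup>+x. g (?T (?T y + x)) \<partial>lborel)"
      by (subst nn_integral_distr) auto
    also have "\<dots> = (\<integral>\<^sup>+x. g (?T x + y) \<partial>lborel)"
      by (simp add: linear_add[OF linear_reflection] add.commute)
    finally show ?thesis by simp
  qed
  have shift': "(\<integral>\<^sup>+x. g (x + y) \<partial>lborel) = (\<integral>\<^sup>+x. g x \<partial>lborel)"
    if [measurable]: "g \<in> borel_measurable borel" for g :: "'a \<Rightarrow> ennreal" and y
  proof -
    have "(\<integral>\<^sup>+x. g x \<partial>lborel) = (\<integral>\<^sup>+x. g x \<partial>(distr lborel borel ((+) y)))"
      by (simp add: lborel_distr_plus)
    also have "\<dots> = (\<integral>\<^sup>+x. g (x + y) \<partial>lborel)"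
      by (subst nn_integral_distr) (auto simp: add.commute)
    finally show ?thesis by simp
  qed
  let ?m = "\<integral>\<^sup>+x. indicator A (?T x) \<partial>lborel"
  have "emeasure lborel ?B * ?m = (\<integral>\<^sup>+y. indicator ?B y * ?m \<partial>lborel)"
    by (subst nn_integral_multc) auto
  also have "\<dots> = (\<integral>\<^sup>+y. indicator ?B y * (\<integral>\<^sup>+x. indicator A (?T x + y) \<partial>lborel) \<partial>lborel)"
    by (subst shift) auto
  also have "\<dots> = (\<integral>\<^sup>+y. (\<integral>\<^sup>+x. indicator ?B y * indicator A (?T x + y) \<partial>lborel) \<partial>lborel)"
    by (subst nn_integral_cmult) auto
  also have "\<dots> = (\<integral>\<^sup>+x. (\<integral>\<^sup>+y. indicator ?B y * indicator A (?T x + y) \<partial>lborel) \<partial>lborel)"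
    by (rule lborel_pair.Fubini') measurable
  also have "\<dots> = (\<integral>\<^sup>+x. (\<integral>\<^sup>+y. indicator ?B (y - ?T x) * indicator A y \<partial>lborel) \<partial>lborel)"
  proof (rule nn_integral_cong)
    fix x
    show "(\<integral>\<^sup>+y. indicator ?B y * indicator A (?T x + y) \<partial>lborel) =
        (\<integral>\<^sup>+y. indicator ?B (y - ?T x) * indicator A y \<partial>lborel)"
      by (subst shift'[where y = "?T x", symmetric]) (auto simp: add.commute)
  qed
  also have "\<dots> = (\<integral>\<^sup>+y. (\<integral>\<^sup>+x. indicator ?B (y - ?T x) * indicator A y \<partial>lborel) \<partial>lborel)"
    by (rule lborel_pair.Fubini') measurable
  also have "\<dots> = (\<integral>\<^sup>+y. emeasure lborel ?B * indicator A y \<partial>lborel)"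
  proof (rule nn_integral_cong)
    fix y
    have "(\<integral>\<^sup>+x. indicator ?B (y - ?T x) * indicator A y \<partial>lborel) =
        (\<integral>\<^sup>+x. indicator ?B (y - ?T x) \<partial>lborel) * indicator A y"
      by (subst nn_integral_multc) auto
    also have "(\<integral>\<^sup>+x. indicator ?B (y - ?T x) \<partial>lborel) = (\<integral>\<^sup>+x. indicator ?B (?T x + (- y)) \<partial>lborel)"
      by (intro nn_integral_cong) (auto simp: indicator_def norm_minus_commute)
    also have "\<dots> = (\<integral>\<^sup>+x. indicator ?B (?T x) \<partial>lborel)"
      by (rule shift) auto
    also have "\<dots> = (\<integral>\<^sup>+x. indicator ?B x \<partial>lborel)"
      by (intro nn_integral_cong) (auto simp: indicator_def)
    also have "\<dots> = emeasure lborel ?B" by simp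
    finally show "(\<integral>\<^sup>+x. indicator ?B (y - ?T x) * indicator A y \<partial>lborel) =
      emeasure lborel ?B * indicator A y" .
  qed
  also have "\<dots> = emeasure lborel ?B * emeasure lborel A"
    by (simp add: nn_integral_cmult)
  finally have "emeasure lborel ?B * ?m = emeasure lborel ?B * emeasure lborel A" .
  moreover have "emeasure lborel ?B \<noteq> 0"
    using content_ball_pos[of 1 "0::'a"] by (auto simp: measure_def)
  moreover have "emeasure lborel ?B \<noteq> top"
    using emeasure_lborel_ball_finite[of "0::'a" 1] by auto
  ultimately have "?m = emeasure lborel A"
    by (simp add: ennreal_mult_cancel_left)
  moreover have "?m = emeasure (distr lborel borel ?T) A"
  proof -
    have "emeasure (distr lborel borel ?T) A = (\<integral>\<^sup>+x. indicator A x \<partial>(distr lborel borel ?T))"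
      by simp
    also have "\<dots> = ?m" by (subst nn_integral_distr) auto
    finally show ?thesis by simp
  qed
  ultimately show "emeasure (distr lborel borel ?T) A = emeasure lborel A" by simp
qed

lemma lborel_integral_reflection:
  fixes g :: "'a::euclidean_space \<Rightarrow> real"
  assumes "g \<in> borel_measurable borel"
  shows "(\<integral>x. g (reflection v x) \<partial>lborel) = (\<integral>x. g x \<partial>lborel)"
  by (subst (2) distr_lborel_reflection[of v, symmetric]) (subst integral_distr, use assms in auto)

lemma sets_sphere_measure [measurable_cong, simp]: "sets sphere_measure = sets borel"
  and space_sphere_measure [simp]: "space sphere_measure = UNIV"
  by (simp_all add: sphere_measure_def space_scale_measure)

lemma sphere_measure_eq_density:
  "(sphere_measure :: 'a::euclidean_space measure) =
    density (distr (restrict_space lborel (cball 0 1 - {0})) borel (\<lambda>x::'a. x /\<^sub>R norm x))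
      (\<lambda>_. ennreal (real DIM('a)))"
  unfolding sphere_measure_def
  by (rule measure_eqI)
     (auto simp: emeasure_density nn_integral_cmult_indicator ennreal_of_nat_eq_real_of_nat)

lemma sphere_integral:
  fixes g :: "'a::euclidean_space \<Rightarrow> real"
  assumes [measurable]: "g \<in> borel_measurable borel"
  shows "(\<integral>x. g x \<partial>sphere_measure) =
    DIM('a) * (\<integral>x. indicator (cball 0 1 - {0}) x * g (x /\<^sub>R norm x) \<partial>lborel)"
proof -
  let ?N = "distr (restrict_space lborel (cball 0 1 - {0})) borel (\<lambda>x::'a. x /\<^sub>R norm x)"
  have m [measurable]: "(\<lambda>x::'a. x /\<^sub>R norm x) \<in> borel_measurable (restrict_space lborel (cball 0 1 - {0}))"
    by (rule measurable_restrict_space1) measurable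
  have "(\<integral>x. g x \<partial>sphere_measure) = (\<integral>x. real DIM('a) * g x \<partial>?N)"
    unfolding sphere_measure_eq_density by (subst integral_density) auto
  also have "\<dots> = DIM('a) * (\<integral>x. g (x /\<^sub>R norm x) \<partial>restrict_space lborel (cball 0 1 - {0}))"
    by (simp add: integral_distr)
  also have "(\<integral>x. g (x /\<^sub>R norm x) \<partial>restrict_space lborel (cball 0 1 - {0})) =
    (\<integral>x. indicator (cball 0 1 - {0}) x * g (x /\<^sub>R norm x) \<partial>lborel)"
    by (subst integral_restrict_space) auto
  finally show ?thesis .
qed

lemma sphere_integral_reflection:
  fixes g :: "'a::euclidean_space \<Rightarrow> real"
  assumes [measurable]: "g \<in> borel_measurable borel"
  shows "(\<integral>x. g (reflection v x) \<partial>sphere_measure) = (\<integral>x. g x \<partial>sphere_measure)"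
proof -
  let ?F = "\<lambda>x. indicator (cball 0 1 - {0}) x * g (x /\<^sub>R norm x)"
  have "(\<integral>x. g (reflection v x) \<partial>sphere_measure) = DIM('a) * (\<integral>x. ?F (reflection v x) \<partial>lborel)"
  proof (subst sphere_integral)
    have "reflection v x = 0 \<longleftrightarrow> x = 0" for x :: 'a
      using norm_reflection[of v x] by (metis norm_eq_zero)
    then have "indicator (cball 0 1 - {0}) x * g (reflection v (x /\<^sub>R norm x)) = ?F (reflection v x)" for x
      by (auto simp: indicator_def linear_scale[OF linear_reflection])
    then show "real DIM('a) * (\<integral>x. indicator (cball 0 1 - {0}) x * g (reflection v (x /\<^sub>R norm x)) \<partial>lborel) =
      DIM('a) * (\<integral>x. ?F (reflection v x) \<partial>lborel)" by simp
  qed measurable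
  also have "\<dots> = DIM('a) * (\<integral>x. ?F x \<partial>lborel)"
    by (subst lborel_integral_reflection) (auto intro!: borel_measurable_times borel_measurable_indicator)
  also have "\<dots> = (\<integral>x. g x \<partial>sphere_measure)"
    by (simp add: sphere_integral)
  finally show ?thesis .
qed

lemma sphere_integral_cong:
  fixes f g :: "'a::euclidean_space \<Rightarrow> real"
  assumes "\<And>x. norm x = 1 \<Longrightarrow> f x = g x"
    and "f \<in> borel_measurable borel" "g \<in> borel_measurable borel"
  shows "(\<integral>x. f x \<partial>sphere_measure) = (\<integral>x. g x \<partial>sphere_measure)"
proof -
  have "indicator (cball 0 1 - {0}) x * f (x /\<^sub>R norm x) =
      indicator (cball 0 1 - {0}) x * g (x /\<^sub>R norm x)" for x
    by (cases "x = 0") (simp_all add: assms(1))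
  then show ?thesis unfolding sphere_integral[OF assms(2)] sphere_integral[OF assms(3)] by (simp only:)
qed

lemma sphere_integrable_continuous:
  fixes g :: "'a::euclidean_space \<Rightarrow> real"
  assumes c: "continuous_on UNIV g"
  shows "integrable sphere_measure g"
proof -
  have [measurable]: "g \<in> borel_measurable borel" using c by (rule borel_measurable_continuous_onI)
  let ?N = "distr (restrict_space lborel (cball 0 1 - {0})) borel (\<lambda>x::'a. x /\<^sub>R norm x)"
  have m [measurable]: "(\<lambda>x::'a. x /\<^sub>R norm x) \<in> borel_measurable (restrict_space lborel (cball 0 1 - {0}))"
    by (rule measurable_restrict_space1) measurable
  have "compact (g ` sphere 0 1)"
    using c by (intro compact_continuous_image continuous_on_subset[OF c]) auto
  then obtain B where B: "\<And>x. norm x = 1 \<Longrightarrow> \<bar>g x\<bar> \<le> B"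
    by (force dest!: compact_imp_bounded simp: bounded_iff)
  have "emeasure lborel (cball 0 1 - {0::'a}) \<le> emeasure lborel (cball (0::'a) 1)"
    by (rule emeasure_mono) auto
  then have fin: "emeasure lborel (cball 0 1 - {0::'a}) < top"
    using emeasure_lborel_cball_finite[of "0::'a" 1] by (auto simp: less_top[symmetric] top_unique)
  have [measurable]: "cball 0 1 - {0::'a} \<in> sets borel" by auto
  have "integrable lborel (\<lambda>x. indicat_real (cball 0 1 - {0}) x *\<^sub>R g (x /\<^sub>R norm x))"
  proof (rule Bochner_Integration.integrable_bound)
    show "integrable lborel (\<lambda>x::'a. B * indicator (cball 0 1 - {0}) x)"
      using fin by (intro integrable_mult_right integrable_real_indicator) auto
    show "AE x in lborel. norm (indicat_real (cball 0 1 - {0}) x *\<^sub>R g (x /\<^sub>R norm x))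
       \<le> norm (B * indicat_real (cball 0 1 - {0}) x)"
      by (intro AE_I2) (auto simp: indicator_def intro!: order_trans[OF B])
  qed measurable
  then have "integrable (restrict_space lborel (cball 0 1 - {0})) (\<lambda>x. g (x /\<^sub>R norm x))"
    by (subst integrable_restrict_space) (auto simp: set_integrable_def)
  then have "integrable ?N g" by (subst integrable_distr_eq) auto
  then show ?thesis unfolding sphere_measure_eq_density
    by (subst integrable_density) auto
qed

section \<open>The shape of a zonal harmonic\<close>

lemma deriv2I:
  fixes F G G' :: "real \<Rightarrow> real"
  assumes eq: "\<And>s. \<bar>s\<bar> < 1 \<Longrightarrow> F s = G s"
    and d1: "\<And>s. \<bar>s\<bar> < 1 \<Longrightarrow> (G has_real_derivative G' s) (at s)"
    and d2: "(G' has_real_derivative D) (at 0)"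
  shows "(deriv ^^ 2) F 0 = D"
proof -
  have o: "open {-1<..<1::real}" by simp
  have "deriv F s = G' s" if "\<bar>s\<bar> < 1" for s
  proof -
    have "(F has_real_derivative G' s) (at s)"
      by (rule has_field_derivative_transform_within_open[OF d1[OF that] o])
         (use that eq in \<open>auto simp: abs_if split: if_splits\<close>)
    then show ?thesis by (rule DERIV_imp_deriv)
  qed
  then have "(deriv F has_real_derivative D) (at 0)"
    by (intro has_field_derivative_transform_within_open[OF d2 o]) (auto simp: abs_if)
  then show ?thesis by (simp add: numeral_2_eq_2 DERIV_imp_deriv)
qed

lemma even_polynomial_in_square:
  fixes w :: "real poly"
  assumes even: "\<And>t. poly w (- t) = poly w t"
  shows "poly w t = (\<Sum>k\<le>degree w. coeff w (2 * k) * (t\<^sup>2) ^ k)"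
proof -
  let ?f = "\<lambda>i. coeff w i * t ^ i" and ?n = "Suc (degree w)"
  have p: "poly w s = (\<Sum>i<2 * ?n. coeff w i * s ^ i)" for s
    unfolding poly_altdef by (rule sum.mono_neutral_left) (auto simp: coeff_eq_0)
  have "poly w t = (poly w t + poly w (- t)) / 2" using even by simp
  also have "\<dots> = (\<Sum>i<2 * ?n. if even i then ?f i else 0)"
    unfolding p sum.distrib[symmetric] sum_divide_distrib
    by (rule sum.cong[OF refl]) auto
  also have "\<dots> = (\<Sum>i<?n. ?f (2 * i))"
    by (subst sum_split_even_odd) simp
  finally show ?thesis by (simp add: lessThan_Suc_atMost power_mult)
qed

text \<open>
  The Taylor coefficients at zero of the hypergeometric polynomial
  \<open>\<^sub>2F\<^sub>1 (- l / 2, (1 - l) / 2; n / 2; - z)\<close>. The numerator vanishes once \<open>2 * k\<close> reaches \<open>l\<close> or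
  \<open>l - 1\<close>, so the series terminates.
\<close>

primrec zonal_coeff :: "nat \<Rightarrow> nat \<Rightarrow> nat \<Rightarrow> real" where
  "zonal_coeff n l 0 = 1"
| "zonal_coeff n l (Suc k) =
     - ((real l - 2 * real k) * (real l - 2 * real k - 1) /
        (2 * (real k + 1) * (2 * real k + real n))) * zonal_coeff n l k"

lemma zonal_coeff_eq_0: "l < 2 * k \<Longrightarrow> zonal_coeff n l k = 0"
proof (induction k)
  case (Suc k)
  show ?case
  proof (cases "l < 2 * k")
    case False
    then have "l = 2 * k \<or> l = 2 * k + 1" using Suc.prems by auto
    then show ?thesis by auto
  qed (use Suc.IH in auto)
qed simp

text \<open>
  A zonal harmonic of degree \<open>l\<close> on the affine hyperplane \<open>y \<bullet> e = 1\<close>, as a function of the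
  squared distance from its centre \<open>e\<close>. On the sphere \<open>z\<close> is the squared tangent of the angle to the
  pole.
\<close>

definition zonal_profile :: "nat \<Rightarrow> nat \<Rightarrow> real \<Rightarrow> real" where
  "zonal_profile n l z = (\<Sum>k\<le>l. zonal_coeff n l k * z ^ k)"

text \<open>
  A homogeneous function is determined off the equator by its restriction to the hyperplane
  \<open>y \<bullet> e = 1\<close>. Invariance makes this restriction an even polynomial in the distance from \<open>e\<close>, and
  Laplace's equation becomes a first-order recursion for its coefficients. So the value at \<open>e\<close>
  determines everything.
\<close>

lemma zonal_harmonic_formula:
  fixes g :: "'a::euclidean_space \<Rightarrow> real"
  assumes g: "g \<in> solid_harmonics l" and e: "e \<in> Basis" and dim: "DIM('a) = Suc n" "n \<ge> 1"
    and inv: "\<And>v x. v \<bullet> e = 0 \<Longrightarrow> g (reflection v x) = g x"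
    and y: "y \<bullet> e \<noteq> 0"
  shows "g y = g e * (y \<bullet> e) ^ l * zonal_profile n l (((norm y)\<^sup>2 - (y \<bullet> e)\<^sup>2) / (y \<bullet> e)\<^sup>2)"
proof -
  have "card (Basis - {e} :: 'a set) = n" using dim e by simp
  with dim have "Basis - {e} \<noteq> ({} :: 'a set)" by (metis card.empty not_one_le_zero)
  then obtain \<eta> where \<eta>: "\<eta> \<in> Basis" "\<eta> \<noteq> e" by blast
  have [simp]: "e \<bullet> e = 1" "\<eta> \<bullet> \<eta> = 1" "e \<bullet> \<eta> = 0" "\<eta> \<bullet> e = 0"
    using e \<eta> by (simp_all add: inner_Basis)
  obtain w where w: "\<And>t. g (e + t *\<^sub>R \<eta>) = poly w t"
    using polynomial_on_line[OF solid_harmonicsD(1)[OF g]] by blast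
  \<comment> \<open>The reflection that changes the sign of \<open>\<eta>\<close> fixes \<open>e\<close>.\<close>
  have w_even: "poly w (- t) = poly w t" for t
    using inv[of \<eta> "e + t *\<^sub>R \<eta>"] w[of t] w[of "- t"]
    by (simp add: reflection_def inner_add_left scaleR_add_left[symmetric] add_diff_eq[symmetric]
        scaleR_diff_left[symmetric])
  define m where "m = degree w + l"
  define v where "v k = coeff w (2 * k)" for k
  have v0: "v k = 0" if "k > m" for k using that by (simp add: v_def m_def coeff_eq_0)
  have wv: "poly w t = (\<Sum>k\<le>m. v k * (t\<^sup>2) ^ k)" for t
    unfolding even_polynomial_in_square[OF w_even] v_def
    by (rule sum.mono_neutral_left) (auto simp: m_def coeff_eq_0)
  have gy: "g y = (y \<bullet> e) ^ l * (\<Sum>k\<le>m. v k * (((norm y)\<^sup>2 - (y \<bullet> e)\<^sup>2) / (y \<bullet> e)\<^sup>2) ^ k)"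
    if "y \<bullet> e \<noteq> 0" for y
  proof -
    let ?a = "y \<bullet> e"
    define u where "u = y - ?a *\<^sub>R e"
    have ue: "u \<bullet> e = 0" by (simp add: u_def inner_diff_left)
    have u2: "(norm u)\<^sup>2 = (norm y)\<^sup>2 - ?a\<^sup>2"
      unfolding power2_norm_eq_inner u_def
      by (simp add: inner_diff_left inner_diff_right inner_commute power2_eq_square)
    let ?v = "u - norm u *\<^sub>R \<eta>"
    have ve: "?v \<bullet> e = 0" using ue by (simp add: inner_diff_left)
    have "norm (norm u *\<^sub>R \<eta>) = norm u" using \<eta> by simp
    then have "reflection ?v u = norm u *\<^sub>R \<eta>" by (intro reflection_swaps) simp
    moreover have "reflection ?v (?a *\<^sub>R e) = ?a *\<^sub>R e"
      by (rule reflection_fixes) (use ve in \<open>simp add: inner_commute\<close>)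
    moreover have "reflection ?v (?a *\<^sub>R e + u) = reflection ?v (?a *\<^sub>R e) + reflection ?v u"
      by (rule linear_add[OF linear_reflection])
    moreover have "?a *\<^sub>R e + u = y" by (simp add: u_def)
    ultimately have "reflection ?v y = ?a *\<^sub>R e + norm u *\<^sub>R \<eta>"
      by simp
    also have "\<dots> = ?a *\<^sub>R (e + (norm u / ?a) *\<^sub>R \<eta>)" using that by (simp add: scaleR_add_right)
    finally have "g y = ?a ^ l * g (e + (norm u / ?a) *\<^sub>R \<eta>)"
      using inv[OF ve, of y] by (simp only: solid_harmonicsD(2)[OF g])
    also have "\<dots> = ?a ^ l * (\<Sum>k\<le>m. v k * ((norm u / ?a)\<^sup>2) ^ k)" by (simp add: w wv)
    finally show ?thesis by (simp only: power_divide u2)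
  qed
  \<comment> \<open>Laplace's equation for \<open>g\<close> at the point \<open>e + t *\<^sub>R \<eta>\<close>, one second derivative for each kind of
    axis.\<close>
  have ode: "(\<Sum>k\<le>m. (v (Suc k) * (2 * (k + 1) * (2 * k + n)) + v k * ((real l - 2 * k) * (real l - 2 * k - 1))) * (t\<^sup>2) ^ k) = 0"
    if "0 < t" for t :: real
  proof -
    let ?x = "e + t *\<^sub>R \<eta>"
    define T where "T k = v k * (2 * real k) * t ^ (2 * k - 2)" for k
    \<comment> \<open>A step along \<open>e\<close> keeps the distance from the axis and changes the height to \<open>1 + s\<close>, so the
      term of index \<open>k\<close> is multiplied by \<open>1 + s\<close> to the power \<open>l - 2 * k\<close>, which may be negative.\<close>
    have along_e: "(deriv ^^ 2) (\<lambda>s. g (?x + s *\<^sub>R e)) 0 =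
        (\<Sum>k\<le>m. v k * (t\<^sup>2) ^ k * ((real l - 2 * k) * (real l - 2 * k - 1)))"
    proof (rule deriv2I)
      fix s :: real assume s: "\<bar>s\<bar> < 1"
      then have s1: "1 + s > 0" by linarith
      have xe: "(?x + s *\<^sub>R e) \<bullet> e = 1 + s" by (simp add: inner_add_left)
      have nx: "(norm (?x + s *\<^sub>R e))\<^sup>2 - (1 + s)\<^sup>2 = t\<^sup>2"
        unfolding power2_norm_eq_inner by (simp add: inner_add_left inner_add_right algebra_simps power2_eq_square)
      have "g (?x + s *\<^sub>R e) = (1 + s) ^ l * (\<Sum>k\<le>m. v k * (t\<^sup>2 / (1 + s)\<^sup>2) ^ k)"
        using gy[of "?x + s *\<^sub>R e"] s1 by (simp only: xe nx)
      also have "\<dots> = (\<Sum>k\<le>m. v k * (t\<^sup>2) ^ k * (1 + s) powi (int l - 2 * int k))"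
        unfolding sum_distrib_left
      proof (rule sum.cong[OF refl])
        fix k
        have "(1 + s) powi (int l - 2 * int k) = (1 + s) ^ l / ((1 + s)\<^sup>2) ^ k"
        proof -
          have "(1 + s) powi (int l - int (2 * k)) = (1 + s) powi int l / (1 + s) powi int (2 * k)"
            using s1 by (intro power_int_diff) simp
          moreover have "int l - 2 * int k = int l - int (2 * k)" by simp
          ultimately show ?thesis by (simp only: power_int_of_nat power_mult)
        qed
        then show "(1 + s) ^ l * (v k * (t\<^sup>2 / (1 + s)\<^sup>2) ^ k) =
            v k * (t\<^sup>2) ^ k * (1 + s) powi (int l - 2 * int k)"
          by (simp add: power_divide)
      qed
      finally show "g (?x + s *\<^sub>R e) = \<dots>" .
      show "((\<lambda>s. \<Sum>k\<le>m. v k * (t\<^sup>2) ^ k * (1 + s) powi (int l - 2 * int k)) has_real_derivative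
         (\<Sum>k\<le>m. v k * (t\<^sup>2) ^ k * ((real l - 2 * k) * (1 + s) powi (int l - 2 * int k - 1)))) (at s)"
        using s1 by (auto intro!: derivative_eq_intros sum.cong)
    next
      show "((\<lambda>s. \<Sum>k\<le>m. v k * (t\<^sup>2) ^ k * ((real l - 2 * k) * (1 + s) powi (int l - 2 * int k - 1)))
        has_real_derivative (\<Sum>k\<le>m. v k * (t\<^sup>2) ^ k * ((real l - 2 * k) * (real l - 2 * k - 1)))) (at 0)"
        by (auto intro!: derivative_eq_intros sum.cong)
    qed
    have along_\<eta>: "(deriv ^^ 2) (\<lambda>s. g (?x + s *\<^sub>R \<eta>)) 0 = (\<Sum>k\<le>m. T k * (2 * real k - 1))"
    proof (rule deriv2I)
      fix s :: real assume s: "\<bar>s\<bar> < 1"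
      have "?x + s *\<^sub>R \<eta> = e + (t + s) *\<^sub>R \<eta>" by (simp add: algebra_simps)
      then show "g (?x + s *\<^sub>R \<eta>) = (\<Sum>k\<le>m. v k * (t + s) ^ (2 * k))"
        by (simp only: w wv power_mult)
      show "((\<lambda>s. \<Sum>k\<le>m. v k * (t + s) ^ (2 * k)) has_real_derivative
          (\<Sum>k\<le>m. v k * (2 * real k * (t + s) ^ (2 * k - 1)))) (at s)"
        by (auto intro!: derivative_eq_intros sum.cong)
    next
      show "((\<lambda>s. \<Sum>k\<le>m. v k * (2 * real k * (t + s) ^ (2 * k - 1))) has_real_derivative
          (\<Sum>k\<le>m. T k * (2 * real k - 1))) (at 0)"
      proof -
        have "real (2 * k - Suc 0) = 2 * real k - 1" if "k \<noteq> 0" for k using that by (cases k) auto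
        then show ?thesis
          by (auto intro!: derivative_eq_intros sum.cong simp: T_def numeral_2_eq_2)
      qed
    qed
    \<comment> \<open>A step along any other axis keeps the height and changes the squared distance to \<open>t\<^sup>2 + s\<^sup>2\<close>.\<close>
    have along_b: "(deriv ^^ 2) (\<lambda>s. g (?x + s *\<^sub>R b)) 0 = (\<Sum>k\<le>m. T k)"
      if b: "b \<in> Basis" "b \<noteq> e" "b \<noteq> \<eta>" for b
    proof (rule deriv2I)
      have [simp]: "b \<bullet> b = 1" "e \<bullet> b = 0" "\<eta> \<bullet> b = 0" "b \<bullet> e = 0" "b \<bullet> \<eta> = 0"
        using e \<eta> b by (simp_all add: inner_Basis)
      fix s :: real assume s: "\<bar>s\<bar> < 1"
      have xe: "(?x + s *\<^sub>R b) \<bullet> e = 1" by (simp add: inner_add_left)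
      have nx: "(norm (?x + s *\<^sub>R b))\<^sup>2 - 1\<^sup>2 = t\<^sup>2 + s\<^sup>2"
        unfolding power2_norm_eq_inner by (simp add: inner_add_left inner_add_right algebra_simps power2_eq_square)
      show "g (?x + s *\<^sub>R b) = (\<Sum>k\<le>m. v k * (t\<^sup>2 + s\<^sup>2) ^ k)"
        using gy[of "?x + s *\<^sub>R b"] by (simp only: xe nx) simp
      show "((\<lambda>s. \<Sum>k\<le>m. v k * (t\<^sup>2 + s\<^sup>2) ^ k) has_real_derivative
          (\<Sum>k\<le>m. v k * (real k * (t\<^sup>2 + s\<^sup>2) ^ (k - 1)) * (2 * s))) (at s)"
        by (auto intro!: derivative_eq_intros sum.cong)
    next
      have "(t\<^sup>2) ^ (k - 1) = t ^ (2 * k - 2)" for k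
        by (simp add: power_mult[symmetric] right_diff_distrib')
      then show "((\<lambda>s. \<Sum>k\<le>m. v k * (real k * (t\<^sup>2 + s\<^sup>2) ^ (k - 1)) * (2 * s)) has_real_derivative
          (\<Sum>k\<le>m. T k)) (at 0)"
        by (auto intro!: derivative_eq_intros sum.cong simp: T_def)
    qed
    have "0 = laplacian g ?x" using solid_harmonicsD(3)[OF g] by simp
    also have "\<dots> = (\<Sum>b\<in>Basis - {e}. (deriv ^^ 2) (\<lambda>s. g (?x + s *\<^sub>R b)) 0) + (deriv ^^ 2) (\<lambda>s. g (?x + s *\<^sub>R e)) 0"
      unfolding laplacian_def by (subst sum.remove[OF _ e]) auto
    also have "(\<Sum>b\<in>Basis - {e}. (deriv ^^ 2) (\<lambda>s. g (?x + s *\<^sub>R b)) 0) =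
       (\<Sum>b\<in>Basis - {e} - {\<eta>}. (deriv ^^ 2) (\<lambda>s. g (?x + s *\<^sub>R b)) 0) + (\<Sum>k\<le>m. T k * (2 * real k - 1))"
      using \<eta> by (subst sum.remove[of _ \<eta>]) (auto simp: along_\<eta>)
    also have "(\<Sum>b\<in>Basis - {e} - {\<eta>}. (deriv ^^ 2) (\<lambda>s. g (?x + s *\<^sub>R b)) 0) = real (n - 1) * (\<Sum>k\<le>m. T k)"
      using e \<eta> dim by (simp add: along_b)
    finally have "0 = (\<Sum>k\<le>m. T k * (real n + 2 * real k - 2)) +
        (\<Sum>k\<le>m. v k * (t\<^sup>2) ^ k * ((real l - 2 * k) * (real l - 2 * k - 1)))"
      using dim unfolding along_e by (simp add: of_nat_diff sum_distrib_left sum.distrib[symmetric] algebra_simps)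
    also have "(\<Sum>k\<le>m. T k * (real n + 2 * real k - 2)) = (\<Sum>k\<le>Suc m. T k * (real n + 2 * real k - 2))"
      by (simp add: T_def v0)
    also have "\<dots> = (\<Sum>k\<le>m. T (Suc k) * (real n + 2 * real k))"
      by (subst sum.atMost_Suc_shift) (simp add: T_def)
    also have "\<dots> = (\<Sum>k\<le>m. v (Suc k) * (2 * (k + 1) * (2 * k + n)) * (t\<^sup>2) ^ k)"
      by (rule sum.cong) (auto simp: T_def power_mult[symmetric] algebra_simps)
    finally show ?thesis by (simp add: sum.distrib[symmetric] algebra_simps)
  qed
  have "infinite {z::real. (\<Sum>k\<le>m. (v (Suc k) * (2 * (k + 1) * (2 * k + n)) +
      v k * ((real l - 2 * k) * (real l - 2 * k - 1))) * z ^ k) = 0}"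
  proof (rule infinite_super)
    show "{0<..} \<subseteq> {z::real. (\<Sum>k\<le>m. (v (Suc k) * (2 * (k + 1) * (2 * k + n)) +
      v k * ((real l - 2 * k) * (real l - 2 * k - 1))) * z ^ k) = 0}"
    proof
      fix z :: real assume "z \<in> {0<..}"
      then show "z \<in> {z::real. (\<Sum>k\<le>m. (v (Suc k) * (2 * (k + 1) * (2 * k + n)) +
      v k * ((real l - 2 * k) * (real l - 2 * k - 1))) * z ^ k) = 0}"
        using ode[of "sqrt z"] by simp
    qed
    show "infinite {0::real<..}" by (rule infinite_Ioi)
  qed
  then have rec: "v (Suc k) * (2 * (k + 1) * (2 * k + n)) + v k * ((real l - 2 * k) * (real l - 2 * k - 1)) = 0"
    if "k \<le> m" for k unfolding polyfun_finite_roots using that by blast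
  have ge: "v 0 = g e" using w[of 0] by (simp add: v_def poly_0_coeff_0)
  have vz: "v k = g e * zonal_coeff n l k" if "k \<le> Suc m" for k
    using that
  proof (induction k)
    case (Suc k)
    have "2 * (real k + 1) * (2 * real k + real n) > 0" using dim by (intro mult_pos_pos) auto
    moreover have "v (Suc k) * (2 * (real k + 1) * (2 * real k + real n)) =
       - (v k * ((real l - 2 * k) * (real l - 2 * k - 1)))"
      using rec[of k] Suc.prems by (simp add: algebra_simps)
    ultimately have "v (Suc k) = - (v k * ((real l - 2 * k) * (real l - 2 * k - 1))) /
        (2 * (real k + 1) * (2 * real k + real n))" by (subst nonzero_eq_divide_eq) auto
    then show ?case using Suc by simp
  qed (simp add: ge)
  have "(\<Sum>k\<le>m. v k * z ^ k) = g e * zonal_profile n l z" for z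
  proof -
    have "(\<Sum>k\<le>m. v k * z ^ k) = (\<Sum>k\<le>m. g e * (zonal_coeff n l k * z ^ k))"
      by (rule sum.cong) (auto simp: vz)
    also have "\<dots> = (\<Sum>k\<le>l. g e * (zonal_coeff n l k * z ^ k))"
      by (rule sum.mono_neutral_right) (auto simp: m_def zonal_coeff_eq_0)
    finally show ?thesis by (simp add: zonal_profile_def sum_distrib_left)
  qed
  then show ?thesis using gy[OF y] by (simp add: mult_ac)
qed

lemma continuous_on_solid_harmonic:
  assumes "h \<in> solid_harmonics l"
  shows "continuous_on S h"
  using solid_harmonicsD(1)[OF assms]
  by (meson continuous_on_polymonial_function real_polynomial_function_eq)

lemma sphere_inner_commute: "sphere_inner f g = sphere_inner g f"
  by (simp add: sphere_inner_def mult.commute)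

lemma sphere_inner_sum_left:
  fixes f :: "'i \<Rightarrow> 'a::euclidean_space \<Rightarrow> real"
  assumes "\<And>i. i \<in> I \<Longrightarrow> continuous_on UNIV (f i)" "continuous_on UNIV g"
  shows "sphere_inner (\<lambda>x. \<Sum>i\<in>I. c i * f i x) g = (\<Sum>i\<in>I. c i * sphere_inner (f i) g)"
proof -
  have i: "integrable sphere_measure (\<lambda>x. f i x * g x)" if "i \<in> I" for i
    using assms that by (intro sphere_integrable_continuous continuous_intros) auto
  have "sphere_inner (\<lambda>x. \<Sum>i\<in>I. c i * f i x) g = (\<integral>x. (\<Sum>i\<in>I. c i * (f i x * g x)) \<partial>sphere_measure)"
    by (simp add: sphere_inner_def sum_distrib_right mult.assoc)
  also have "\<dots> = (\<Sum>i\<in>I. \<integral>x. c i * (f i x * g x) \<partial>sphere_measure)"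
    by (rule Bochner_Integration.integral_sum) (simp add: i)
  finally show ?thesis by (simp add: sphere_inner_def)
qed

lemma sphere_inner_scale_left: "sphere_inner (\<lambda>x. c * f x) g = c * sphere_inner f g"
  by (simp add: sphere_inner_def mult.assoc)

lemma sphere_inner_reflection:
  assumes "continuous_on UNIV f" "continuous_on UNIV g"
  shows "sphere_inner (\<lambda>x. f (reflection v x)) (\<lambda>x. g (reflection v x)) = sphere_inner f g"
  unfolding sphere_inner_def
  by (rule sphere_integral_reflection[where g = "\<lambda>x. f x * g x"])
     (intro borel_measurable_continuous_onI continuous_intros assms)

lemma polynomial_Re_Im_power:
  fixes a b :: "'a::euclidean_space"
  shows "real_polynomial_function (\<lambda>y. Re (Complex (y \<bullet> a) (y \<bullet> b) ^ l))"
    and "real_polynomial_function (\<lambda>y. Im (Complex (y \<bullet> a) (y \<bullet> b) ^ l))"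
proof (induction l)
  case (Suc l)
  have i: "real_polynomial_function (\<lambda>y. y \<bullet> c)" for c :: 'a
    by (intro real_polynomial_function.intros bounded_linear_inner_left)
  {
    case 1
    show ?case by (simp, intro real_polynomial_function_diff real_polynomial_function.intros(4) i Suc)
  next
    case 2
    show ?case by (simp, intro real_polynomial_function.intros(3,4) i Suc)
  }
qed (auto intro: real_polynomial_function.intros)

text \<open>
  An explicit harmonic polynomial of each degree that does not vanish at \<open>a\<close>; it shows that the
  kernel of every degree is positive on the diagonal.
\<close>

lemma Re_power_solid_harmonic:
  fixes a b :: "'a::euclidean_space"
  assumes ab: "a \<in> Basis" "b \<in> Basis" "a \<noteq> b"
  shows "(\<lambda>y. Re (Complex (y \<bullet> a) (y \<bullet> b) ^ l)) \<in> solid_harmonics l"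
proof -
  let ?z = "\<lambda>y. Complex (y \<bullet> a) (y \<bullet> b)"
  have "Re (?z (t *\<^sub>R y) ^ l) = t ^ l * Re (?z y ^ l)" for t y
  proof -
    have "?z (t *\<^sub>R y) = of_real t * ?z y" by (simp add: complex_eq_iff)
    then have "?z (t *\<^sub>R y) ^ l = of_real (t ^ l) * ?z y ^ l" by (simp add: power_mult_distrib)
    then show ?thesis by (simp del: of_real_power)
  qed
  moreover have "laplacian (\<lambda>y. Re (?z y ^ l)) x = 0" for x
  proof -
    define c where "c b' = Complex (b' \<bullet> a) (b' \<bullet> b)" for b'
    define p where "p b' = (\<Sum>k\<le>l. monom (real (l choose k) * Re (c b' ^ k * ?z x ^ (l - k))) k)" for b'
    have "Re (?z (x + t *\<^sub>R b') ^ l) = poly (p b') t" for b' t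
    proof -
      have "?z (x + t *\<^sub>R b') = of_real t * c b' + ?z x"
        by (simp add: complex_eq_iff inner_add_left c_def)
      then have "?z (x + t *\<^sub>R b') ^ l =
          (\<Sum>k\<le>l. of_nat (l choose k) * (of_real t * c b') ^ k * ?z x ^ (l - k))"
        by (simp only: binomial_ring)
      also have "\<dots> = (\<Sum>k\<le>l. of_real (real (l choose k) * t ^ k) * (c b' ^ k * ?z x ^ (l - k)))"
        by (rule sum.cong) (auto simp: power_mult_distrib)
      finally have "Re (?z (x + t *\<^sub>R b') ^ l) =
          (\<Sum>k\<le>l. (real (l choose k) * t ^ k) * Re (c b' ^ k * ?z x ^ (l - k)))"
        by (simp only: Re_sum times_complex.sel(1)[of "complex_of_real _"] Re_complex_of_real Im_complex_of_real mult_zero_left diff_zero)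
      then show ?thesis by (simp add: p_def poly_sum poly_monom mult_ac)
    qed
    then have "laplacian (\<lambda>y. Re (?z y ^ l)) x = 2 * (\<Sum>b'\<in>Basis. coeff (p b') 2)"
      by (rule laplacian_coeff)
    also have "(\<Sum>b'\<in>Basis. coeff (p b') 2) =
        (if 2 \<le> l then (l choose 2) * (\<Sum>b'\<in>Basis. Re (c b' ^ 2 * ?z x ^ (l - 2))) else 0)"
      by (simp add: p_def coeff_sum coeff_monom sum_distrib_left)
    also have "(\<Sum>b'\<in>Basis. Re (c b' ^ 2 * ?z x ^ (l - 2))) = Re ((\<Sum>b'\<in>Basis. c b' ^ 2) * ?z x ^ (l - 2))"
      by (simp only: sum_distrib_right Re_sum)
    also have "(\<Sum>b'\<in>Basis. c b' ^ 2) = (\<Sum>b'\<in>{a, b}. c b' ^ 2)"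
      using ab by (intro sum.mono_neutral_right) (auto simp: c_def inner_Basis complex_eq_iff)
    also have "\<dots> = 0" using ab by (simp add: c_def inner_Basis complex_eq_iff power2_eq_square)
    finally show ?thesis by simp
  qed
  ultimately show ?thesis
    by (simp add: solid_harmonics_def homogeneous_polynomials_def polynomial_Re_Im_power)
qed

lemma zonal_coeff_Suc2:
  assumes "n \<ge> 1"
  shows "zonal_coeff n (m + 2) (Suc k) * (2 * (real k + 1) * (2 * real k + real n)) =
    - ((real m + 2) * (real m + 1)) * zonal_coeff n m k"
proof (induction k)
  case 0 then show ?case using assms by (simp add: field_simps)
next
  case (Suc k)
  let ?q = "\<lambda>k. 2 * (real k + 1) * (2 * real k + real n)"
  have q: "?q k > 0" for k using assms by (intro mult_pos_pos) auto
  have r: "zonal_coeff n l (Suc k) * ?q k = - ((real l - 2 * real k) * (real l - 2 * real k - 1)) * zonal_coeff n l k" for l k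
    using q[of k] by (simp add: field_simps)
  have "?q k * (zonal_coeff n (m + 2) (Suc (Suc k)) * ?q (Suc k)) =
      - ((real m - 2 * real k) * (real m - 2 * real k - 1)) * (zonal_coeff n (m + 2) (Suc k) * ?q k)"
    unfolding r[of "m + 2" "Suc k"] by (simp add: algebra_simps)
  also have "\<dots> = - ((real m + 2) * (real m + 1)) * (zonal_coeff n m (Suc k) * ?q k)"
    unfolding Suc r[of m k] by simp
  finally have "?q k * (zonal_coeff n (m + 2) (Suc (Suc k)) * ?q (Suc k)) =
     ?q k * (- ((real m + 2) * (real m + 1)) * zonal_coeff n m (Suc k))" by (simp only: mult_ac)
  then show ?case using q[of k] by (simp only: mult_cancel_left) simp
qed

lemma zonal_coeff_Suc1:
  assumes "n \<ge> 1"
  shows "zonal_coeff n (m + 1) (Suc k) * (2 * (real k + 1) * (2 * real k + real n)) =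
    - ((real m + 1) * (real m - 2 * real k)) * zonal_coeff n m k"
proof (induction k)
  case 0 then show ?case using assms by (simp add: field_simps)
next
  case (Suc k)
  let ?q = "\<lambda>k. 2 * (real k + 1) * (2 * real k + real n)"
  have q: "?q k > 0" for k using assms by (intro mult_pos_pos) auto
  have r: "zonal_coeff n l (Suc k) * ?q k = - ((real l - 2 * real k) * (real l - 2 * real k - 1)) * zonal_coeff n l k" for l k
    using q[of k] by (simp add: field_simps)
  have "?q k * (zonal_coeff n (m + 1) (Suc (Suc k)) * ?q (Suc k)) =
      - ((real m - 2 * real k - 1) * (real m - 2 * real k - 2)) * (zonal_coeff n (m + 1) (Suc k) * ?q k)"
    unfolding r[of "m + 1" "Suc k"] by (simp add: algebra_simps)
  also have "\<dots> = - ((real m + 1) * (real m - 2 * real (Suc k))) * (zonal_coeff n m (Suc k) * ?q k)"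
    unfolding Suc r[of m k] by (simp add: algebra_simps)
  finally have "?q k * (zonal_coeff n (m + 1) (Suc (Suc k)) * ?q (Suc k)) =
     ?q k * (- ((real m + 1) * (real m - 2 * real (Suc k))) * zonal_coeff n m (Suc k))" by (simp only: mult_ac)
  then show ?case using q[of k] by (simp only: mult_cancel_left) simp
qed

lemma zonal_profile_upto:
  "l \<le> M \<Longrightarrow> zonal_profile n l z = (\<Sum>k\<le>M. zonal_coeff n l k * z ^ k)"
  unfolding zonal_profile_def by (rule sum.mono_neutral_left) (auto simp: zonal_coeff_eq_0)

lemma zonal_profile_shift:
  "l \<le> Suc M \<Longrightarrow> zonal_profile n l z = 1 + (\<Sum>k\<le>M. zonal_coeff n l (Suc k) * z ^ Suc k)"
  by (subst zonal_profile_upto[of l "Suc M"], simp, subst sum.atMost_Suc_shift) (simp del: zonal_coeff.simps(2))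

text \<open>
  A contiguity relation of the hypergeometric function, proved by comparing coefficients. It is the
  three-term recurrence of the Gegenbauer polynomials, written in the variable of the hyperplane.
\<close>

lemma zonal_profile_recurrence:
  assumes n: "n \<ge> 1"
  shows "(2 * real m + real n + 1) * zonal_profile n (m + 1) z =
    (real m + real n) * zonal_profile n (m + 2) z + (real m + 1) * (1 + z) * zonal_profile n m z"
proof -
  let ?c = "zonal_coeff n" and ?q = "\<lambda>k. 2 * (real k + 1) * (2 * real k + real n)"
  have id: "(2 * real m + real n + 1) * ?c (m + 1) (Suc k) =
      (real m + real n) * ?c (m + 2) (Suc k) + (real m + 1) * (?c m (Suc k) + ?c m k)" for k
  proof -
    have q: "?q k > 0" using n by (intro mult_pos_pos) auto
    have r: "?c m (Suc k) * ?q k = - ((real m - 2 * real k) * (real m - 2 * real k - 1)) * ?c m k"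
      using q by (simp add: field_simps)
    have "(2 * real m + real n + 1) * (?c (m + 1) (Suc k) * ?q k) =
      (real m + real n) * (?c (m + 2) (Suc k) * ?q k) + (real m + 1) * (?c m (Suc k) * ?q k + ?c m k * ?q k)"
      unfolding zonal_coeff_Suc1[OF n] zonal_coeff_Suc2[OF n] r by (simp add: algebra_simps del: zonal_coeff.simps)
    then have "?q k * ((2 * real m + real n + 1) * ?c (m + 1) (Suc k)) =
      ?q k * ((real m + real n) * ?c (m + 2) (Suc k) + (real m + 1) * (?c m (Suc k) + ?c m k))"
      by (simp only: distrib_left mult_ac)
    moreover have "?q k \<noteq> 0" by (rule less_imp_neq[OF q, symmetric])
    ultimately show ?thesis using mult_left_cancel by blast
  qed
  let ?S = "\<lambda>l. \<Sum>k\<le>Suc m. ?c l (Suc k) * z ^ Suc k"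
  have "(2 * real m + real n + 1) * ?S (m + 1) =
      (real m + real n) * ?S (m + 2) + (real m + 1) * (?S m + z * (\<Sum>k\<le>Suc m. ?c m k * z ^ k))"
    unfolding sum_distrib_left sum.distrib[symmetric]
  proof (rule sum.cong[OF refl])
    fix k
    have "(2 * real m + real n + 1) * (?c (m + 1) (Suc k) * z ^ Suc k) =
      ((real m + real n) * ?c (m + 2) (Suc k) + (real m + 1) * (?c m (Suc k) + ?c m k)) * z ^ Suc k"
      unfolding id[symmetric] by (simp only: mult.assoc)
    then show "(2 * real m + real n + 1) * (?c (m + 1) (Suc k) * z ^ Suc k) =
      (real m + real n) * (?c (m + 2) (Suc k) * z ^ Suc k) +
        (real m + 1) * (?c m (Suc k) * z ^ Suc k + z * (?c m k * z ^ k))"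
      by (simp only: power_Suc distrib_left distrib_right mult_ac)
  qed
  moreover have "?S (m + 1) = zonal_profile n (m + 1) z - 1" "?S (m + 2) = zonal_profile n (m + 2) z - 1"
    "?S m = zonal_profile n m z - 1"
    by (subst zonal_profile_shift[where M = "Suc m"]; simp del: zonal_coeff.simps(2) sum.atMost_Suc)+
  moreover have "(\<Sum>k\<le>Suc m. ?c m k * z ^ k) = zonal_profile n m z"
    by (rule zonal_profile_upto[symmetric]) simp
  ultimately have "(2 * real m + real n + 1) * (zonal_profile n (m + 1) z - 1) =
      (real m + real n) * (zonal_profile n (m + 2) z - 1) +
      (real m + 1) * ((zonal_profile n m z - 1) + z * zonal_profile n m z)"
    by (simp only:)
  then show ?thesis by (simp add: algebra_simps)
qed

section \<open>The reproducing kernel of the spherical harmonics\<close>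

text \<open>
  A basis as in \<open>orthonormal_harmonic_basis\<close>, with functions on the sphere replaced by the solid
  harmonics that extend them. The number \<open>n\<close> is the dimension of the sphere.
\<close>

locale harmonic_basis =
  fixes J :: "nat \<Rightarrow> 'j set" and h :: "nat \<Rightarrow> 'j \<Rightarrow> 'a::euclidean_space \<Rightarrow> real" and n :: nat
  assumes finite_J: "finite (J l)"
    and harmonic: "j \<in> J l \<Longrightarrow> h l j \<in> solid_harmonics l"
    and orthonormal: "i \<in> J l \<Longrightarrow> j \<in> J l \<Longrightarrow> sphere_inner (h l i) (h l j) = (if i = j then 1 else 0)"
    and spanning: "g \<in> solid_harmonics l \<Longrightarrow> \<exists>c. \<forall>x. g x = (\<Sum>j\<in>J l. c j * h l j x)"
    and dim: "DIM('a) = Suc n" and n_pos: "n \<ge> 1"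
begin

definition kernel :: "nat \<Rightarrow> 'a \<Rightarrow> 'a \<Rightarrow> real" where
  "kernel l x y = (\<Sum>j\<in>J l. h l j x * h l j y)"

lemma kernel_commute: "kernel l x y = kernel l y x"
  by (simp add: kernel_def mult.commute)

lemma kernel_harmonic: "kernel l x \<in> solid_harmonics l"
  unfolding kernel_def by (rule solid_harmonics_combination) (auto intro: harmonic finite_J)

lemma kernel_homogeneous: "kernel l x (t *\<^sub>R y) = t ^ l * kernel l x y"
  using kernel_harmonic by (rule solid_harmonicsD)

lemma inner_coeff:
  assumes "k \<in> J l" "\<And>x. g x = (\<Sum>j\<in>J l. c j * h l j x)"
  shows "sphere_inner g (h l k) = c k"
proof -
  have "sphere_inner g (h l k) = sphere_inner (\<lambda>x. \<Sum>j\<in>J l. c j * h l j x) (h l k)"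
    using assms(2) by presburger
  also have "\<dots> = (\<Sum>j\<in>J l. c j * sphere_inner (h l j) (h l k))"
    by (rule sphere_inner_sum_left) (auto intro: continuous_on_solid_harmonic harmonic assms(1))
  also have "\<dots> = c k"
    using assms(1) by (simp add: orthonormal if_distrib sum.delta finite_J cong: if_cong)
  finally show ?thesis .
qed

lemma inner_kernel:
  assumes "continuous_on UNIV f"
  shows "sphere_inner f (kernel l x) = (\<Sum>j\<in>J l. h l j x * sphere_inner f (h l j))"
  unfolding sphere_inner_commute[of f] kernel_def
  by (rule sphere_inner_sum_left) (auto intro: continuous_on_solid_harmonic harmonic assms)

lemma reproducing:
  assumes g: "g \<in> solid_harmonics l"
  shows "sphere_inner g (kernel l x) = g x"
proof -
  from spanning[OF g] obtain c where c: "\<And>x. g x = (\<Sum>j\<in>J l. c j * h l j x)" by blast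
  have "sphere_inner g (kernel l x) = (\<Sum>j\<in>J l. h l j x * c j)"
    unfolding inner_kernel[OF continuous_on_solid_harmonic[OF g]]
    by (rule sum.cong) (auto simp: inner_coeff c)
  then show ?thesis by (simp add: c mult.commute)
qed

text \<open>
  The inner product is an integral over the sphere, but it determines a solid harmonic on the whole
  space because the kernel reproduces values at every point.
\<close>

lemma harmonic_eq_if_inner_eq:
  fixes f g :: "'a \<Rightarrow> real"
  assumes "f \<in> solid_harmonics l" "g \<in> solid_harmonics l"
    and "\<And>u. u \<in> solid_harmonics l \<Longrightarrow> sphere_inner f u = sphere_inner g u"
  shows "f = g"
proof
  fix x
  have "f x = sphere_inner f (kernel l x)" using assms(1) by (rule reproducing[symmetric])
  also have "\<dots> = sphere_inner g (kernel l x)" by (rule assms(3)[OF kernel_harmonic])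
  also have "\<dots> = g x" using assms(2) by (rule reproducing)
  finally show "f x = g x" .
qed

text \<open>
  The kernel is determined by the reproducing property, and the space of harmonics as well as its
  inner product are invariant under reflections.
\<close>

lemma kernel_reflection: "kernel l (reflection v x) (reflection v y) = kernel l x y"
proof -
  let ?T = "reflection v"
  have "(\<lambda>y. kernel l (?T x) (?T y)) = kernel l x"
  proof (rule harmonic_eq_if_inner_eq)
    show "(\<lambda>y. kernel l (?T x) (?T y)) \<in> solid_harmonics l"
      by (rule solid_harmonics_orthogonal[OF kernel_harmonic orthogonal_reflection])
    show "kernel l x \<in> solid_harmonics l" by (rule kernel_harmonic)
    fix u :: "'a \<Rightarrow> real" assume u: "u \<in> solid_harmonics l"
    let ?u = "\<lambda>y. u (?T y)"
    have u': "?u \<in> solid_harmonics l" by (rule solid_harmonics_orthogonal[OF u orthogonal_reflection])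
    have "sphere_inner (\<lambda>y. kernel l (?T x) (?T y)) (\<lambda>y. ?u (?T y)) = sphere_inner (kernel l (?T x)) ?u"
      by (intro sphere_inner_reflection continuous_on_solid_harmonic[OF kernel_harmonic]
          continuous_on_solid_harmonic[OF u'])
    also have "\<dots> = ?u (?T x)" using reproducing[OF u'] sphere_inner_commute by metis
    also have "\<dots> = sphere_inner (kernel l x) u"
      using reproducing[OF u] sphere_inner_commute by (metis reflection_reflection)
    finally show "sphere_inner (\<lambda>y. kernel l (?T x) (?T y)) u = sphere_inner (kernel l x) u" by simp
  qed
  then show ?thesis by metis
qed

lemma kernel_diag_eq:
  assumes "norm x = norm y"
  shows "kernel l x x = kernel l y y"
  using kernel_reflection[of l "x - y" x x] reflection_swaps[OF assms] by simp

definition pole :: 'a where "pole = (SOME b. b \<in> Basis)"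

lemma pole_Basis: "pole \<in> Basis"
  unfolding pole_def by (rule someI_ex) (use nonempty_Basis in blast)

lemma norm_pole [simp]: "norm pole = 1" by (rule norm_Basis[OF pole_Basis])

text \<open>
  The common value of \<open>kernel l u u\<close> at all unit vectors \<open>u\<close>, which is the dimension of the space of
  harmonics of degree \<open>l\<close> divided by the area of the sphere.
\<close>

definition mass :: "nat \<Rightarrow> real" where "mass l = kernel l pole pole"

lemma kernel_diag: "kernel l x x = norm x ^ (2 * l) * mass l"
proof -
  have "kernel l x x = kernel l (norm x *\<^sub>R pole) (norm x *\<^sub>R pole)"
    by (rule kernel_diag_eq) simp
  also have "\<dots> = norm x ^ l * (norm x ^ l * mass l)"
    unfolding mass_def by (metis kernel_commute kernel_homogeneous)
  finally show ?thesis by (simp add: power_add mult_2)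
qed

lemma kernel_zonal:
  assumes "y \<bullet> pole \<noteq> 0"
  shows "kernel l pole y = mass l * (y \<bullet> pole) ^ l *
    zonal_profile n l (((norm y)\<^sup>2 - (y \<bullet> pole)\<^sup>2) / (y \<bullet> pole)\<^sup>2)"
  unfolding mass_def
proof (rule zonal_harmonic_formula[OF kernel_harmonic pole_Basis dim n_pos _ assms])
  fix v x :: 'a assume "v \<bullet> pole = 0"
  then have "reflection v pole = pole" by (intro reflection_fixes) (simp add: inner_commute)
  then show "kernel l pole (reflection v x) = kernel l pole x"
    using kernel_reflection[of l v pole x] by simp
qed

lemma obtain_orthogonal_Basis: obtains b where "b \<in> Basis" "b \<noteq> pole"
proof -
  have "card (Basis - {pole} :: 'a set) = n" using dim pole_Basis by simp
  with n_pos have "Basis - {pole} \<noteq> ({} :: 'a set)" by (metis card.empty not_one_le_zero)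
  then show ?thesis using that by blast
qed

text \<open>
  If the kernel vanished at the pole, all basis functions and hence all harmonics of degree \<open>l\<close> would
  vanish there.
\<close>

lemma mass_pos: "mass l > 0"
proof -
  obtain b where b: "b \<in> Basis" "b \<noteq> pole" by (rule obtain_orthogonal_Basis)
  let ?g = "\<lambda>y. Re (Complex (y \<bullet> pole) (y \<bullet> b) ^ l)"
  have g: "?g \<in> solid_harmonics l" using pole_Basis b by (intro Re_power_solid_harmonic) auto
  have "pole \<bullet> pole = 1" "pole \<bullet> b = 0" using pole_Basis b by (simp_all add: inner_Basis)
  moreover have "Complex 1 0 = 1" by (simp add: complex_eq_iff)
  ultimately have g1: "?g pole = 1" by simp
  from spanning[OF g] obtain c where c: "\<And>x. ?g x = (\<Sum>j\<in>J l. c j * h l j x)" by blast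
  have m: "mass l = (\<Sum>j\<in>J l. (h l j pole)\<^sup>2)" by (simp add: mass_def kernel_def power2_eq_square)
  have "mass l \<noteq> 0"
  proof
    assume "mass l = 0"
    then have "\<forall>j\<in>J l. h l j pole = 0" unfolding m by (simp add: sum_nonneg_eq_0_iff finite_J)
    then show False using c[of pole] g1 by simp
  qed
  moreover have "mass l \<ge> 0" unfolding m by (rule sum_nonneg) simp
  ultimately show ?thesis by simp
qed

definition zonal :: "nat \<Rightarrow> 'a \<Rightarrow> real" where "zonal l y = kernel l pole y / mass l"

lemma zonal_harmonic: "zonal l \<in> solid_harmonics l"
  using solid_harmonics_combination[of "{0::nat}" "\<lambda>_. kernel l pole" l "\<lambda>_. inverse (mass l)"] kernel_harmonic
  by (simp add: zonal_def[abs_def] divide_inverse mult.commute)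

lemma zonal_formula:
  assumes "y \<bullet> pole \<noteq> 0"
  shows "zonal l y = (y \<bullet> pole) ^ l * zonal_profile n l (((norm y)\<^sup>2 - (y \<bullet> pole)\<^sup>2) / (y \<bullet> pole)\<^sup>2)"
  using kernel_zonal[OF assms] mass_pos[of l] by (simp add: zonal_def)

lemma zonal_unit_tangent:
  assumes b: "b \<in> Basis" "b \<noteq> pole"
  shows "zonal l (pole + t *\<^sub>R b) = zonal_profile n l (t\<^sup>2)"
proof -
  have [simp]: "pole \<bullet> pole = 1" "pole \<bullet> b = 0" "b \<bullet> pole = 0" "b \<bullet> b = 1"
    using pole_Basis b by (simp_all add: inner_Basis)
  have 1: "(pole + t *\<^sub>R b) \<bullet> pole = 1" by (simp add: inner_add_left)
  have "(norm (pole + t *\<^sub>R b))\<^sup>2 - 1\<^sup>2 = t\<^sup>2"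
    unfolding power2_norm_eq_inner by (simp add: inner_add_left inner_add_right power2_eq_square)
  then show ?thesis using zonal_formula[of "pole + t *\<^sub>R b" l] unfolding 1 by simp
qed

text \<open>
  The recurrence of the profiles in homogeneous form. The term \<open>(norm y)\<^sup>2\<close> is one on the sphere,
  which turns the recurrence into an expression for multiplication by the height \<open>y \<bullet> pole\<close>.
\<close>

lemma zonal_recurrence:
  "(2 * real m + real n + 1) * ((y \<bullet> pole) * zonal (m + 1) y) =
    (real m + real n) * zonal (m + 2) y + (real m + 1) * ((norm y)\<^sup>2 * zonal m y)"
proof -
  let ?L = "\<lambda>y. (2 * real m + real n + 1) * ((y \<bullet> pole) * zonal (m + 1) y) -
    ((real m + real n) * zonal (m + 2) y + (real m + 1) * ((norm y)\<^sup>2 * zonal m y))"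
  have off: "?L y = 0" if y: "y \<bullet> pole \<noteq> 0" for y
  proof -
    let ?a = "y \<bullet> pole" and ?z = "((norm y)\<^sup>2 - (y \<bullet> pole)\<^sup>2) / (y \<bullet> pole)\<^sup>2"
    have ny: "(norm y)\<^sup>2 = ?a\<^sup>2 * (1 + ?z)" using y by (simp add: field_simps)
    have "(2 * real m + real n + 1) * (?a * zonal (m + 1) y) =
        ?a ^ (m + 2) * ((2 * real m + real n + 1) * zonal_profile n (m + 1) ?z)"
      by (simp add: zonal_formula[OF y] mult_ac)
    also have "\<dots> = (real m + real n) * (?a ^ (m + 2) * zonal_profile n (m + 2) ?z) +
        (real m + 1) * ((?a\<^sup>2 * (1 + ?z)) * (?a ^ m * zonal_profile n m ?z))"
      unfolding zonal_profile_recurrence[OF n_pos] by (simp add: algebra_simps power2_eq_square)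
    finally show ?thesis unfolding ny[symmetric] by (simp add: zonal_formula[OF y])
  qed
  \<comment> \<open>The equator, where the formula in terms of the profile is not available, is reached by continuity.\<close>
  have cont: "continuous_on UNIV ?L"
    by (intro continuous_intros continuous_on_solid_harmonic[OF zonal_harmonic])
  have "?L y = 0" for y
  proof (cases "y \<bullet> pole = 0")
    case True
    have "(\<lambda>k. y + inverse (real (Suc k)) *\<^sub>R pole) \<longlonglongrightarrow> y + 0 *\<^sub>R pole"
      by (intro tendsto_intros LIMSEQ_inverse_real_of_nat)
    then have "(\<lambda>k. ?L (y + inverse (real (Suc k)) *\<^sub>R pole)) \<longlonglongrightarrow> ?L y"
      using continuous_on_tendsto_compose[OF cont, of _ y] by simp
    moreover have "?L (y + inverse (real (Suc k)) *\<^sub>R pole) = 0" for k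
      by (rule off) (simp add: inner_add_left True inner_Basis pole_Basis del: of_nat_Suc)
    ultimately show ?thesis by (simp add: LIMSEQ_const_iff)
  qed (rule off)
  then show ?thesis by (simp add: algebra_simps)
qed

lemma zonal_inner:
  "sphere_inner (zonal l) (zonal k) = sphere_inner (kernel l pole) (kernel k pole) / (mass l * mass k)"
proof -
  have z: "zonal l = (\<lambda>y. inverse (mass l) * kernel l pole y)" for l
    by (rule ext) (simp add: zonal_def divide_inverse)
  show ?thesis
    unfolding z sphere_inner_scale_left
    unfolding sphere_inner_commute[of "kernel l pole"] sphere_inner_scale_left
    by (simp add: divide_inverse mult_ac)
qed

lemma zonal_norm: "sphere_inner (zonal l) (zonal l) = 1 / mass l"
  using reproducing[OF kernel_harmonic, of l pole pole] mass_pos[of l]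
  by (simp add: zonal_inner mass_def)

text \<open>
  The two points are exchanged by a reflection, under which the inner product and both kernels are
  invariant.
\<close>

lemma kernel_inner_commute:
  assumes "norm x = norm y"
  shows "sphere_inner (kernel l x) (kernel k y) = sphere_inner (kernel l y) (kernel k x)"
proof -
  let ?T = "reflection (x - y)"
  have T: "?T x = y" "?T y = x" using reflection_swaps[OF assms] reflection_swaps'[OF assms] by auto
  have "kernel l x = (\<lambda>z. kernel l y (?T z))" "kernel k y = (\<lambda>z. kernel k x (?T z))"
    using kernel_reflection[of _ "x - y"] T by (metis ext)+
  then have "sphere_inner (kernel l x) (kernel k y) =
      sphere_inner (\<lambda>z. kernel l y (?T z)) (\<lambda>z. kernel k x (?T z))" by simp
  also have "\<dots> = sphere_inner (kernel l y) (kernel k x)"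
    by (intro sphere_inner_reflection continuous_on_solid_harmonic[OF kernel_harmonic])
  finally show ?thesis .
qed

text \<open>
  As a function of \<open>y\<close> the left-hand side is a harmonic of degree \<open>k\<close> that is invariant under the
  reflections fixing the pole, hence a multiple of the zonal one.
\<close>

lemma inner_kernel_zonal:
  assumes y: "y \<bullet> pole \<noteq> 0"
  shows "sphere_inner (kernel l pole) (kernel k y) = sphere_inner (kernel l pole) (kernel k pole) * zonal k y"
proof -
  let ?g = "\<lambda>y. sphere_inner (kernel l pole) (kernel k y)"
  have c: "continuous_on UNIV (kernel l pole)" by (rule continuous_on_solid_harmonic[OF kernel_harmonic])
  have "?g = (\<lambda>y. \<Sum>j\<in>J k. sphere_inner (kernel l pole) (h k j) * h k j y)"
    by (rule ext) (simp add: inner_kernel[OF c] mult.commute)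
  also have "\<dots> \<in> solid_harmonics k"
    by (rule solid_harmonics_combination) (auto intro: harmonic finite_J)
  finally have g: "?g \<in> solid_harmonics k" .
  show ?thesis
    unfolding zonal_formula[OF y]
    using zonal_harmonic_formula[OF g pole_Basis dim n_pos _ y]
  proof (simp only: mult.assoc, elim meta_mp)
    fix v x :: 'a assume v: "v \<bullet> pole = 0"
    then have T: "reflection v pole = pole" by (intro reflection_fixes) (simp add: inner_commute)
    have "kernel l pole = (\<lambda>z. kernel l pole (reflection v z))"
      using kernel_reflection[of l v pole] T by (metis ext)
    moreover have "kernel k (reflection v x) = (\<lambda>z. kernel k x (reflection v z))"
      using kernel_reflection[of k v "reflection v x"] by (metis ext reflection_reflection)
    ultimately have "?g (reflection v x) = sphere_inner (\<lambda>z. kernel l pole (reflection v z)) (\<lambda>z. kernel k x (reflection v z))"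
      by metis
    also have "\<dots> = ?g x"
      by (intro sphere_inner_reflection continuous_on_solid_harmonic[OF kernel_harmonic])
    finally show "?g (reflection v x) = ?g x" .
  qed
qed

text \<open>
  The cross kernel \<open>sphere_inner (kernel l x) (kernel (l + 2) y)\<close> is symmetric in \<open>x\<close> and \<open>y\<close> on the
  sphere. With \<open>x\<close> at the pole it is a multiple of the zonal harmonic of degree \<open>l + 2\<close>; by symmetry
  it is the same multiple of the zonal harmonic of degree \<open>l\<close>. These two functions differ on the
  sphere, so the factor \<open>q\<close> is zero. The degrees differ by two because multiplication by
  the height \<open>y \<bullet> pole\<close> couples the neighbours of a degree.
\<close>

lemma zonal_orthogonal: "sphere_inner (zonal l) (zonal (l + 2)) = 0"
proof -
  define q where "q = sphere_inner (kernel l pole) (kernel (l + 2) pole)"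
  obtain b where b: "b \<in> Basis" "b \<noteq> pole" by (rule obtain_orthogonal_Basis)
  have [simp]: "pole \<bullet> pole = 1" "pole \<bullet> b = 0" "b \<bullet> pole = 0" "b \<bullet> b = 1"
    using pole_Basis b by (simp_all add: inner_Basis)
  \<comment> \<open>The point \<open>?x\<close> of the hyperplane is projected to the sphere, where the symmetry holds; going back
    multiplies the two sides by different powers of \<open>r\<close>.\<close>
  have eq: "q * zonal_profile n (l + 2) z = q * ((1 + z) * zonal_profile n l z)" if z: "z > 0" for z
  proof -
    let ?x = "pole + sqrt z *\<^sub>R b"
    define r where "r = norm ?x"
    have r2: "r\<^sup>2 = 1 + z"
      unfolding r_def power2_norm_eq_inner using z by (simp add: inner_add_left inner_add_right)
    have r: "r > 0" using r2 z unfolding r_def by (metis add_pos_pos less_numeral_extra(1) norm_ge_zero order_le_less power_zero_numeral less_irrefl)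
    let ?y = "(1 / r) *\<^sub>R ?x"
    have ny: "norm ?y = norm pole" using r by (simp add: r_def)
    have yp: "?y \<bullet> pole \<noteq> 0" using r by (simp add: inner_add_left)
    have "q * zonal (l + 2) ?y = sphere_inner (kernel l ?y) (kernel (l + 2) pole)"
      using inner_kernel_zonal[OF yp, of l "l + 2"] kernel_inner_commute[OF ny, of l "l + 2"]
      by (simp add: q_def)
    also have "\<dots> = q * zonal l ?y"
      using inner_kernel_zonal[OF yp, of "l + 2" l] by (simp add: q_def sphere_inner_commute)
    finally have "q * ((1 / r) ^ (l + 2) * zonal (l + 2) ?x) = q * ((1 / r) ^ l * zonal l ?x)"
      by (simp only: solid_harmonicsD(2)[OF zonal_harmonic])
    then have "q * zonal (l + 2) ?x = q * (r\<^sup>2 * zonal l ?x)"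
      using r by (simp add: field_simps power_add power2_eq_square)
    then show ?thesis unfolding zonal_unit_tangent[OF b] r2 using z by simp
  qed
  let ?d = "\<lambda>k. q * (zonal_coeff n (l + 2) k - zonal_coeff n l k - (if k = 0 then 0 else zonal_coeff n l (k - 1)))"
  have "(\<Sum>k\<le>l + 2. ?d k * z ^ k) = q * zonal_profile n (l + 2) z - q * ((1 + z) * zonal_profile n l z)" for z
  proof -
    have 1: "zonal_profile n (l + 2) z = (\<Sum>k\<le>l + 2. zonal_coeff n (l + 2) k * z ^ k)"
      "zonal_profile n l z = (\<Sum>k\<le>l + 2. zonal_coeff n l k * z ^ k)"
      by (rule zonal_profile_upto; simp)+
    have "z * zonal_profile n l z = (\<Sum>k\<le>l + 1. zonal_coeff n l k * z ^ Suc k)"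
      unfolding zonal_profile_upto[of l "l + 1", OF le_add1] sum_distrib_left
      by (rule sum.cong) (auto simp: mult_ac)
    also have "\<dots> = (\<Sum>k\<le>l + 2. (if k = 0 then 0 else zonal_coeff n l (k - 1)) * z ^ k)"
      using sum.atMost_Suc_shift[of "\<lambda>k. (if k = 0 then 0 else zonal_coeff n l (k - 1)) * z ^ k" "l + 1"] by simp
    finally have 2: "z * zonal_profile n l z = \<dots>" .
    have "q * zonal_profile n (l + 2) z - q * ((1 + z) * zonal_profile n l z) =
       q * (zonal_profile n (l + 2) z - zonal_profile n l z - z * zonal_profile n l z)"
      by (simp add: algebra_simps)
    also have "\<dots> = (\<Sum>k\<le>l + 2. ?d k * z ^ k)"
      unfolding 2 unfolding 1 sum_subtractf[symmetric] sum_distrib_left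
      by (rule sum.cong) (auto simp: algebra_simps)
    finally show ?thesis by simp
  qed
  then have "{0<..} \<subseteq> {z. (\<Sum>k\<le>l + 2. ?d k * z ^ k) = 0}" using eq by auto
  then have "infinite {z. (\<Sum>k\<le>l + 2. ?d k * z ^ k) = 0}"
    using infinite_Ioi infinite_super by blast
  \<comment> \<open>Already the linear coefficients of the two profiles disagree.\<close>
  then have "?d 1 = 0" unfolding polyfun_finite_roots by auto
  moreover have "zonal_coeff n (l + 2) 1 - zonal_coeff n l 1 - zonal_coeff n l 0 < 0"
  proof -
    have "4 * real n * (zonal_coeff n (l + 2) 1 - zonal_coeff n l 1 - zonal_coeff n l 0) = - (8 * real l + 4 + 4 * real n)"
      using n_pos by (simp add: field_simps)
    also have "\<dots> < 0" by simp
    finally show ?thesis using n_pos by (simp add: mult_less_0_iff)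
  qed
  ultimately have "q = 0" by auto
  then show ?thesis by (simp add: zonal_inner q_def)
qed

lemma integral_zonal_recurrence:
  assumes G: "continuous_on UNIV G"
  shows "(2 * real m + real n + 1) * (\<integral>y. (y \<bullet> pole) * zonal (m + 1) y * G y \<partial>sphere_measure) =
    (real m + real n) * sphere_inner (zonal (m + 2)) G + (real m + 1) * sphere_inner (zonal m) G"
proof -
  have U: "continuous_on UNIV (zonal l)" for l by (rule continuous_on_solid_harmonic[OF zonal_harmonic])
  note c = borel_measurable_continuous_onI continuous_intros U G
  have "(2 * real m + real n + 1) * (\<integral>y. (y \<bullet> pole) * zonal (m + 1) y * G y \<partial>sphere_measure) =
     (\<integral>y. (2 * real m + real n + 1) * ((y \<bullet> pole) * zonal (m + 1) y) * G y \<partial>sphere_measure)"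
    by (simp add: mult.assoc)
  also have "\<dots> = (\<integral>y. (real m + real n) * (zonal (m + 2) y * G y) + (real m + 1) * (zonal m y * G y) \<partial>sphere_measure)"
  proof (rule sphere_integral_cong)
    fix y :: 'a assume "norm y = 1"
    then show "(2 * real m + real n + 1) * ((y \<bullet> pole) * zonal (m + 1) y) * G y =
      (real m + real n) * (zonal (m + 2) y * G y) + (real m + 1) * (zonal m y * G y)"
      unfolding zonal_recurrence by (simp add: algebra_simps)
  qed (intro c)+
  also have "\<dots> = (real m + real n) * sphere_inner (zonal (m + 2)) G + (real m + 1) * sphere_inner (zonal m) G"
    unfolding sphere_inner_def
    by (subst Bochner_Integration.integral_add)
       (auto intro!: sphere_integrable_continuous integrable_mult_right continuous_intros U G)
  finally show ?thesis .
qed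

text \<open>
  Multiplication by the height \<open>y \<bullet> pole\<close> is symmetric. Its matrix entry between the zonal harmonics
  of degrees \<open>m + 1\<close> and \<open>m + 2\<close> can be read off from the three-term recurrence of either of them,
  and the squared norms in the two results are the inverses of the two masses.
\<close>

lemma mass_recurrence:
  "mass (m + 2) * ((real m + 2) * (2 * real m + real n + 1)) = mass (m + 1) * ((real m + real n) * (2 * real m + real n + 3))"
proof -
  have U: "continuous_on UNIV (zonal l)" for l by (rule continuous_on_solid_harmonic[OF zonal_harmonic])
  define X where "X = (\<integral>y. (y \<bullet> pole) * zonal (m + 1) y * zonal (m + 2) y \<partial>sphere_measure)"
  have 1: "(2 * real m + real n + 1) * X * mass (m + 2) = real m + real n"
    unfolding X_def integral_zonal_recurrence[OF U] zonal_norm zonal_orthogonal using mass_pos[of "m + 2"] by simp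
  have "(2 * real (m + 1) + real n + 1) * (\<integral>y. (y \<bullet> pole) * zonal (m + 1 + 1) y * zonal (m + 1) y \<partial>sphere_measure) =
      (real (m + 1) + 1) * (1 / mass (m + 1))"
    unfolding integral_zonal_recurrence[OF U] zonal_norm
    using zonal_orthogonal[of "m + 1"] by (simp add: sphere_inner_commute)
  moreover have "(\<integral>y. (y \<bullet> pole) * zonal (m + 1 + 1) y * zonal (m + 1) y \<partial>sphere_measure) = X"
    by (simp add: X_def mult_ac)
  ultimately have 2: "(2 * real m + real n + 3) * X * mass (m + 1) = real m + 2"
    using mass_pos[of "m + 1"] by (simp add: field_simps)
  have "X * (mass (m + 2) * ((real m + 2) * (2 * real m + real n + 1))) =
      X * (mass (m + 1) * ((real m + real n) * (2 * real m + real n + 3)))"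
    using 1 2 by algebra
  moreover have "X \<noteq> 0" using 2 by (auto simp: add_nonneg_eq_0_iff)
  ultimately show ?thesis by simp
qed

text \<open>
  The recurrence solved in closed form. Up to the constant this is the dimension of the space of
  harmonics of degree \<open>m + 1\<close> in \<open>n + 1\<close> variables.
\<close>

lemma mass_formula:
  "mass (m + 1) = mass 1 / (fact (n - 1) * (real n + 1)) * (2 + (real n - 1) / (real m + 1)) * pochhammer (real m + 1) (n - 1)"
proof (induction m)
  case 0
  have "mass 1 / (fact (n - 1) * (real n + 1)) * (real n + 1) * fact (n - 1) = mass 1"
    by (simp add: field_simps add_nonneg_eq_0_iff)
  then show ?case by (simp add: pochhammer_fact[symmetric] algebra_simps)
next
  case (Suc m)
  let ?P = "pochhammer (real m + 1) (n - 1)" and ?Q = "pochhammer (real m + 2) (n - 1)"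
  define K where "K = mass 1 / (fact (n - 1) * (real n + 1))"
  have "pochhammer (real m + 1) n = ?P * (real m + real n)"
    using n_pos by (cases n) (simp_all add: pochhammer_Suc algebra_simps)
  moreover have "pochhammer (real m + 1) n = (real m + 1) * ?Q"
    using n_pos by (cases n) (simp_all add: pochhammer_rec algebra_simps)
  ultimately have P: "?P * (real m + real n) = (real m + 1) * ?Q" by simp
  have IH: "mass (m + 1) * (real m + 1) = K * (2 * real m + real n + 1) * ?P"
  proof -
    have "mass (m + 1) * (real m + 1) = K * ((2 + (real n - 1) / (real m + 1)) * (real m + 1)) * ?P"
      using Suc unfolding K_def[symmetric] by (simp only: mult_ac)
    also have "(2 + (real n - 1) / (real m + 1)) * (real m + 1) = 2 * real m + real n + 1"
      by (simp add: field_simps)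
    finally show ?thesis .
  qed
  have "(mass (m + 2) * (real m + 2)) * ((2 * real m + real n + 1) * (real m + 1)) =
     (mass (m + 1) * (real m + 1)) * ((real m + real n) * (2 * real m + real n + 3))"
    using mass_recurrence[of m] by algebra
  also have "\<dots> = K * (2 * real m + real n + 1) * (2 * real m + real n + 3) * (?P * (real m + real n))"
    unfolding IH by (simp only: mult_ac)
  also have "\<dots> = (K * (2 * real m + real n + 3) * ?Q) * ((2 * real m + real n + 1) * (real m + 1))"
    unfolding P by (simp only: mult_ac)
  finally have "mass (m + 2) * (real m + 2) = K * (2 * real m + real n + 3) * ?Q"
  proof -
    have "(2 * real m + real n + 1) * (real m + 1) \<noteq> 0" by (simp add: add_nonneg_eq_0_iff)
    then show "mass (m + 2) * (real m + 2) * ((2 * real m + real n + 1) * (real m + 1)) =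
      K * (2 * real m + real n + 3) * ?Q * ((2 * real m + real n + 1) * (real m + 1)) \<Longrightarrow> ?thesis"
      using mult_right_cancel by blast
  qed
  then have "mass (m + 2) = K * (2 + (real n - 1) / (real m + 2)) * ?Q"
    by (simp add: field_simps)
  then show ?case by (simp add: K_def algebra_simps)
qed

text \<open>
  The factor \<open>pochhammer (l :: real) (n - 1)\<close> of the closed form is a polynomial in \<open>l\<close> of degree
  \<open>n - 1\<close>, and the other factor lies between two positive constants.
\<close>

lemma mass_bounds:
  obtains c C where "c > 0" "C > 0" "\<And>l. l \<ge> 1 \<Longrightarrow> c * real l ^ (n - 1) \<le> mass l"
    "\<And>l. mass l \<le> C * (real l + 1) ^ (n - 1)"
proof -
  define K where "K = mass 1 / (fact (n - 1) * (real n + 1))"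
  have K: "K > 0" using mass_pos[of 1] by (simp add: K_def)
  have f: "mass l = K * (2 + (real n - 1) / real l) * pochhammer (real l) (n - 1)" if "l \<ge> 1" for l
    using mass_formula[of "l - 1"] that by (simp add: K_def of_nat_diff)
  have low: "real l ^ (n - 1) \<le> pochhammer (real l) (n - 1)" for l
    unfolding pochhammer_prod
    using prod_mono[of "{0..<n - 1}" "\<lambda>_. real l" "\<lambda>i. real l + real i"] by simp
  have up: "pochhammer (real l) (n - 1) \<le> (real n * (real l + 1)) ^ (n - 1)" for l
  proof -
    have "pochhammer (real l) (n - 1) \<le> (\<Prod>i\<in>{0..<n - 1}. real n * (real l + 1))"
      unfolding pochhammer_prod
    proof (rule prod_mono)
      fix i assume "i \<in> {0..<n - 1}"
      then have "real i \<le> real n" by simp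
      moreover have "real l \<le> real n * real l" using n_pos mult_right_mono[of 1 "real n" "real l"] by simp
      ultimately show "0 \<le> real l + real i \<and> real l + real i \<le> real n * (real l + 1)"
        by (simp add: algebra_simps)
    qed
    then show ?thesis by simp
  qed
  let ?C = "K * (real n + 1) * real n ^ (n - 1) + mass 0"
  show ?thesis
  proof
    show "2 * K > 0" using K by simp
    show "?C > 0" using K mass_pos[of 0] by (simp add: add_nonneg_pos)
    show "2 * K * real l ^ (n - 1) \<le> mass l" if "l \<ge> 1" for l
    proof -
      have "2 * K * real l ^ (n - 1) \<le> (K * (2 + (real n - 1) / real l)) * pochhammer (real l) (n - 1)"
      proof (rule mult_mono[OF _ low])
        show "2 * K \<le> K * (2 + (real n - 1) / real l)" using K n_pos by (simp add: algebra_simps)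
        then show "0 \<le> K * (2 + (real n - 1) / real l)" using K by linarith
      qed simp
      then show ?thesis using f[OF that] by simp
    qed
    show "mass l \<le> ?C * (real l + 1) ^ (n - 1)" for l
    proof (cases "l \<ge> 1")
      case True
      have "(real n - 1) / real l \<le> real n - 1"
        using True n_pos mult_left_mono[of 1 "real l" "real n - 1"] by (simp add: divide_le_eq)
      then have "mass l \<le> (K * (real n + 1)) * (real n * (real l + 1)) ^ (n - 1)"
        unfolding f[OF True] using K n_pos True
        by (intro mult_mono up mult_left_mono) (auto simp: pochhammer_nonneg)
      also have "\<dots> = (K * (real n + 1) * real n ^ (n - 1)) * (real l + 1) ^ (n - 1)"
        by (simp add: power_mult_distrib)
      also have "\<dots> \<le> ?C * (real l + 1) ^ (n - 1)"
        using mass_pos[of 0] by (intro mult_right_mono) auto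
      finally show ?thesis .
    next
      case False
      then have "l = 0" by simp
      then show ?thesis using K by simp
    qed
  qed
qed

end

text \<open>
  A solid harmonic is determined by its values on the sphere, so orthonormality and spanning carry
  over from the sphere to the extensions.
\<close>

lemma solid_harmonic_basis_exists:
  fixes Y :: "nat \<Rightarrow> 'j \<Rightarrow> 'a::euclidean_space \<Rightarrow> real"
  assumes Y: "\<And>l. orthonormal_harmonic_basis l (J l) (Y l)" and dim: "DIM('a) = Suc n" "n \<ge> 1"
  obtains h where "harmonic_basis J h n"
    "\<And>l j x. j \<in> J l \<Longrightarrow> norm x = 1 \<Longrightarrow> Y l j x = h l j x"
proof -
  have "\<exists>g. g \<in> solid_harmonics l \<and> Y l j = (\<lambda>x. if x \<in> sphere 0 1 then g x else 0)" if "j \<in> J l" for l j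
    using Y[of l] that unfolding orthonormal_harmonic_basis_def spherical_harmonics_def solid_harmonics_def
    by blast
  then have "\<forall>l j. \<exists>g. j \<in> J l \<longrightarrow>
      g \<in> solid_harmonics l \<and> Y l j = (\<lambda>x. if x \<in> sphere 0 1 then g x else 0)"
    by blast
  then obtain h where h: "\<And>l j. j \<in> J l \<Longrightarrow> h l j \<in> solid_harmonics l"
    and Yh: "\<And>l j. j \<in> J l \<Longrightarrow> Y l j = (\<lambda>x. if x \<in> sphere 0 1 then h l j x else 0)"
    unfolding choice_iff by blast
  have on_sphere: "Y l j x = h l j x" if "j \<in> J l" "norm x = 1" for l j x
    using that by (simp add: Yh)
  have "harmonic_basis J h n"
  proof
    show "finite (J l)" for l using Y[of l] by (simp add: orthonormal_harmonic_basis_def)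
    show "h l j \<in> solid_harmonics l" if "j \<in> J l" for l j using h that .
    show "sphere_inner (h l i) (h l j) = (if i = j then 1 else 0)" if ij: "i \<in> J l" "j \<in> J l" for l i j
    proof -
      have hm: "h l k \<in> borel_measurable borel" if "k \<in> J l" for k
        by (rule borel_measurable_continuous_onI[OF continuous_on_solid_harmonic[OF h[OF that]]])
      have Ym: "Y l k \<in> borel_measurable borel" if "k \<in> J l" for k
        unfolding Yh[OF that] by (intro measurable_If hm[OF that]) auto
      have "sphere_inner (h l i) (h l j) = sphere_inner (Y l i) (Y l j)"
        unfolding sphere_inner_def
        by (rule sphere_integral_cong) (use ij hm Ym on_sphere in auto)
      then show ?thesis using Y[of l] ij by (simp add: orthonormal_harmonic_basis_def)
    qed
    show "\<exists>c. \<forall>x. g x = (\<Sum>j\<in>J l. c j * h l j x)" if g: "g \<in> solid_harmonics l" for g l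
    proof -
      have "(\<lambda>x. if x \<in> sphere 0 1 then g x else 0) \<in> spherical_harmonics l"
        using g by (auto simp: spherical_harmonics_def solid_harmonics_def)
      then obtain c where c: "(\<lambda>x. if x \<in> sphere 0 1 then g x else 0) = (\<lambda>x. \<Sum>j\<in>J l. c j * Y l j x)"
        using Y[of l] unfolding orthonormal_harmonic_basis_def by blast
      have fin: "finite (J l)" using Y[of l] by (simp add: orthonormal_harmonic_basis_def)
      have "g = (\<lambda>x. \<Sum>j\<in>J l. c j * h l j x)"
      proof (rule solid_harmonics_eqI[OF g])
        show "(\<lambda>x. \<Sum>j\<in>J l. c j * h l j x) \<in> solid_harmonics l"
          by (rule solid_harmonics_combination[OF h fin])
        show "g x = (\<Sum>j\<in>J l. c j * h l j x)" if x: "norm x = 1" for x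
          using fun_cong[OF c, of x] x by (simp add: on_sphere cong: sum.cong)
      qed
      then have "\<forall>x. g x = (\<Sum>j\<in>J l. c j * h l j x)" by (rule fun_cong[THEN allI])
      then show ?thesis by blast
    qed
  qed (fact dim)+
  then show ?thesis using that on_sphere by blast
qed

section \<open>The mean value property\<close>

lemma homogeneous_parts:
  fixes f :: "'a::euclidean_space \<Rightarrow> real"
  assumes "real_polynomial_function f"
  shows "\<exists>N F. (\<forall>k. F k \<in> homogeneous_polynomials k) \<and> (\<forall>x. f x = (\<Sum>k\<le>N. F k x))"
  using assms
proof induction
  case (linear f)
  then have l: "linear f" by (rule bounded_linear.linear)
  define F where "F k x = (if k = 1 then f x else 0)" for k :: nat and x
  have "F k \<in> homogeneous_polynomials k" for k
    using linear linear_scale[OF l]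
    by (cases "k = 1") (auto simp: F_def[abs_def] homogeneous_polynomials_def real_polynomial_function.intros)
  moreover have "f x = (\<Sum>k\<le>1. F k x)" for x by (simp add: F_def)
  ultimately show ?case by blast
next
  case (const c)
  define F where "F k x = (if k = 0 then c else 0)" for k :: nat and x :: 'a
  have "F k \<in> homogeneous_polynomials k" for k
    by (cases "k = 0") (auto simp: F_def[abs_def] homogeneous_polynomials_def real_polynomial_function.intros)
  moreover have "c = (\<Sum>k\<le>0. F k x)" for x by (simp add: F_def)
  ultimately show ?case by blast
next
  case (add f g)
  then obtain N F N' F' where 1: "\<And>k. F k \<in> homogeneous_polynomials k" "\<And>x. f x = (\<Sum>k\<le>N. F k x)"
    and 2: "\<And>k. F' k \<in> homogeneous_polynomials k" "\<And>x. g x = (\<Sum>k\<le>N'. F' k x)" by metis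
  define G where "G k x = (if k \<le> N then F k x else 0) + (if k \<le> N' then F' k x else 0)" for k x
  have "G k \<in> homogeneous_polynomials k" for k
  proof -
    have z: "(\<lambda>x. if Q then H k x else 0) \<in> homogeneous_polynomials k"
      if "H k \<in> homogeneous_polynomials k" for Q and H :: "nat \<Rightarrow> 'a \<Rightarrow> real"
      using that by (cases Q) (auto simp: homogeneous_polynomials_def real_polynomial_function.intros)
    from z[of F, OF 1(1), of "k \<le> N"] z[of F', OF 2(1), of "k \<le> N'"] show ?thesis
      by (simp add: G_def[abs_def] homogeneous_polynomials_def real_polynomial_function.intros distrib_left)
  qed
  moreover have "f x + g x = (\<Sum>k\<le>N + N'. G k x)" for x
  proof -
    have "(\<Sum>k\<le>N. F k x) = (\<Sum>k\<le>N + N'. if k \<le> N then F k x else 0)"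
      by (rule sum.mono_neutral_cong_left) auto
    moreover have "(\<Sum>k\<le>N'. F' k x) = (\<Sum>k\<le>N + N'. if k \<le> N' then F' k x else 0)"
      by (rule sum.mono_neutral_cong_left) auto
    ultimately show ?thesis by (simp add: 1(2) 2(2) G_def sum.distrib)
  qed
  ultimately show ?case by blast
next
  case (mult f g)
  then obtain N F N' F' where 1: "\<And>k. F k \<in> homogeneous_polynomials k" "\<And>x. f x = (\<Sum>k\<le>N. F k x)"
    and 2: "\<And>k. F' k \<in> homogeneous_polynomials k" "\<And>x. g x = (\<Sum>k\<le>N'. F' k x)" by metis
  let ?S = "\<lambda>m. {p \<in> {..N} \<times> {..N'}. fst p + snd p = m}"
  define G where "G m x = (\<Sum>p\<in>?S m. F (fst p) x * F' (snd p) x)" for m x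
  have "G m \<in> homogeneous_polynomials m" for m
  proof -
    have "real_polynomial_function (G m)" unfolding G_def[abs_def]
      using 1(1) 2(1) by (intro real_polynomial_function_sum real_polynomial_function.intros(4))
        (auto simp: homogeneous_polynomials_def)
    moreover have "G m (t *\<^sub>R x) = t ^ m * G m x" for t x
      unfolding G_def sum_distrib_left
      by (rule sum.cong) (use 1(1) 2(1) in \<open>auto simp: homogeneous_polynomials_def power_add\<close>)
    ultimately show ?thesis by (simp add: homogeneous_polynomials_def)
  qed
  moreover have "f x * g x = (\<Sum>m\<le>N + N'. G m x)" for x
  proof -
    have "f x * g x = (\<Sum>p\<in>{..N} \<times> {..N'}. F (fst p) x * F' (snd p) x)"
      by (simp add: 1(2) 2(2) sum_product sum.cartesian_product case_prod_beta)
    also have "\<dots> = (\<Sum>m\<le>N + N'. G m x)"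
      unfolding G_def by (rule sum.group[symmetric]) auto
    finally show ?thesis .
  qed
  ultimately show ?case by blast
qed

text \<open>
  The Laplacian of a part of degree \<open>k\<close> scales with exponent \<open>k - 2\<close>. The vanishing sum at the points
  \<open>t *\<^sub>R x\<close> is therefore, after multiplication by \<open>t\<^sup>2\<close>, a polynomial in \<open>t\<close> that vanishes for all
  \<open>t > 0\<close>.
\<close>

lemma homogeneous_parts_harmonic:
  fixes F :: "nat \<Rightarrow> 'a::euclidean_space \<Rightarrow> real"
  assumes F: "\<And>k. F k \<in> homogeneous_polynomials k"
    and harm: "\<And>x. laplacian (\<lambda>x. \<Sum>k\<le>N. F k x) x = 0" and k: "k \<le> N"
  shows "F k \<in> solid_harmonics k"
proof -
  have poly: "real_polynomial_function (F k)" for k using F by (simp add: homogeneous_polynomials_def)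
  have lap: "laplacian (F k) (t *\<^sub>R x) * t ^ 2 = t ^ k * laplacian (F k) x" if "t \<noteq> 0" for k t x
  proof -
    have "\<exists>p. \<forall>s. F k (x + s *\<^sub>R b) = poly p s" for b using polynomial_on_line[OF poly] by metis
    then obtain p where p: "\<And>b s. F k (x + s *\<^sub>R b) = poly (p b) s" by metis
    have "F k (t *\<^sub>R x + s *\<^sub>R b) = poly (smult (t ^ k) (pcompose (p b) [:0, inverse t:])) s" for s b
    proof -
      have "t *\<^sub>R x + s *\<^sub>R b = t *\<^sub>R (x + (s * inverse t) *\<^sub>R b)" using that by (simp add: algebra_simps)
      then have "F k (t *\<^sub>R x + s *\<^sub>R b) = t ^ k * F k (x + (s * inverse t) *\<^sub>R b)"
        using F[of k] by (simp add: homogeneous_polynomials_def)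
      then show ?thesis by (simp add: p poly_pcompose)
    qed
    then have "laplacian (F k) (t *\<^sub>R x) = 2 * (\<Sum>b\<in>Basis. coeff (smult (t ^ k) (pcompose (p b) [:0, inverse t:])) 2)"
      by (rule laplacian_coeff)
    also have "\<dots> = 2 * (\<Sum>b\<in>Basis. t ^ k * (inverse t ^ 2 * coeff (p b) 2))"
      by (simp add: coeff_pcompose_linear)
    also have "\<dots> = t ^ k * inverse t ^ 2 * laplacian (F k) x"
      by (subst laplacian_coeff[of "F k" x p]) (simp_all add: p sum_distrib_left mult_ac)
    finally show ?thesis using that by (simp add: field_simps)
  qed
  have "laplacian (F k) x = 0" for x
  proof -
    have "(\<Sum>k\<le>N. laplacian (F k) x * t ^ k) = 0" if "t > 0" for t
    proof -
      have "0 = (\<Sum>k\<le>N. laplacian (F k) (t *\<^sub>R x)) * t\<^sup>2"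
        using harm[of "t *\<^sub>R x"] laplacian_linear_combination[of "{..N}" F "\<lambda>_. 1" "t *\<^sub>R x"] poly by simp
      also have "\<dots> = (\<Sum>k\<le>N. laplacian (F k) x * t ^ k)"
        unfolding sum_distrib_right using that by (intro sum.cong refl) (use lap in \<open>simp add: mult.commute\<close>)
      finally show ?thesis by simp
    qed
    then have "{0<..} \<subseteq> {t. (\<Sum>k\<le>N. laplacian (F k) x * t ^ k) = 0}" by auto
    then have "infinite {t. (\<Sum>k\<le>N. laplacian (F k) x * t ^ k) = 0}"
      using infinite_Ioi infinite_super by blast
    then show ?thesis unfolding polyfun_finite_roots using k by blast
  qed
  then show ?thesis using F by (simp add: solid_harmonics_def)
qed

lemma set_integrable_ball_continuous:
  fixes f :: "'a::euclidean_space \<Rightarrow> real"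
  assumes "continuous_on UNIV f"
  shows "set_integrable lborel (ball a r) f"
proof (rule set_integrable_subset)
  show "set_integrable lborel (cball a r) f"
    unfolding set_integrable_def
    by (rule borel_integrable_compact) (auto intro: continuous_on_subset[OF assms])
qed auto

context harmonic_basis
begin

text \<open>
  Integration over the ball is a linear functional on the harmonics of degree \<open>l\<close>, so it is the inner
  product with some harmonic \<open>w\<close>. The functional is invariant under reflections, hence \<open>w\<close> is too,
  and \<open>w\<close> is a multiple of \<open>norm x ^ l\<close>. The only harmonic multiple is zero, since the Laplacian of
  \<open>norm x ^ l\<close> at the pole is \<open>l * (n + l - 1) > 0\<close>.
\<close>

lemma ball_integral_harmonic:
  fixes g :: "'a \<Rightarrow> real"
  assumes g: "g \<in> solid_harmonics l" and l: "l \<ge> 1"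
  shows "(\<integral>x\<in>ball 0 r. g x \<partial>lborel) = 0"
proof -
  define L where "L f = (\<integral>x\<in>ball 0 r. f x \<partial>lborel)" for f :: "'a \<Rightarrow> real"
  define w where "w y = (\<Sum>j\<in>J l. L (h l j) * h l j y)" for y
  have w: "w \<in> solid_harmonics l"
    unfolding w_def[abs_def] by (rule solid_harmonics_combination) (auto intro: harmonic finite_J)
  have L_inv: "L (\<lambda>x. f (reflection v x)) = L f" if "f \<in> solid_harmonics l" for f v
  proof -
    have [measurable]: "f \<in> borel_measurable borel"
      by (rule borel_measurable_continuous_onI[OF continuous_on_solid_harmonic[OF that]])
    have "indicator (ball 0 r) x *\<^sub>R f (reflection v x) = indicator (ball 0 r) (reflection v x) *\<^sub>R f (reflection v x)" for x
      by (simp add: indicator_def)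
    moreover have "(\<lambda>x. indicator (ball 0 r) x *\<^sub>R f x) \<in> borel_measurable borel"
      by (intro borel_measurable_scaleR borel_measurable_indicator) auto
    ultimately show ?thesis
      unfolding L_def set_lebesgue_integral_def
      using lborel_integral_reflection[of "\<lambda>x. indicator (ball 0 r) x *\<^sub>R f x" v] by (simp only:)
  qed
  have L_w: "sphere_inner f w = L f" if f: "f \<in> solid_harmonics l" for f
  proof -
    from spanning[OF f] obtain c where c: "\<And>x. f x = (\<Sum>j\<in>J l. c j * h l j x)" by blast
    have "sphere_inner f w = (\<Sum>j\<in>J l. L (h l j) * sphere_inner f (h l j))"
      unfolding sphere_inner_commute[of f] w_def[abs_def]
      by (rule sphere_inner_sum_left) (auto intro: continuous_on_solid_harmonic harmonic f)
    also have "\<dots> = (\<Sum>j\<in>J l. L (h l j) * c j)"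
      by (rule sum.cong) (auto simp: inner_coeff c)
    also have "\<dots> = L f"
    proof -
      have "L f = (\<integral>x. (\<Sum>j\<in>J l. c j * (indicator (ball 0 r) x *\<^sub>R h l j x)) \<partial>lborel)"
        unfolding L_def set_lebesgue_integral_def by (simp add: c sum_distrib_left mult_ac)
      also have "\<dots> = (\<Sum>j\<in>J l. \<integral>x. c j * (indicator (ball 0 r) x *\<^sub>R h l j x) \<partial>lborel)"
        using set_integrable_ball_continuous[OF continuous_on_solid_harmonic[OF harmonic]]
        by (intro Bochner_Integration.integral_sum integrable_mult_right) (auto simp: set_integrable_def)
      finally show ?thesis by (simp add: L_def set_lebesgue_integral_def mult.commute)
    qed
    finally show ?thesis .
  qed
  have w_inv: "w (reflection v x) = w x" for v x
  proof -
    have w': "(\<lambda>x. w (reflection v x)) \<in> solid_harmonics l"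
      by (rule solid_harmonics_orthogonal[OF w orthogonal_reflection])
    have "(\<lambda>x. w (reflection v x)) = w"
    proof (rule harmonic_eq_if_inner_eq[OF w' w])
      fix u :: "'a \<Rightarrow> real" assume u: "u \<in> solid_harmonics l"
      have u': "(\<lambda>x. u (reflection v x)) \<in> solid_harmonics l"
        by (rule solid_harmonics_orthogonal[OF u orthogonal_reflection])
      have "sphere_inner (\<lambda>x. w (reflection v x)) (\<lambda>x. u (reflection v (reflection v x))) =
          sphere_inner w (\<lambda>x. u (reflection v x))"
        by (rule sphere_inner_reflection) (rule continuous_on_solid_harmonic[OF w] continuous_on_solid_harmonic[OF u'])+
      also have "\<dots> = sphere_inner w u"
        unfolding sphere_inner_commute[of w] by (simp add: L_w u u' L_inv)
      finally show "sphere_inner (\<lambda>x. w (reflection v x)) u = sphere_inner w u" by simp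
    qed
    then show ?thesis by metis
  qed
  define \<kappa> where "\<kappa> = w pole"
  have w_norm: "w x = norm x ^ l * \<kappa>" for x
  proof -
    have "w x = w (norm x *\<^sub>R pole)"
      using w_inv[of "x - norm x *\<^sub>R pole" x] reflection_swaps[of x "norm x *\<^sub>R pole"] by simp
    then show ?thesis by (simp add: solid_harmonicsD(2)[OF w] \<kappa>_def)
  qed
  have "\<kappa> = 0"
  proof -
    have tangential: "(deriv ^^ 2) (\<lambda>s. w (pole + s *\<^sub>R b)) 0 = \<kappa> * real l"
      if b: "b \<in> Basis - {pole}" for b
    proof (rule deriv2I)
      fix s :: real
      have "(norm (pole + s *\<^sub>R b))\<^sup>2 = 1 + s\<^sup>2"
        unfolding power2_norm_eq_inner using pole_Basis b
        by (auto simp: inner_add_left inner_add_right inner_Basis power2_eq_square)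
      then have "norm (pole + s *\<^sub>R b) = (1 + s\<^sup>2) powr (1 / 2)"
        by (simp add: powr_half_sqrt real_sqrt_unique add_nonneg_nonneg)
      then show "w (pole + s *\<^sub>R b) = \<kappa> * (1 + s\<^sup>2) powr (real l / 2)"
        using powr_power[of "1 + s\<^sup>2" "1 / 2 :: real" l] by (simp add: w_norm add_nonneg_eq_0_iff)
      have "1 + s\<^sup>2 > 0" by (simp add: add_pos_nonneg)
      then show "((\<lambda>s. \<kappa> * (1 + s\<^sup>2) powr (real l / 2)) has_real_derivative
          \<kappa> * (real l * s * (1 + s\<^sup>2) powr (real l / 2 - 1))) (at s)"
        by (auto intro!: derivative_eq_intros simp: powr_diff divide_simps)
    next
      show "((\<lambda>s. \<kappa> * (real l * s * (1 + s\<^sup>2) powr (real l / 2 - 1))) has_real_derivative \<kappa> * real l) (at 0)"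
        by (auto intro!: derivative_eq_intros)
    qed
    have radial: "(deriv ^^ 2) (\<lambda>s. w (pole + s *\<^sub>R pole)) 0 = \<kappa> * (real l * (real l - 1))"
    proof (rule deriv2I)
      fix s :: real assume "\<bar>s\<bar> < 1"
      then have "norm (pole + s *\<^sub>R pole) = 1 + s"
        using norm_scaleR[of "1 + s" pole] by (simp add: scaleR_add_left)
      then show "w (pole + s *\<^sub>R pole) = \<kappa> * (1 + s) ^ l" by (simp add: w_norm)
      show "((\<lambda>s. \<kappa> * (1 + s) ^ l) has_real_derivative \<kappa> * (real l * (1 + s) ^ (l - 1))) (at s)"
        by (auto intro!: derivative_eq_intros)
    next
      show "((\<lambda>s. \<kappa> * (real l * (1 + s) ^ (l - 1))) has_real_derivative \<kappa> * (real l * (real l - 1))) (at 0)"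
        using l by (auto intro!: derivative_eq_intros simp: of_nat_diff)
    qed
    have "0 = laplacian w pole" using solid_harmonicsD(3)[OF w] by simp
    also have "\<dots> = (\<Sum>b\<in>Basis - {pole}. (deriv ^^ 2) (\<lambda>s. w (pole + s *\<^sub>R b)) 0) + \<kappa> * (real l * (real l - 1))"
      unfolding laplacian_def by (subst sum.remove[OF _ pole_Basis]) (auto simp: radial)
    also have "\<dots> = \<kappa> * (real l * (real n + real l - 1))"
      using dim pole_Basis by (simp add: tangential algebra_simps)
    finally show ?thesis using l n_pos by simp
  qed
  then have "w = (\<lambda>x. 0)" using w_norm by auto
  then show ?thesis using L_w[OF g] by (simp add: L_def sphere_inner_def)
qed

text \<open>
  Expanding \<open>f\<close> around \<open>y\<close> into homogeneous parts, only the constant part has a nonzero integral over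
  the ball.
\<close>

lemma ball_mean_value:
  fixes f :: "'a \<Rightarrow> real"
  assumes f: "real_polynomial_function f" and harm: "\<And>x. laplacian f x = 0"
  shows "(\<integral>x\<in>ball y r. f x \<partial>lborel) = measure lborel (ball y r) * f (y :: 'a)"
proof -
  let ?g = "\<lambda>z. f (y + z)"
  have g: "real_polynomial_function ?g"
    using f
  proof induction
    case (linear f)
    then show ?case
      by (simp add: linear_simps(1)[OF linear]) (intro real_polynomial_function.intros linear)
  qed (auto intro: real_polynomial_function.intros)
  have glap: "laplacian ?g x = 0" for x
    using harm[of "y + x"] by (simp add: laplacian_def add.assoc)
  obtain N F where F: "\<And>k. F k \<in> homogeneous_polynomials k" and gF: "\<And>x. ?g x = (\<Sum>k\<le>N. F k x)"
    using homogeneous_parts[OF g] by metis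
  have "laplacian (\<lambda>x. \<Sum>k\<le>N. F k x) x = 0" for x using glap[of x] unfolding gF .
  then have Fh: "F k \<in> solid_harmonics k" if "k \<le> N" for k
    using homogeneous_parts_harmonic[OF F _ that] by blast
  have hom: "F k (0 *\<^sub>R x) = 0 ^ k * F k x" for k x
    using F[of k] unfolding homogeneous_polynomials_def by blast
  have F0: "F k 0 = 0" if "k \<ge> 1" for k using hom[of k 0] that by (cases k) simp_all
  have F_const: "F 0 x = F 0 0" for x using hom[of 0 x] by simp
  have "(\<integral>x\<in>ball y r. f x \<partial>lborel) = (\<integral>x. indicator (ball y r) x *\<^sub>R f x \<partial>distr lborel borel ((+) y))"
    by (simp add: lborel_distr_plus set_lebesgue_integral_def)
  also have "\<dots> = (\<integral>z. indicator (ball y r) (y + z) *\<^sub>R f (y + z) \<partial>lborel)"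
  proof (rule integral_distr)
    have "f \<in> borel_measurable borel" using f
      by (meson borel_measurable_continuous_onI continuous_on_polymonial_function real_polynomial_function_eq)
    then show "(\<lambda>x. indicator (ball y r) x *\<^sub>R f x) \<in> borel_measurable borel"
      by (intro borel_measurable_scaleR borel_measurable_indicator) auto
  qed auto
  also have "\<dots> = (\<integral>z. (\<Sum>k\<le>N. indicator (ball 0 r) z *\<^sub>R F k z) \<partial>lborel)"
    by (intro Bochner_Integration.integral_cong refl) (simp add: gF indicator_def dist_norm sum_distrib_left)
  also have "\<dots> = (\<Sum>k\<le>N. \<integral>z\<in>ball 0 r. F k z \<partial>lborel)"
    unfolding set_lebesgue_integral_def
    using set_integrable_ball_continuous[OF continuous_on_solid_harmonic[OF Fh]]
    by (intro Bochner_Integration.integral_sum) (auto simp: set_integrable_def)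
  also have "\<dots> = (\<Sum>k\<le>N. if k = 0 then measure lborel (ball y r) * F 0 0 else 0)"
  proof (rule sum.cong[OF refl])
    fix k assume k: "k \<in> {..N}"
    show "(\<integral>z\<in>ball 0 r. F k z \<partial>lborel) = (if k = 0 then measure lborel (ball y r) * F 0 0 else 0)"
    proof (cases "k = 0")
      case True
      have "(\<integral>z\<in>ball 0 r. F 0 z \<partial>lborel) = (\<integral>z\<in>ball (0::'a) r. F 0 0 \<partial>lborel)"
      proof -
        have "F 0 = (\<lambda>_. F 0 0)" by (rule ext) (rule F_const)
        then show ?thesis by (rule arg_cong)
      qed
      also have "\<dots> = measure lborel (ball (0::'a) r) * F 0 0"
        using emeasure_lborel_ball_finite[of "0::'a" r] by (simp add: set_lebesgue_integral_def)
      also have "measure lborel (ball (0::'a) r) = measure lborel (ball y r)"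
      proof (cases "r \<ge> 0")
        case True
        then show ?thesis using content_ball_conv_unit_ball[of r "0::'a"] content_ball_conv_unit_ball[of r y] by simp
      qed (simp add: ball_empty)
      finally show ?thesis using True by simp
    qed (use k Fh[of k] ball_integral_harmonic[of "F k" k r] in auto)
  qed
  also have "\<dots> = measure lborel (ball y r) * F 0 0" by simp
  also have "F 0 0 = f y"
  proof -
    have "f y = (\<Sum>k\<le>N. F k 0)" using gF[of 0] by simp
    also have "\<dots> = (\<Sum>k\<le>N. if k = 0 then F 0 0 else 0)"
      by (rule sum.cong) (auto simp: F0)
    finally show ?thesis by simp
  qed
  finally show ?thesis .
qed

text \<open>
  The mean of \<open>f\<^sup>2\<close> exceeds the square of the mean, which is the value at the centre.
\<close>

lemma square_le_ball_average:
  fixes f :: "'a \<Rightarrow> real"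
  assumes f: "real_polynomial_function f" and harm: "\<And>x. laplacian f x = 0" and r: "r > 0"
  shows "(f y)\<^sup>2 * measure lborel (ball (y :: 'a) r) \<le> (\<integral>x\<in>ball y r. (f x)\<^sup>2 \<partial>lborel)"
proof -
  let ?v = "measure lborel (ball y r)"
  have v: "?v > 0" using content_ball_pos[OF r] .
  have c: "continuous_on UNIV f" using f
    by (meson continuous_on_polymonial_function real_polynomial_function_eq)
  have i1: "set_integrable lborel (ball y r) (\<lambda>x. (f x)\<^sup>2)"
    and i2: "set_integrable lborel (ball y r) f"
    and i3: "set_integrable lborel (ball y r) (\<lambda>x. (f y)\<^sup>2 :: real)"
    by (intro set_integrable_ball_continuous continuous_intros c)+
  have "0 \<le> (\<integral>x\<in>ball y r. (f x - f y)\<^sup>2 \<partial>lborel)"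
    unfolding set_lebesgue_integral_def by (intro Bochner_Integration.integral_nonneg) simp
  also have "(\<integral>x\<in>ball y r. (f x - f y)\<^sup>2 \<partial>lborel) =
      (\<integral>x\<in>ball y r. (f x)\<^sup>2 - 2 * f y * f x + (f y)\<^sup>2 \<partial>lborel)"
    by (simp add: power2_diff algebra_simps)
  also have "\<dots> = (\<integral>x\<in>ball y r. (f x)\<^sup>2 \<partial>lborel) - 2 * f y * (\<integral>x\<in>ball y r. f x \<partial>lborel) + (\<integral>x\<in>ball y r. (f y)\<^sup>2 \<partial>lborel)"
    using i1 i2 i3 by (simp add: set_integral_add set_integral_diff set_integrable_mult_right)
  also have "(\<integral>x\<in>ball y r. (f y)\<^sup>2 \<partial>lborel) = ?v * (f y)\<^sup>2"
    using emeasure_lborel_ball_finite[of y r] by (simp add: set_lebesgue_integral_def)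
  also have "(\<integral>x\<in>ball y r. f x \<partial>lborel) = ?v * f y" by (rule ball_mean_value[OF f harm])
  finally show ?thesis by (simp add: power2_eq_square algebra_simps)
qed

end

section \<open>A Bessel function that takes a negative value\<close>

primrec bessel_coeff :: "nat \<Rightarrow> nat \<Rightarrow> real" where
  "bessel_coeff n 0 = 1"
| "bessel_coeff n (Suc k) = - bessel_coeff n k / (2 * (real k + 1) * (2 * real k + real n))"

text \<open>
  In terms of the Bessel function of the first kind, \<open>bessel_profile n (x\<^sup>2)\<close> is
  \<open>Gamma (n / 2) * (2 / x) powr (n / 2 - 1) * J (n / 2 - 1) x\<close>. It is \<open>cos x\<close> for \<open>n = 1\<close> and \<open>sin x / x\<close>
  for \<open>n = 3\<close>.
\<close>

definition bessel_profile :: "nat \<Rightarrow> real \<Rightarrow> real" where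
  "bessel_profile n z = (\<Sum>k. bessel_coeff n k * z ^ k)"

lemma bessel_coeff_bound: "n \<ge> 1 \<Longrightarrow> \<bar>bessel_coeff n k\<bar> \<le> 1 / fact k"
proof (induction k)
  case (Suc k)
  let ?q = "2 * (real k + 1) * (2 * real k + real n)"
  have q: "real k + 1 \<le> ?q"
    using Suc.prems mult_left_mono[of 1 "2 * (2 * real k + real n)" "real k + 1"]
    by (simp only: mult_ac) simp
  have "\<bar>bessel_coeff n (Suc k)\<bar> = \<bar>bessel_coeff n k\<bar> / ?q"
    using q by (simp add: abs_mult)
  also have "\<dots> \<le> (1 / fact k) / (real k + 1)"
    by (intro frac_le q Suc.IH Suc.prems) simp_all
  finally have "\<bar>bessel_coeff n (Suc k)\<bar> \<le> (1 / fact k) / (real k + 1)" .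
  then show ?case by (simp add: field_simps)
qed simp

lemma bessel_coeff_closed:
  assumes n: "n \<ge> 1"
  shows "bessel_coeff n k = (- 1 / 4) ^ k / (fact k * pochhammer (real n / 2) k)"
proof (induction k)
  case (Suc k)
  have "pochhammer (real n / 2) k > 0" using n by (intro pochhammer_pos) auto
  have "2 * (real k + 1) * (2 * real k + real n) = 4 * ((real k + 1) * (real n / 2 + real k))"
    by (simp add: algebra_simps)
  then show ?case by (simp add: pochhammer_Suc Suc mult_ac)
qed simp

lemma abs_summable_bessel:
  assumes "n \<ge> 1" shows "summable (\<lambda>k. norm (bessel_coeff n k * z ^ k))"
proof (rule summable_comparison_test')
  show "summable (\<lambda>k. inverse (fact k) * \<bar>z\<bar> ^ k)" by (rule summable_exp)
  fix k :: nat
  have "\<bar>bessel_coeff n k\<bar> * \<bar>z\<bar> ^ k \<le> 1 / fact k * \<bar>z\<bar> ^ k"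
    by (intro mult_right_mono bessel_coeff_bound assms) simp
  then show "norm (norm (bessel_coeff n k * z ^ k)) \<le> inverse (fact k) * \<bar>z\<bar> ^ k"
    by (simp only: real_norm_def abs_abs abs_mult power_abs divide_inverse mult_1)
qed

lemma summable_bessel: "n \<ge> 1 \<Longrightarrow> summable (\<lambda>k. bessel_coeff n k * z ^ k)"
  using abs_summable_bessel by (rule summable_norm_cancel)

lemma continuous_bessel_profile:
  assumes "n \<ge> 1" shows "isCont (bessel_profile n) z"
  unfolding bessel_profile_def[abs_def]
  by (rule isCont_powser[where K = "norm z + 1"]) (simp_all add: summable_bessel[OF assms])

text \<open>
  The exponential series with the weight \<open>a + k\<close>; such series arise below from
  \<open>Gamma (a + k + 1) = (a + k) * Gamma (a + k)\<close>.
\<close>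

lemma exp_moment_sums: "(\<lambda>k. x ^ k / fact k * (a + real k)) sums ((a + x) * exp (x::real))"
proof -
  have e: "(\<lambda>k. x ^ k / fact k) sums exp x"
    using exp_converges[of x] by (simp add: divide_inverse mult.commute)
  have "(\<lambda>k. x ^ Suc k / fact (Suc k) * real (Suc k)) sums (x * exp x)"
    using sums_mult[OF e, of x] by (simp add: field_simps del: of_nat_Suc)
  then have "(\<lambda>k. x ^ k / fact k * real k) sums (x * exp x)"
    using sums_Suc[of "\<lambda>k. x ^ k / fact k * real k"] by simp
  from sums_add[OF sums_mult[OF e, of a] this] show ?thesis
    by (simp add: algebra_simps add_divide_distrib)
qed

text \<open>
  The profile has a negative integral against the positive density \<open>t powr (n / 2) * exp (- t)\<close> if its
  argument is \<open>4 * n * t\<close>. Term by term, the Gamma integrals turn the Bessel series into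
  \<open>Gamma (n / 2) * (\<Sum>k. (- n) ^ k / fact k * (n / 2 + k))\<close>, whose value is
  \<open>Gamma (n / 2) * (n / 2 - n) * exp (- n)\<close>.
\<close>

lemma bessel_profile_negative:
  assumes n: "n \<ge> 1"
  obtains z where "z > 0" "bessel_profile n z < 0"
proof -
  \<comment> \<open>The exponent of the density is \<open>?s - 1 = n / 2\<close>. With \<open>n / 2 - 1\<close> instead, the Gamma factors would
    cancel completely and the integral would be a positive multiple of \<open>exp (- n)\<close>; the extra factor
    \<open>t\<close> contributes the weight \<open>n / 2 + k\<close>, hence \<open>n / 2 - n < 0\<close>.\<close>
  let ?s = "real n / 2 + 1" and ?b = "4 * real n"
  define c where "c k = bessel_coeff n k * ?b ^ k" for k
  define g where "g k t = indicator {0..} t * t powr (?s + real k - 1) / exp t" for k and t :: real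
  have coeff: "c k * Gamma (?s + real k) = Gamma (real n / 2) * ((- real n) ^ k / fact k * (real n / 2 + real k))" for k
  proof -
    have p: "pochhammer (real n / 2) k > 0" using n by (intro pochhammer_pos) auto
    have "real n / 2 + real k \<notin> \<int>\<^sub>\<le>\<^sub>0" using n by (auto dest!: nonpos_Ints_nonpos)
    then have "Gamma (?s + real k) = (real n / 2 + real k) * Gamma (real n / 2 + real k)"
      using Gamma_plus1[of "real n / 2 + real k"] by (simp add: add_ac)
    also have "Gamma (real n / 2 + real k) = pochhammer (real n / 2) k * Gamma (real n / 2)"
    proof -
      have "real n / 2 \<notin> \<int>\<^sub>\<le>\<^sub>0" using n by (auto dest!: nonpos_Ints_nonpos)
      moreover from this have "Gamma (real n / 2) \<noteq> 0" by (simp add: Gamma_eq_zero_iff)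
      ultimately show ?thesis using pochhammer_Gamma[of "real n / 2" k] by (simp add: field_simps)
    qed
    finally have G: "Gamma (?s + real k) = (real n / 2 + real k) * (pochhammer (real n / 2) k * Gamma (real n / 2))" .
    have "c k = (- real n) ^ k / (fact k * pochhammer (real n / 2) k)"
    proof -
      have "(- 1 / 4) ^ k * ?b ^ k = ((- 1 / 4) * ?b) ^ k" by (rule power_mult_distrib[symmetric])
      also have "(- 1 / 4) * ?b = - real n" by simp
      finally show ?thesis unfolding c_def bessel_coeff_closed[OF n] times_divide_eq_left by simp
    qed
    then show ?thesis unfolding G using p by simp
  qed
  have g_int: "has_bochner_integral lborel (g k) (Gamma (?s + real k))" for k
  proof (rule has_bochner_integral_nn_integral)
    show "g k \<in> borel_measurable lborel" unfolding g_def by measurable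
    show "AE t in lborel. 0 \<le> g k t" by (simp add: g_def)
    show "0 \<le> Gamma (?s + real k)" by (intro less_imp_le Gamma_real_pos) auto
    show "(\<integral>\<^sup>+t. ennreal (g k t) \<partial>lborel) = ennreal (Gamma (?s + real k))"
      unfolding g_def by (rule Gamma_conv_nn_integral_real[symmetric]) simp
  qed
  have I: "integrable lborel (\<lambda>t. c k * g k t)" for k
    using g_int[of k] by (intro integrable_mult_right) (auto simp: has_bochner_integral_iff)
  have "(\<lambda>k. \<integral>t. c k * g k t \<partial>lborel) sums (\<integral>t. (\<Sum>k. c k * g k t) \<partial>lborel)"
  proof (rule sums_integral)
    show "integrable lborel (\<lambda>t. c k * g k t)" for k by (rule I)
    have gt: "c k * g k t = indicator {0..} t * (t powr (real n / 2) / exp t) * (bessel_coeff n k * (?b * t) ^ k)"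
      for k t
      by (cases "t > 0") (auto simp: g_def c_def powr_add powr_realpow power_mult_distrib indicator_def)
    show "AE t in lborel. summable (\<lambda>k. norm (c k * g k t))"
    proof (rule AE_I2)
      fix t
      have "summable (\<lambda>k. norm (bessel_coeff n k * (?b * t) ^ k))"
        by (rule abs_summable_bessel[OF n])
      then show "summable (\<lambda>k. norm (c k * g k t))"
        unfolding gt norm_mult[of "indicator {0..} t * (t powr (real n / 2) / exp t)"]
        by (rule summable_mult)
    qed
    show "summable (\<lambda>k. \<integral>t. norm (c k * g k t) \<partial>lborel)"
    proof -
      have "(\<integral>t. norm (c k * g k t) \<partial>lborel) = Gamma (real n / 2) * (real n ^ k / fact k * (real n / 2 + real k))" for k
      proof -
        have "(\<integral>t. norm (c k * g k t) \<partial>lborel) = \<bar>c k\<bar> * (\<integral>t. g k t \<partial>lborel)"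
        proof -
          have "norm (c k * g k t) = \<bar>c k\<bar> * g k t" for t
            by (simp only: real_norm_def abs_mult) (simp add: g_def)
          then show ?thesis by simp
        qed
        also have "\<dots> = \<bar>c k * Gamma (?s + real k)\<bar>"
          using g_int[of k] by (simp add: abs_mult has_bochner_integral_iff Gamma_real_pos less_imp_le)
        also have "\<dots> = Gamma (real n / 2) * (real n ^ k / fact k * (real n / 2 + real k))"
          unfolding coeff using n by (simp add: abs_mult power_abs less_imp_le Gamma_real_pos)
        finally show ?thesis .
      qed
      moreover have "summable (\<lambda>k. Gamma (real n / 2) * (real n ^ k / fact k * (real n / 2 + real k)))"
        by (intro summable_mult sums_summable[OF exp_moment_sums])
      ultimately show ?thesis by presburger
    qed
  qed
  moreover have "(\<lambda>k. \<integral>t. c k * g k t \<partial>lborel) sums (Gamma (real n / 2) * ((real n / 2 + (- real n)) * exp (- real n)))"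
    using g_int sums_mult[OF exp_moment_sums[of "- real n" "real n / 2"], of "Gamma (real n / 2)"]
    by (simp add: has_bochner_integral_iff coeff)
  ultimately have "(\<integral>t. (\<Sum>k. c k * g k t) \<partial>lborel) = Gamma (real n / 2) * ((real n / 2 + (- real n)) * exp (- real n))"
    using sums_unique2 by blast
  also have "\<dots> < 0"
    using n by (intro mult_pos_neg mult_neg_pos Gamma_real_pos) auto
  finally have neg: "(\<integral>t. (\<Sum>k. c k * g k t) \<partial>lborel) < 0" .
  have "\<exists>t. (\<Sum>k. c k * g k t) < 0"
  proof (rule ccontr)
    assume "\<nexists>t. (\<Sum>k. c k * g k t) < 0"
    then have "(\<integral>t. (\<Sum>k. c k * g k t) \<partial>lborel) \<ge> 0"
      by (intro Bochner_Integration.integral_nonneg_AE) (auto simp: not_less)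
    with neg show False by simp
  qed
  then obtain t where t: "(\<Sum>k. c k * g k t) < 0" by blast
  have tpos: "t > 0"
  proof (rule ccontr)
    assume "\<not> t > 0"
    then have "g k t = 0" for k by (cases "t = 0") (auto simp: g_def)
    then show False using t by simp
  qed
  have "(\<Sum>k. c k * g k t) = (\<Sum>k. (t powr (real n / 2) / exp t) * (bessel_coeff n k * (?b * t) ^ k))"
    using tpos by (intro suminf_cong) (simp add: g_def c_def powr_add powr_realpow power_mult_distrib)
  also have "\<dots> = (t powr (real n / 2) / exp t) * bessel_profile n (?b * t)"
    unfolding bessel_profile_def by (rule suminf_mult) (rule summable_bessel[OF n])
  finally have "bessel_profile n (?b * t) < 0"
    using t tpos by (simp add: mult_less_0_iff divide_less_0_iff)
  moreover have "?b * t > 0" using tpos n by simp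
  ultimately show ?thesis by (rule that[rotated])
qed

text \<open>
  Up to the power of \<open>l\<close>, the two coefficients of index \<open>k\<close> differ by the factor
  \<open>\<Prod>i<2 * k. 1 - i / l\<close>, called \<open>r\<close>. It is one minus at most the sum of all \<open>i / l\<close>, until it
  becomes zero.
\<close>

lemma zonal_coeff_near_bessel:
  assumes n: "n \<ge> 1" and l: "l \<ge> 1"
  shows "\<exists>r. zonal_coeff n l k = r * ((real l)\<^sup>2) ^ k * bessel_coeff n k \<and> 0 \<le> r \<and> r \<le> 1 \<and> 1 - r \<le> 4 * (real k)\<^sup>2 / real l"
proof (induction k)
  case 0
  then show ?case by (intro exI[of _ 1]) simp
next
  case (Suc k)
  then obtain r where r: "zonal_coeff n l k = r * ((real l)\<^sup>2) ^ k * bessel_coeff n k" "0 \<le> r" "r \<le> 1"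
    "1 - r \<le> 4 * (real k)\<^sup>2 / real l" by blast
  let ?f = "(1 - 2 * real k / real l) * (1 - (2 * real k + 1) / real l)"
  have eq: "zonal_coeff n l (Suc k) = (r * ?f) * ((real l)\<^sup>2) ^ Suc k * bessel_coeff n (Suc k)"
  proof -
    have "(real l)\<^sup>2 * ?f = (real l - 2 * real k) * (real l - 2 * real k - 1)"
      using l by (simp add: field_simps power2_eq_square)
    then show ?thesis by (simp add: r(1) mult_ac)
  qed
  show ?case
  proof (cases "2 * k + 1 \<le> l")
    case True
    have 1: "0 \<le> 1 - 2 * real k / real l" "1 - 2 * real k / real l \<le> 1"
      "0 \<le> 1 - (2 * real k + 1) / real l" "1 - (2 * real k + 1) / real l \<le> 1"
      using True l by (auto simp: divide_le_eq)
    have f: "0 \<le> ?f" "?f \<le> 1" using 1 by (auto intro: mult_nonneg_nonneg mult_le_one)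
    have "1 - ?f = (4 * real k + 1) / real l - (2 * real k / real l) * ((2 * real k + 1) / real l)"
      using l by (simp add: field_simps)
    also have "\<dots> \<le> (4 * real k + 1) / real l" by simp
    finally have f1: "1 - ?f \<le> (4 * real k + 1) / real l" .
    have "1 - r * ?f = (1 - r) + r * (1 - ?f)" by (simp add: algebra_simps)
    also have "\<dots> \<le> 4 * (real k)\<^sup>2 / real l + 1 * ((4 * real k + 1) / real l)"
      using r f f1 by (intro add_mono mult_mono) auto
    also have "\<dots> \<le> 4 * (real (Suc k))\<^sup>2 / real l"
      using l by (simp add: add_divide_distrib[symmetric] divide_right_mono power2_eq_square algebra_simps)
    finally show ?thesis using r f mult_le_one[of r ?f] by (intro exI[of _ "r * ?f"] conjI eq) auto
  next
    case False
    have "zonal_coeff n l (Suc k) = 0" using False by (intro zonal_coeff_eq_0) simp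
    moreover have "1 \<le> 4 * (real (Suc k))\<^sup>2 / real l"
    proof -
      have "l \<le> 2 * Suc k" using False by simp
      also have "\<dots> \<le> 4 * (Suc k)\<^sup>2" by (simp add: power2_eq_square)
      finally have "real l \<le> 4 * (real (Suc k))\<^sup>2" by (metis of_nat_le_iff of_nat_mult of_nat_numeral of_nat_power)
      then show ?thesis using l by (simp add: le_divide_eq)
    qed
    ultimately show ?thesis by (intro exI[of _ 0]) simp
  qed
qed

text \<open>
  The form that the Mehler-Heine asymptotics of Gegenbauer polynomials takes here, with an explicit
  rate. The scaling \<open>z / l\<^sup>2\<close> says that a zonal harmonic varies at the angular scale \<open>1 / l\<close>.
\<close>

lemma zonal_profile_near_bessel:
  assumes n: "n \<ge> 1" and l: "l \<ge> 1" and z: "0 \<le> z" "z \<le> X"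
  shows "\<bar>zonal_profile n l (z / (real l)\<^sup>2) - bessel_profile n z\<bar> \<le> 4 * exp (4 * X) / real l"
proof -
  let ?a = "\<lambda>k. zonal_coeff n l k * (z / (real l)\<^sup>2) ^ k" and ?b = "\<lambda>k. bessel_coeff n k * z ^ k"
  have "(\<lambda>k. ?a k) sums zonal_profile n l (z / (real l)\<^sup>2)"
    unfolding zonal_profile_def by (rule sums_finite) (auto simp: zonal_coeff_eq_0)
  moreover have "(\<lambda>k. ?b k) sums bessel_profile n z"
    unfolding bessel_profile_def by (rule summable_sums) (rule summable_bessel[OF n])
  ultimately have s: "(\<lambda>k. ?a k - ?b k) sums (zonal_profile n l (z / (real l)\<^sup>2) - bessel_profile n z)"
    by (rule sums_diff)
  have e: "(\<lambda>k. 4 / real l * ((4 * X) ^ k / fact k)) sums (4 / real l * exp (4 * X))"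
    using exp_converges[of "4 * X"] by (intro sums_mult) (simp add: divide_inverse mult.commute)
  have bd: "norm (?a k - ?b k) \<le> 4 / real l * ((4 * X) ^ k / fact k)" for k
  proof -
    obtain r where r: "zonal_coeff n l k = r * ((real l)\<^sup>2) ^ k * bessel_coeff n k" "0 \<le> r" "r \<le> 1"
      "1 - r \<le> 4 * (real k)\<^sup>2 / real l" using zonal_coeff_near_bessel[OF n l] by blast
    have "((real l)\<^sup>2) ^ k * (z / (real l)\<^sup>2) ^ k = z ^ k"
      using l by (simp add: power_mult_distrib[symmetric] del: power_mult_distrib)
    then have L: "bessel_coeff n k * (((real l)\<^sup>2) ^ k * (z / (real l)\<^sup>2) ^ k) = ?b k" by (simp only:)
    have "?a k = r * (bessel_coeff n k * (((real l)\<^sup>2) ^ k * (z / (real l)\<^sup>2) ^ k))"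
      by (simp only: r(1) mult_ac)
    then have "?a k = r * ?b k" by (simp only: L)
    then have "?a k - ?b k = - ((1 - r) * ?b k)" by (simp only: left_diff_distrib)
    then have "norm (?a k - ?b k) = \<bar>1 - r\<bar> * (\<bar>bessel_coeff n k\<bar> * \<bar>z ^ k\<bar>)"
      by (simp only: real_norm_def abs_minus_cancel abs_mult)
    then have "norm (?a k - ?b k) = (1 - r) * (\<bar>bessel_coeff n k\<bar> * z ^ k)"
      using r z by simp
    also have "\<dots> \<le> (4 * (real k)\<^sup>2 / real l) * (1 / fact k * X ^ k)"
      using r z by (intro mult_mono bessel_coeff_bound n power_mono) auto
    also have "(real k)\<^sup>2 \<le> 4 ^ k"
    proof -
      have "real k \<le> 2 ^ k" using of_nat_less_two_power[of k, where 'a = real] by simp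
      then have "(real k)\<^sup>2 \<le> (2 ^ k)\<^sup>2" by (intro power_mono) auto
      also have "((2::real) ^ k)\<^sup>2 = (2\<^sup>2) ^ k" by (simp only: power_mult[symmetric] mult.commute)
      finally show ?thesis by simp
    qed
    then have "(4 * (real k)\<^sup>2 / real l) * (1 / fact k * X ^ k) \<le> (4 * 4 ^ k / real l) * (1 / fact k * X ^ k)"
      using z by (intro mult_right_mono divide_right_mono) auto
    also have "\<dots> = 4 / real l * ((4 * X) ^ k / fact k)" by (simp add: power_mult_distrib)
    finally show ?thesis .
  qed
  have "norm (\<Sum>k. ?a k - ?b k) \<le> (\<Sum>k. 4 / real l * ((4 * X) ^ k / fact k))"
    by (rule norm_suminf_le[OF bd sums_summable[OF e]])
  then show ?thesis using sums_unique[OF s] sums_unique[OF e] by simp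
qed

text \<open>
  The bound is uniform in the degrees of a whole band, all tested at the same aperture \<open>x / A\<close>. Within
  a narrow band the Bessel argument \<open>(x * l / A)\<^sup>2\<close> stays close to a point where the Bessel profile is
  negative. The power of the cosine \<open>1 / sqrt (1 + (x / A)\<^sup>2)\<close> does not spoil the bound, because it is
  about \<open>exp (- x\<^sup>2 * l / (2 * A\<^sup>2))\<close> and \<open>l\<close> is comparable to \<open>A \<ge> 1\<close>.
\<close>

lemma zonal_profile_negative_band:
  assumes n: "n \<ge> 1"
  obtains x \<delta> c A0 where "x > 0" "\<delta> > 0" "c > 0" "A0 \<ge> 1"
    "\<And>A l. A \<ge> A0 \<Longrightarrow> A \<le> real l \<Longrightarrow> real l \<le> (1 + \<delta>) * A \<Longrightarrow>
       (1 / sqrt (1 + (x / A)\<^sup>2)) ^ l * zonal_profile n l ((x / A)\<^sup>2) \<le> - c"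
proof -
  obtain z where z: "z > 0" "bessel_profile n z < 0" using bessel_profile_negative[OF n] by blast
  define \<nu> where "\<nu> = - bessel_profile n z"
  have \<nu>: "\<nu> > 0" using z by (simp add: \<nu>_def)
  from continuous_bessel_profile[OF n, of z] obtain \<eta> where \<eta>: "\<eta> > 0"
    "\<And>w. dist w z < \<eta> \<Longrightarrow> dist (bessel_profile n w) (bessel_profile n z) < \<nu> / 2"
    unfolding continuous_at_eps_delta using \<nu> half_gt_zero by blast
  \<comment> \<open>For \<open>l\<close> in the band the argument \<open>z * (l / A)\<^sup>2\<close> is at most \<open>z * (1 + 3 * \<delta>)\<close>, and \<open>3 * \<delta> * z < \<eta>\<close>.\<close>
  define \<delta> where "\<delta> = min 1 (\<eta> / (4 * z))"
  have \<delta>: "\<delta> > 0" "\<delta> \<le> 1" "4 * z * \<delta> \<le> \<eta>"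
    using \<eta> z by (auto simp: \<delta>_def min_def field_simps)
  \<comment> \<open>From \<open>A0\<close> on, the distance between the profiles, with arguments up to \<open>4 * z\<close>, is at most \<open>\<nu> / 4\<close>.\<close>
  define A0 where "A0 = max 1 (16 * exp (16 * z) / \<nu>)"
  show ?thesis
  proof (rule that[of "sqrt z" \<delta> "exp (- (2 * z)) * (\<nu> / 4)" A0])
    fix A :: real and l :: nat
    assume A: "A0 \<le> A" "A \<le> real l" "real l \<le> (1 + \<delta>) * A"
    have A1: "A \<ge> 1" "16 * exp (16 * z) / \<nu> \<le> A" using A(1) by (auto simp: A0_def)
    have l: "l \<ge> 1" using A1 A by linarith
    let ?q = "(real l / A)\<^sup>2" and ?\<rho> = "sqrt z / A"
    have q0: "1 \<le> real l / A" "real l / A \<le> 1 + \<delta>" using A A1 by (auto simp: field_simps)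
    have q1: "1 \<le> ?q" using q0 by simp
    have "?q \<le> (1 + \<delta>)\<^sup>2" using q0 by (intro power_mono) auto
    also have "\<dots> \<le> 1 + 3 * \<delta>" using \<delta> by (simp add: power2_eq_square algebra_simps mult_left_le)
    finally have q2: "?q \<le> 1 + 3 * \<delta>" .
    have \<rho>: "?\<rho>\<^sup>2 = (z * ?q) / (real l)\<^sup>2" using z l A1 by (simp add: power_divide)
    have "dist (z * ?q) z = z * (?q - 1)" using z q1 by (simp add: dist_real_def algebra_simps)
    also have "\<dots> \<le> z * (3 * \<delta>)" using z q2 by (intro mult_left_mono) auto
    also have "\<dots> < \<eta>" using \<delta> z mult_pos_pos[OF z(1) \<delta>(1)] by linarith
    finally have "dist (bessel_profile n (z * ?q)) (bessel_profile n z) < \<nu> / 2" by (rule \<eta>(2))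
    then have J: "bessel_profile n (z * ?q) < - \<nu> / 2" by (simp add: dist_real_def \<nu>_def)
    have "z * ?q \<le> z * 4" using z q2 \<delta> by (intro mult_left_mono) auto
    then have "\<bar>zonal_profile n l (?\<rho>\<^sup>2) - bessel_profile n (z * ?q)\<bar> \<le> 4 * exp (4 * (4 * z)) / real l"
      unfolding \<rho> using z by (intro zonal_profile_near_bessel n l) auto
    also have "\<dots> \<le> \<nu> / 4"
    proof -
      have "16 * exp (16 * z) \<le> A * \<nu>" using A1(2) \<nu> by (simp only: pos_divide_le_eq)
      also have "\<dots> \<le> real l * \<nu>" using A \<nu> by (intro mult_right_mono) auto
      finally show ?thesis using l by (simp add: field_simps)
    qed
    finally have V: "zonal_profile n l (?\<rho>\<^sup>2) \<le> - (\<nu> / 4)" using J by linarith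
    have "exp (- (2 * z)) \<le> (1 / sqrt (1 + ?\<rho>\<^sup>2)) ^ l"
    proof -
      have "sqrt (1 + ?\<rho>\<^sup>2) \<le> 1 + ?\<rho>\<^sup>2"
        by (rule real_le_lsqrt) (auto intro!: self_le_power)
      also have "\<dots> \<le> exp (?\<rho>\<^sup>2)" by (rule exp_ge_add_one_self)
      finally have "sqrt (1 + ?\<rho>\<^sup>2) ^ l \<le> exp (?\<rho>\<^sup>2) ^ l" by (intro power_mono) auto
      also have "\<dots> = exp (real l * ?\<rho>\<^sup>2)" by (simp add: exp_of_nat_mult)
      also have "real l * ?\<rho>\<^sup>2 \<le> 2 * z"
      proof -
        have "real l * ?\<rho>\<^sup>2 = (real l / A) * (z / A)" using z A1 by (simp add: power2_eq_square)
        also have "\<dots> \<le> 2 * z"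
        proof (rule mult_mono)
          show "real l / A \<le> 2" using q0 \<delta> by linarith
          show "z / A \<le> z" using z A1 by (simp add: divide_le_eq)
        qed (use z A1 in auto)
        finally show ?thesis .
      qed
      finally have "sqrt (1 + ?\<rho>\<^sup>2) ^ l \<le> exp (2 * z)" by simp
      moreover have "sqrt (1 + ?\<rho>\<^sup>2) ^ l > 0" by (simp add: add_pos_nonneg)
      ultimately have "inverse (exp (2 * z)) \<le> inverse (sqrt (1 + ?\<rho>\<^sup>2) ^ l)"
        by (intro le_imp_inverse_le) auto
      then show ?thesis by (simp add: exp_minus power_one_over divide_inverse power_inverse)
    qed
    then have "exp (- (2 * z)) * (\<nu> / 4) \<le> (1 / sqrt (1 + ?\<rho>\<^sup>2)) ^ l * (- zonal_profile n l (?\<rho>\<^sup>2))"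
      using V \<nu> by (intro mult_mono) auto
    then show "(1 / sqrt (1 + ?\<rho>\<^sup>2)) ^ l * zonal_profile n l (?\<rho>\<^sup>2) \<le> - (exp (- (2 * z)) * (\<nu> / 4))"
      by simp
  qed (use z \<delta> \<nu> in \<open>auto simp: A0_def\<close>)
qed

section \<open>Shifted Gaussian vectors\<close>

lemma gaussian_law:
  assumes X: "iid_standard_gaussian M I X" and fin: "finite I" and ne: "I \<noteq> {}"
  shows "distr M (\<Pi>\<^sub>M i\<in>I. borel) (\<lambda>\<omega>. \<lambda>i\<in>I. X i \<omega>) = (\<Pi>\<^sub>M i\<in>I. density lborel std_normal_density)"
proof -
  interpret prob_space M using X by (simp add: iid_standard_gaussian_def)
  have d: "distributed M lborel (X i) std_normal_density" if "i \<in> I" for i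
    using X that by (simp add: iid_standard_gaussian_def)
  have rv: "X i \<in> borel_measurable M" if "i \<in> I" for i
    using distributed_measurable[OF d[OF that]] by simp
  have "distr M (\<Pi>\<^sub>M i\<in>I. borel) (\<lambda>\<omega>. \<lambda>i\<in>I. X i \<omega>) = (\<Pi>\<^sub>M i\<in>I. distr M borel (X i))"
    using X indep_vars_iff_distr_eq_PiM'[OF ne rv] by (simp add: iid_standard_gaussian_def)
  also have "\<dots> = (\<Pi>\<^sub>M i\<in>I. density lborel std_normal_density)"
  proof (rule PiM_cong[OF refl])
    fix i assume "i \<in> I"
    have "distr M borel (X i) = distr M lborel (X i)" by (rule distr_cong) auto
    then show "distr M borel (X i) = density lborel std_normal_density"
      using distributed_distr_eq_density[OF d[OF \<open>i \<in> I\<close>]] by simp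
  qed
  finally show ?thesis .
qed

lemma normal_shift_density:
  "density lborel (normal_density b 1) = density (density lborel std_normal_density) (\<lambda>x. ennreal (exp (b * x - b\<^sup>2 / 2)))"
proof -
  have "normal_density b 1 x = std_normal_density x * exp (b * x - b\<^sup>2 / 2)" for x
    unfolding normal_density_def
    by (simp add: mult.assoc exp_add[symmetric]) (simp add: power2_eq_square field_simps)
  then show ?thesis
    by (subst density_density_eq) (auto simp: ennreal_mult intro!: density_cong)
qed

lemma prob_space_std_normal: "prob_space (density lborel std_normal_density)"
  by (rule prob_space_normal_density) simp

lemma distr_normal_shift:
  "distr (density lborel std_normal_density) borel (\<lambda>x. x + b) = density lborel (normal_density b 1)"
proof -
  interpret prob_space "density lborel std_normal_density" by (rule prob_space_std_normal)
  have "distributed (density lborel std_normal_density) lborel (\<lambda>x. x) std_normal_density"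
    unfolding distributed_def by (auto simp: distr_id2)
  from normal_density_affine[OF this, of 1 b]
  have "distributed (density lborel std_normal_density) lborel (\<lambda>x. x + b) (normal_density b 1)"
    by (simp add: add.commute)
  from distributed_distr_eq_density[OF this]
  have "distr (density lborel std_normal_density) lborel (\<lambda>x. x + b) = density lborel (normal_density b 1)" .
  moreover have "distr (density lborel std_normal_density) borel (\<lambda>x. x + b) = distr (density lborel std_normal_density) lborel (\<lambda>x. x + b)"
    by (rule distr_cong) auto
  ultimately show ?thesis by simp
qed

abbreviation gauss :: "'i set \<Rightarrow> ('i \<Rightarrow> real) measure" where
  "gauss I \<equiv> \<Pi>\<^sub>M i\<in>I. density lborel std_normal_density"

text \<open>
  The Cameron-Martin formula in finitely many dimensions.
\<close>

lemma gauss_shift: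
  assumes fin: "finite I"
  shows "distr (gauss I) (\<Pi>\<^sub>M i\<in>I. borel) (\<lambda>a. \<lambda>i\<in>I. a i + b i) =
    density (gauss I) (\<lambda>a. \<Prod>i\<in>I. ennreal (exp (b i * a i - (b i)\<^sup>2 / 2)))"
proof -
  let ?N = "density lborel std_normal_density" and ?Nb = "\<lambda>i. density lborel (normal_density (b i) 1)"
  interpret N: prob_space ?N by (rule prob_space_std_normal)
  interpret P: product_prob_space "\<lambda>_. ?N" I by standard
  interpret Q: product_prob_space ?Nb I
    by (rule product_prob_spaceI) (rule prob_space_normal_density, simp)
  have [measurable_cong]: "sets (\<Pi>\<^sub>M i\<in>I. borel :: real measure) = sets (gauss I)" by (rule sets_PiM_cong) auto
  have [measurable_cong]: "sets (PiM I ?Nb) = sets (gauss I)" by (rule sets_PiM_cong) auto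
  have shift [measurable]: "(\<lambda>a. \<lambda>i\<in>I. a i + b i) \<in> measurable (gauss I) (\<Pi>\<^sub>M i\<in>I. borel)"
    by (intro measurable_restrict borel_measurable_add borel_measurable_const measurable_component_singleton[THEN measurable_compose]) auto
  have "distr (gauss I) (\<Pi>\<^sub>M i\<in>I. borel) (\<lambda>a. \<lambda>i\<in>I. a i + b i) = PiM I ?Nb"
  proof (rule Q.PiM_eqI[OF fin])
    show "sets (distr (gauss I) (\<Pi>\<^sub>M i\<in>I. borel) (\<lambda>a. \<lambda>i\<in>I. a i + b i)) = sets (PiM I ?Nb)"
      unfolding sets_distr by (rule sets_PiM_cong) auto
    fix A assume "\<And>i. i \<in> I \<Longrightarrow> A i \<in> sets (?Nb i)"
    then have A: "\<And>i. i \<in> I \<Longrightarrow> A i \<in> sets borel" by simp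
    have pre: "(\<lambda>a. \<lambda>i\<in>I. a i + b i) -` (Pi\<^sub>E I A) \<inter> space (gauss I) = Pi\<^sub>E I (\<lambda>i. (\<lambda>x. x + b i) -` A i)"
      by (auto simp: space_PiM PiE_iff)
    have A': "(\<lambda>x. x + b i) -` A i \<in> sets borel" if "i \<in> I" for i
      using A[OF that] by (intro measurable_sets_borel[of _ borel]) auto
    have "emeasure (distr (gauss I) (\<Pi>\<^sub>M i\<in>I. borel) (\<lambda>a. \<lambda>i\<in>I. a i + b i)) (Pi\<^sub>E I A) =
        emeasure (gauss I) (Pi\<^sub>E I (\<lambda>i. (\<lambda>x. x + b i) -` A i))"
      using A fin by (subst emeasure_distr[OF shift]) (auto simp: pre intro!: sets_PiM_I_finite)
    also have "\<dots> = (\<Prod>i\<in>I. emeasure ?N ((\<lambda>x. x + b i) -` A i))"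
      using A' by (intro P.emeasure_PiM fin) auto
    also have "\<dots> = (\<Prod>i\<in>I. emeasure (?Nb i) (A i))"
    proof (rule prod.cong[OF refl])
      fix i assume i: "i \<in> I"
      have "emeasure (?Nb i) (A i) = emeasure (distr ?N borel (\<lambda>x. x + b i)) (A i)"
        by (simp only: distr_normal_shift)
      also have "\<dots> = emeasure ?N ((\<lambda>x. x + b i) -` A i)"
        using A[OF i] by (subst emeasure_distr) auto
      finally show "emeasure ?N ((\<lambda>x. x + b i) -` A i) = emeasure (?Nb i) (A i)" by simp
    qed
    finally show "emeasure (distr (gauss I) (\<Pi>\<^sub>M i\<in>I. borel) (\<lambda>a. \<lambda>i\<in>I. a i + b i)) (Pi\<^sub>E I A) =
       (\<Prod>i\<in>I. emeasure (?Nb i) (A i))" .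
  qed
  moreover have "density (gauss I) (\<lambda>a. \<Prod>i\<in>I. ennreal (exp (b i * a i - (b i)\<^sup>2 / 2))) = PiM I ?Nb"
  proof (rule Q.PiM_eqI[OF fin])
    show "sets (density (gauss I) (\<lambda>a. \<Prod>i\<in>I. ennreal (exp (b i * a i - (b i)\<^sup>2 / 2)))) = sets (PiM I ?Nb)"
      unfolding sets_density by (rule sets_PiM_cong) auto
    fix A assume "\<And>i. i \<in> I \<Longrightarrow> A i \<in> sets (?Nb i)"
    then have A [measurable]: "\<And>i. i \<in> I \<Longrightarrow> A i \<in> sets borel" by simp
    let ?e = "\<lambda>i x. ennreal (exp (b i * x - (b i)\<^sup>2 / 2))"
    have "emeasure (density (gauss I) (\<lambda>a. \<Prod>i\<in>I. ?e i (a i))) (Pi\<^sub>E I A) =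
        (\<integral>\<^sup>+a. (\<Prod>i\<in>I. ?e i (a i)) * indicator (Pi\<^sub>E I A) a \<partial>gauss I)"
      using A fin by (intro emeasure_density) (auto intro!: sets_PiM_I_finite borel_measurable_prod_ennreal)
    also have "\<dots> = (\<integral>\<^sup>+a. (\<Prod>i\<in>I. ?e i (a i) * indicator (A i) (a i)) \<partial>gauss I)"
    proof (rule nn_integral_cong)
      fix a assume "a \<in> space (gauss I)"
      then have ext: "a \<in> extensional I" by (auto simp: space_PiM PiE_def)
      have "indicator (Pi\<^sub>E I A) a = (\<Prod>i\<in>I. indicator (A i) (a i) :: ennreal)"
      proof (cases "\<forall>i\<in>I. a i \<in> A i")
        case False
        then show ?thesis using fin by (auto simp: PiE_iff prod_zero indicator_def)
      qed (use ext in \<open>auto simp: PiE_iff\<close>)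
      then show "(\<Prod>i\<in>I. ?e i (a i)) * indicator (Pi\<^sub>E I A) a = (\<Prod>i\<in>I. ?e i (a i) * indicator (A i) (a i))"
        by (simp add: prod.distrib)
    qed
    also have "\<dots> = (\<Prod>i\<in>I. \<integral>\<^sup>+x. ?e i x * indicator (A i) x \<partial>?N)"
      using A by (intro P.product_nn_integral_prod[OF fin]) auto
    also have "\<dots> = (\<Prod>i\<in>I. emeasure (?Nb i) (A i))"
    proof (rule prod.cong[OF refl])
      fix i assume i: "i \<in> I"
      show "(\<integral>\<^sup>+x. ?e i x * indicator (A i) x \<partial>?N) = emeasure (?Nb i) (A i)"
        unfolding normal_shift_density[of "b i"] using A[OF i] by (subst emeasure_density) auto
    qed
    finally show "emeasure (density (gauss I) (\<lambda>a. \<Prod>i\<in>I. ?e i (a i))) (Pi\<^sub>E I A) =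
       (\<Prod>i\<in>I. emeasure (?Nb i) (A i))" .
  qed
  ultimately show ?thesis by simp
qed

lemma gaussian_moments:
  assumes X: "iid_standard_gaussian M I X" and ij: "i \<in> I" "j \<in> I"
  shows "integrable M (\<lambda>\<omega>. X i \<omega> * X j \<omega>)" "(\<integral>\<omega>. X i \<omega> * X j \<omega> \<partial>M) = (if i = j then 1 else 0)"
proof -
  interpret prob_space M using X by (simp add: iid_standard_gaussian_def)
  have d: "distributed M lborel (X i) std_normal_density" if "i \<in> I" for i
    using X that by (simp add: iid_standard_gaussian_def)
  have i1: "integrable M (X i)" "expectation (X i) = 0" if "i \<in> I" for i
  proof -
    show "expectation (X i) = 0" by (rule standard_normal_distributed_expectation[OF d[OF that]])
    have "integrable lborel (\<lambda>x. std_normal_density x * x ^ 1)" by (rule integrable_std_normal_moment)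
    then show "integrable M (X i)"
      using distributed_integrable[OF d[OF that], of "\<lambda>x. x"] by simp
  qed
  have i2: "integrable M (\<lambda>\<omega>. X i \<omega> * X i \<omega>)" "expectation (\<lambda>\<omega>. X i \<omega> * X i \<omega>) = 1" if "i \<in> I" for i
  proof -
    have "integrable lborel (\<lambda>x. std_normal_density x * x ^ 2)" by (rule integrable_std_normal_moment)
    then show "integrable M (\<lambda>\<omega>. X i \<omega> * X i \<omega>)"
      using distributed_integrable[OF d[OF that], of "\<lambda>x. x * x"] by (simp add: power2_eq_square)
    show "expectation (\<lambda>\<omega>. X i \<omega> * X i \<omega>) = 1"
      using standard_normal_distributed_variance[OF d[OF that]] i1(2)[OF that]
      by (simp add: power2_eq_square)
  qed
  show "integrable M (\<lambda>\<omega>. X i \<omega> * X j \<omega>)" "(\<integral>\<omega>. X i \<omega> * X j \<omega> \<partial>M) = (if i = j then 1 else 0)"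
  proof -
    have *: "integrable M (\<lambda>\<omega>. \<Prod>k\<in>{i, j}. X k \<omega>)" "(\<integral>\<omega>. (\<Prod>k\<in>{i, j}. X k \<omega>) \<partial>M) = (\<Prod>k\<in>{i, j}. expectation (X k))"
    proof -
      have ind: "indep_vars (\<lambda>_. borel) X {i, j}"
      proof (rule indep_vars_subset)
        show "indep_vars (\<lambda>_. borel) X I" using X unfolding iid_standard_gaussian_def by blast
      qed (use ij in simp)
      show "integrable M (\<lambda>\<omega>. \<Prod>k\<in>{i, j}. X k \<omega>)"
        by (rule indep_vars_integrable[OF _ ind]) (use ij i1 in auto)
      show "(\<integral>\<omega>. (\<Prod>k\<in>{i, j}. X k \<omega>) \<partial>M) = (\<Prod>k\<in>{i, j}. expectation (X k))"
        by (rule indep_vars_lebesgue_integral[OF _ ind]) (use ij i1 in auto)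
    qed
    show "integrable M (\<lambda>\<omega>. X i \<omega> * X j \<omega>)"
      using *(1) i2(1)[OF ij(1)] by (cases "i = j") auto
    show "(\<integral>\<omega>. X i \<omega> * X j \<omega> \<partial>M) = (if i = j then 1 else 0)"
      using *(2) i2(2)[OF ij(1)] i1(2)[OF ij(1)] by (cases "i = j") auto
  qed
qed

lemma gaussian_quadratic_form:
  assumes X: "iid_standard_gaussian M I X" and fin: "finite I"
  shows "integrable M (\<lambda>\<omega>. \<Sum>i\<in>I. \<Sum>j\<in>I. X i \<omega> * X j \<omega> * G i j)"
    and "(\<integral>\<omega>. (\<Sum>i\<in>I. \<Sum>j\<in>I. X i \<omega> * X j \<omega> * G i j) \<partial>M) = (\<Sum>i\<in>I. G i i)"
proof -
  show "integrable M (\<lambda>\<omega>. \<Sum>i\<in>I. \<Sum>j\<in>I. X i \<omega> * X j \<omega> * G i j)"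
    by (intro Bochner_Integration.integrable_sum integrable_mult_left gaussian_moments(1)[OF X])
  have "(\<integral>\<omega>. (\<Sum>i\<in>I. \<Sum>j\<in>I. X i \<omega> * X j \<omega> * G i j) \<partial>M) = (\<Sum>i\<in>I. \<Sum>j\<in>I. \<integral>\<omega>. X i \<omega> * X j \<omega> * G i j \<partial>M)"
    using gaussian_moments(1)[OF X]
    by (subst Bochner_Integration.integral_sum)
       (auto intro!: Bochner_Integration.integrable_sum integrable_mult_left sum.cong Bochner_Integration.integral_sum)
  also have "\<dots> = (\<Sum>i\<in>I. \<Sum>j\<in>I. (if i = j then 1 else 0) * G i j)"
    by (intro sum.cong refl) (simp add: gaussian_moments(2)[OF X] del: integral_mult_right_zero)
  also have "\<dots> = (\<Sum>i\<in>I. G i i)"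
    by (intro sum.cong refl) (simp add: if_distrib[of "\<lambda>x. x * _"] sum.delta fin cong: if_cong)
  finally show "(\<integral>\<omega>. (\<Sum>i\<in>I. \<Sum>j\<in>I. X i \<omega> * X j \<omega> * G i j) \<partial>M) = (\<Sum>i\<in>I. G i i)" .
qed

text \<open>
  A Gaussian vector comes close to \<open>b\<close>, measured by the form \<open>G\<close>, with a probability bounded below in
  terms of the norm of \<open>b\<close> only. The form is small for the vector itself by Markov's inequality, and
  translation by \<open>b\<close> changes the density by \<open>exp\<close> of a linear form. That linear form is under
  control on an event of probability at least \<open>3 / 4\<close>, again by Markov's inequality.
\<close>

lemma gaussian_shifted_small_ball:
  fixes G :: "'i \<Rightarrow> 'i \<Rightarrow> real"
  assumes X: "iid_standard_gaussian M I X" and fin: "finite I" and ne: "I \<noteq> {}"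
    and pos: "\<And>a. 0 \<le> (\<Sum>i\<in>I. \<Sum>j\<in>I. a i * a j * G i j)"
    and trace: "4 * (\<Sum>i\<in>I. G i i) \<le> V" and V: "V > 0"
    and b: "(\<Sum>i\<in>I. (b i)\<^sup>2) \<le> \<beta>\<^sup>2" and \<beta>: "\<beta> > 0"
  defines "E \<equiv> {\<omega> \<in> space M. (\<Sum>i\<in>I. \<Sum>j\<in>I. (X i \<omega> - b i) * (X j \<omega> - b j) * G i j) \<le> V}"
  shows "E \<in> sets M" and "exp (- 2 * \<beta> - \<beta>\<^sup>2 / 2) / 2 \<le> measure M E"
proof -
  interpret prob_space M using X by (simp add: iid_standard_gaussian_def)
  interpret N: prob_space "density lborel std_normal_density" by (rule prob_space_std_normal)
  interpret P: product_prob_space "\<lambda>_. density lborel std_normal_density" I by standard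
  have rv [measurable]: "X i \<in> borel_measurable M" if "i \<in> I" for i
  proof -
    have "distributed M lborel (X i) std_normal_density" using X that by (simp add: iid_standard_gaussian_def)
    from distributed_measurable[OF this] show ?thesis by simp
  qed
  define S where "S a = (\<Sum>i\<in>I. \<Sum>j\<in>I. a i * a j * G i j)" for a :: "'i \<Rightarrow> real"
  define L where "L a = (\<Sum>i\<in>I. b i * a i)" for a :: "'i \<Rightarrow> real"
  let ?B = "\<Pi>\<^sub>M i\<in>I. borel :: real measure" and ?r = "\<lambda>\<omega>. \<lambda>i\<in>I. X i \<omega>"
  have sb [measurable_cong]: "sets ?B = sets (gauss I)" by (rule sets_PiM_cong) auto
  have S_meas: "S \<in> borel_measurable ?B" and L_meas: "L \<in> borel_measurable ?B"
    unfolding S_def[abs_def] L_def[abs_def] by measurable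
  have r_meas: "?r \<in> measurable M ?B" by (rule measurable_restrict) (rule rv)
  show E: "E \<in> sets M" unfolding E_def by measurable
  have b2: "(\<Sum>i\<in>I. \<Sum>j\<in>I. a i * a j * (b i * b j)) = (L a)\<^sup>2" for a
    by (simp add: L_def power2_eq_square sum_product mult_ac)
  have S1: "measure M {\<omega> \<in> space M. S (?r \<omega>) \<ge> V} \<le> 1 / 4"
  proof -
    have S_r: "S (?r \<omega>) = (\<Sum>i\<in>I. \<Sum>j\<in>I. X i \<omega> * X j \<omega> * G i j)" for \<omega>
      by (simp add: S_def)
    have "measure M {\<omega> \<in> space M. (\<Sum>i\<in>I. \<Sum>j\<in>I. X i \<omega> * X j \<omega> * G i j) \<ge> V} \<le> (\<Sum>i\<in>I. G i i) / V"
      using integral_Markov_inequality_measure[OF gaussian_quadratic_form(1)[OF X fin, of G], of "{}" V] pos V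
      by (simp add: gaussian_quadratic_form(2)[OF X fin])
    also have "\<dots> \<le> 1 / 4" using trace V by (simp add: divide_le_eq)
    finally show ?thesis by (simp only: S_r)
  qed
  have S2: "measure M {\<omega> \<in> space M. (L (?r \<omega>))\<^sup>2 \<ge> 4 * \<beta>\<^sup>2} \<le> 1 / 4"
  proof -
    have L_r: "(L (?r \<omega>))\<^sup>2 = (\<Sum>i\<in>I. \<Sum>j\<in>I. X i \<omega> * X j \<omega> * (b i * b j))" for \<omega>
      using b2[of "?r \<omega>"] by simp
    have i: "integrable M (\<lambda>\<omega>. (L (?r \<omega>))\<^sup>2)"
      unfolding L_r by (rule gaussian_quadratic_form(1)[OF X fin])
    have e: "(\<integral>\<omega>. (L (?r \<omega>))\<^sup>2 \<partial>M) = (\<Sum>i\<in>I. b i * b i)"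
      unfolding L_r by (rule gaussian_quadratic_form(2)[OF X fin])
    have "measure M {\<omega> \<in> space M. (L (?r \<omega>))\<^sup>2 \<ge> 4 * \<beta>\<^sup>2} \<le> (\<Sum>i\<in>I. b i * b i) / (4 * \<beta>\<^sup>2)"
      using integral_Markov_inequality_measure[OF i, of "{}" "4 * \<beta>\<^sup>2"] \<beta> by (simp only: e) simp
    also have "\<dots> \<le> 1 / 4" using b \<beta> by (simp add: divide_le_eq power2_eq_square)
    finally show ?thesis .
  qed
  \<comment> \<open>The event for the translated vector is \<open>A\<close>; the smaller set \<open>A'\<close> is the part of it on which the
    density of the translation is bounded below.\<close>
  define A where "A = {a \<in> space ?B. S a \<le> V}"
  define A' where "A' = {a \<in> space ?B. S a \<le> V \<and> L a \<le> 2 * \<beta>}"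
  have A [measurable]: "A \<in> sets ?B" and A' [measurable]: "A' \<in> sets ?B"
    unfolding A_def A'_def using S_meas L_meas by measurable
  have law: "distr M ?B ?r = gauss I" by (rule gaussian_law[OF X fin ne])
  have half: "1 / 2 \<le> measure (gauss I) A'"
  proof -
    have "space M - ({\<omega> \<in> space M. S (?r \<omega>) \<ge> V} \<union> {\<omega> \<in> space M. (L (?r \<omega>))\<^sup>2 \<ge> 4 * \<beta>\<^sup>2}) \<subseteq> ?r -` A' \<inter> space M"
    proof
      fix \<omega> assume w: "\<omega> \<in> space M - ({\<omega> \<in> space M. S (?r \<omega>) \<ge> V} \<union> {\<omega> \<in> space M. (L (?r \<omega>))\<^sup>2 \<ge> 4 * \<beta>\<^sup>2})"
      then have "(L (?r \<omega>))\<^sup>2 \<le> (2 * \<beta>)\<^sup>2"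
        by (auto simp: power_mult_distrib not_le intro: less_imp_le)
      then have "L (?r \<omega>) \<le> 2 * \<beta>" using \<beta> by (intro power2_le_imp_le[of "L (?r \<omega>)"]) auto
      then show "\<omega> \<in> ?r -` A' \<inter> space M" using w by (auto simp: A'_def space_PiM)
    qed
    moreover have m: "{\<omega> \<in> space M. S (?r \<omega>) \<ge> V} \<in> sets M" "{\<omega> \<in> space M. (L (?r \<omega>))\<^sup>2 \<ge> 4 * \<beta>\<^sup>2} \<in> sets M"
      using measurable_compose[OF r_meas S_meas] measurable_compose[OF r_meas L_meas] by measurable
    moreover have "measure M ({\<omega> \<in> space M. S (?r \<omega>) \<ge> V} \<union> {\<omega> \<in> space M. (L (?r \<omega>))\<^sup>2 \<ge> 4 * \<beta>\<^sup>2}) \<le> 1 / 4 + 1 / 4"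
      using S1 S2 by (intro order_trans[OF measure_Un_le[OF m]] add_mono)
    ultimately have "1 / 2 \<le> measure M (?r -` A' \<inter> space M)"
      using finite_measure_mono[of "space M - ({\<omega> \<in> space M. S (?r \<omega>) \<ge> V} \<union> {\<omega> \<in> space M. (L (?r \<omega>))\<^sup>2 \<ge> 4 * \<beta>\<^sup>2})" "?r -` A' \<inter> space M"]
        prob_compl[of "{\<omega> \<in> space M. S (?r \<omega>) \<ge> V} \<union> {\<omega> \<in> space M. (L (?r \<omega>))\<^sup>2 \<ge> 4 * \<beta>\<^sup>2}"]
        measurable_sets[OF r_meas A'] by auto
    also have "\<dots> = measure (distr M ?B ?r) A'" by (rule measure_distr[OF r_meas A', symmetric])
    finally show ?thesis by (simp only: law)
  qed
  have b': "(\<Sum>i\<in>I. (- b i)\<^sup>2 / 2) \<le> \<beta>\<^sup>2 / 2" using b by (simp add: sum_divide_distrib[symmetric])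
  have "ennreal (exp (- 2 * \<beta> - \<beta>\<^sup>2 / 2)) * emeasure (gauss I) A' = (\<integral>\<^sup>+a. ennreal (exp (- 2 * \<beta> - \<beta>\<^sup>2 / 2)) * indicator A' a \<partial>gauss I)"
    using A' by (simp add: nn_integral_cmult_indicator sb)
  also have "\<dots> \<le> (\<integral>\<^sup>+a. (\<Prod>i\<in>I. ennreal (exp (- b i * a i - (- b i)\<^sup>2 / 2))) * indicator A a \<partial>gauss I)"
  proof (rule nn_integral_mono)
    fix a
    have "(\<Prod>i\<in>I. ennreal (exp (- b i * a i - (- b i)\<^sup>2 / 2))) = ennreal (exp (- L a - (\<Sum>i\<in>I. (- b i)\<^sup>2 / 2)))"
      by (simp add: prod_ennreal exp_sum[OF fin, symmetric] L_def sum_subtractf sum_negf)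
    moreover have "exp (- 2 * \<beta> - \<beta>\<^sup>2 / 2) \<le> exp (- L a - (\<Sum>i\<in>I. (- b i)\<^sup>2 / 2))" if "a \<in> A'"
      using that b' by (simp add: A'_def)
    ultimately show "ennreal (exp (- 2 * \<beta> - \<beta>\<^sup>2 / 2)) * indicator A' a \<le> (\<Prod>i\<in>I. ennreal (exp (- b i * a i - (- b i)\<^sup>2 / 2))) * indicator A a"
      by (auto simp: indicator_def A_def A'_def intro!: ennreal_leI)
  qed
  also have "\<dots> = emeasure (density (gauss I) (\<lambda>a. \<Prod>i\<in>I. ennreal (exp (- b i * a i - (- b i)\<^sup>2 / 2)))) A"
    using A by (intro emeasure_density[symmetric]) (auto simp: sb intro!: borel_measurable_prod_ennreal)
  also have "\<dots> = emeasure (distr (gauss I) ?B (\<lambda>a. \<lambda>i\<in>I. a i + - b i)) A"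
    by (simp only: gauss_shift[OF fin])
  also have "\<dots> = emeasure (distr (distr M ?B ?r) ?B (\<lambda>a. \<lambda>i\<in>I. a i + - b i)) A" by (simp only: law)
  also have "\<dots> = emeasure (distr M ?B ((\<lambda>a. \<lambda>i\<in>I. a i + - b i) \<circ> ?r)) A"
    by (subst distr_distr) (auto intro!: r_meas measurable_restrict)
  also have "\<dots> = emeasure M (((\<lambda>a. \<lambda>i\<in>I. a i + - b i) \<circ> ?r) -` A \<inter> space M)"
    by (rule emeasure_distr) (auto intro!: measurable_comp[OF r_meas] measurable_restrict)
  also have "((\<lambda>a. \<lambda>i\<in>I. a i + - b i) \<circ> ?r) -` A \<inter> space M = E"
    by (auto simp: A_def E_def S_def space_PiM)
  finally have "ennreal (exp (- 2 * \<beta> - \<beta>\<^sup>2 / 2)) * ennreal (measure (gauss I) A') \<le> ennreal (measure M E)"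
    by (simp add: P.emeasure_eq_measure emeasure_eq_measure)
  then have "exp (- 2 * \<beta> - \<beta>\<^sup>2 / 2) * measure (gauss I) A' \<le> measure M E"
    by (simp add: ennreal_mult[symmetric])
  moreover have "exp (- 2 * \<beta> - \<beta>\<^sup>2 / 2) * (1 / 2) \<le> exp (- 2 * \<beta> - \<beta>\<^sup>2 / 2) * measure (gauss I) A'"
    using half by (intro mult_left_mono) auto
  ultimately show "exp (- 2 * \<beta> - \<beta>\<^sup>2 / 2) / 2 \<le> measure M E" by linarith
qed

section \<open>Components separated by cones\<close>

text \<open>
  A connected component that meets a clopen set stays inside it.
\<close>

lemma num_components_ge_card:
  assumes fin: "finite I"
    and clopen: "\<And>i. i \<in> I \<Longrightarrow> openin T (U i)" "\<And>i. i \<in> I \<Longrightarrow> closedin T (U i)"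
    and ne: "\<And>i. i \<in> I \<Longrightarrow> U i \<noteq> {}"
    and disj: "\<And>i j. i \<in> I \<Longrightarrow> j \<in> I \<Longrightarrow> i \<noteq> j \<Longrightarrow> U i \<inter> U j = {}"
  shows "enat (card I) \<le> num_components T"
proof (cases "finite (connected_components_of T)")
  case True
  from ne have "\<forall>i. \<exists>x. i \<in> I \<longrightarrow> x \<in> U i" by blast
  then obtain x where x: "\<And>i. i \<in> I \<Longrightarrow> x i \<in> U i" by metis
  have xT: "x i \<in> topspace T" if "i \<in> I" for i
    using x[OF that] clopen(1)[OF that] openin_subset by blast
  let ?c = "\<lambda>i. connected_component_of_set T (x i)"
  have sub: "?c i \<subseteq> U i" if i: "i \<in> I" for i
  proof -
    have "connectedin T (?c i)" by (rule connectedin_connected_component_of)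
    moreover have "x i \<in> ?c i \<inter> U i" using x[OF i] xT[OF i] by (simp add: connected_component_of_refl)
    ultimately show ?thesis
      using connectedin_clopen_cases[of T "?c i" "U i"] clopen[OF i] by (auto simp: disjnt_iff)
  qed
  have "inj_on ?c I"
  proof (rule inj_onI, rule ccontr)
    fix i j assume ij: "i \<in> I" "j \<in> I" "?c i = ?c j" "i \<noteq> j"
    have "x i \<in> ?c i" using xT[OF ij(1)] by (simp add: connected_component_of_refl)
    then show False using sub[OF ij(1)] sub[OF ij(2)] ij disj[OF ij(1,2,4)] by blast
  qed
  moreover have "?c ` I \<subseteq> connected_components_of T"
    using xT by (auto simp: connected_components_of_def)
  ultimately have "card I \<le> card (connected_components_of T)"
    using True by (metis card_image card_mono)
  then show ?thesis using True by (simp add: num_components_def)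
qed (simp add: num_components_def)

text \<open>
  For a unit vector \<open>u\<close> these are the lines through the origin at an angle less than \<open>arctan \<rho>\<close> to \<open>u\<close>,
  that is, a ball around \<open>[u]\<close> in projective space.
\<close>

definition double_cone :: "real \<Rightarrow> 'a::euclidean_space \<Rightarrow> 'a set" where
  "double_cone \<rho> u = {x. norm (x - (x \<bullet> u) *\<^sub>R u) < \<rho> * \<bar>x \<bullet> u\<bar>}"

lemma proj_point_eq_imp_scaled:
  assumes "proj_point x = proj_point y" "x \<noteq> 0"
  obtains c where "c \<noteq> 0" "x = c *\<^sub>R y"
proof -
  have "x \<in> span {y}" using assms unfolding proj_point_def by (metis insertI1 span_base)
  then obtain c where "x = c *\<^sub>R y" by (auto simp: span_singleton)
  with assms(2) that show ?thesis by (metis scaleR_zero_left)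
qed

definition disjoint_cones :: "real \<Rightarrow> 'a::euclidean_space set \<Rightarrow> bool" where
  "disjoint_cones \<rho> U \<longleftrightarrow>
     (\<forall>u\<in>U. \<forall>u'\<in>U. u \<noteq> u' \<longrightarrow> double_cone \<rho> u \<inter> double_cone \<rho> u' \<subseteq> {0})"

text \<open>
  As \<open>f\<close> has no zeros on the boundary of a cone, the part of the zero set inside the cone is both open
  and closed in the zero set.
\<close>

lemma b0_ge_card:
  fixes f :: "'a::euclidean_space \<Rightarrow> real"
  assumes f: "f \<in> homogeneous_polynomials d" and fin: "finite U"
    and boundary: "\<And>u x. u \<in> U \<Longrightarrow> x \<noteq> 0 \<Longrightarrow> norm (x - (x \<bullet> u) *\<^sub>R u) = \<rho> * \<bar>x \<bullet> u\<bar> \<Longrightarrow> f x \<noteq> 0"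
    and zero: "\<And>u. u \<in> U \<Longrightarrow> \<exists>x. x \<noteq> 0 \<and> x \<in> double_cone \<rho> u \<and> f x = 0"
    and disj: "disjoint_cones \<rho> U"
  shows "enat (card U) \<le> b0 (proj_zero_set f)"
proof -
  define P :: "'a \<Rightarrow> 'a set" where "P = proj_point"
  let ?X = "proj_zero_set f" and ?T = "subtopology proj_topology (proj_zero_set f)"
  define N where "N u = ?X \<inter> P ` (double_cone \<rho> u - {0})" for u
  have scale: "f x = 0" if xy: "P x = P y" "x \<noteq> 0" "f y = 0" for x y
  proof -
    obtain c where "x = c *\<^sub>R y" using proj_point_eq_imp_scaled[of x y] xy(1,2) unfolding P_def by blast
    moreover have "f (c *\<^sub>R y) = c ^ d * f y" using f unfolding homogeneous_polynomials_def by blast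
    ultimately show ?thesis using xy(3) by simp
  qed
  have Xiff: "P x \<in> ?X \<longleftrightarrow> f x = 0" if "x \<noteq> 0" for x
    using scale that by (auto simp: proj_zero_set_def P_def)
  have cone_scale: "c *\<^sub>R x \<in> double_cone \<rho> v \<longleftrightarrow> x \<in> double_cone \<rho> v" if "c \<noteq> 0" for c x and v :: 'a
  proof -
    have "c *\<^sub>R x - (c *\<^sub>R x \<bullet> v) *\<^sub>R v = c *\<^sub>R (x - (x \<bullet> v) *\<^sub>R v)" by (simp add: algebra_simps)
    then show ?thesis using that by (simp add: double_cone_def abs_mult)
  qed
  have Piff: "P x \<in> P ` (double_cone \<rho> v - {0}) \<longleftrightarrow> x \<in> double_cone \<rho> v" if x: "x \<noteq> 0" for x v
  proof
    assume "P x \<in> P ` (double_cone \<rho> v - {0})"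
    then obtain y where "y \<in> double_cone \<rho> v" "P x = P y" by auto
    then obtain c where "c \<noteq> 0" "x = c *\<^sub>R y"
      using proj_point_eq_imp_scaled[of x y] x unfolding P_def by blast
    with \<open>y \<in> double_cone \<rho> v\<close> show "x \<in> double_cone \<rho> v" using cone_scale by simp
  qed (use x in auto)
  have open_cone: "open (double_cone \<rho> v)" for v
    unfolding double_cone_def by (intro open_Collect_less continuous_intros)
  have oP: "openin proj_topology (P ` (double_cone \<rho> v - {0}))" for v
  proof -
    have "{x. x \<noteq> 0 \<and> P x \<in> P ` (double_cone \<rho> v - {0})} = double_cone \<rho> v - {0}" using Piff by auto
    then show ?thesis unfolding openin_proj_topology P_def[symmetric]
      using open_cone[of v] by (auto simp: open_Diff P_def)
  qed
  have cP: "openin proj_topology (P ` ({x. norm (x - (x \<bullet> v) *\<^sub>R v) > \<rho> * \<bar>x \<bullet> v\<bar>} - {0}))" (is "openin _ (P ` (?D - {0}))") for v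
  proof -
    have "{x. x \<noteq> 0 \<and> P x \<in> P ` (?D - {0})} = ?D - {0}"
    proof safe
      fix x y assume y: "P x = P y" "\<rho> * \<bar>y \<bullet> v\<bar> < norm (y - (y \<bullet> v) *\<^sub>R v)" and x: "x \<noteq> 0"
      then obtain c where c: "c \<noteq> 0" "x = c *\<^sub>R y" using proj_point_eq_imp_scaled[of x y] unfolding P_def by blast
      have "x - (x \<bullet> v) *\<^sub>R v = c *\<^sub>R (y - (y \<bullet> v) *\<^sub>R v)" by (simp add: c algebra_simps)
      then show "\<rho> * \<bar>x \<bullet> v\<bar> < norm (x - (x \<bullet> v) *\<^sub>R v)"
        using y c by (simp add: abs_mult)
    qed auto
    moreover have "open ?D" by (intro open_Collect_less continuous_intros)
    ultimately show ?thesis unfolding openin_proj_topology P_def[symmetric]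
      by (auto simp: open_Diff P_def)
  qed
  have XP: "?X \<subseteq> topspace proj_topology" by (auto simp: proj_zero_set_def topspace_proj_topology)
  have "enat (card U) \<le> num_components ?T"
  proof (rule num_components_ge_card[OF fin])
    fix u assume u: "u \<in> U"
    show "openin ?T (N u)"
      unfolding N_def openin_subtopology using oP by blast
    have "?X - N u = ?X \<inter> P ` ({x. norm (x - (x \<bullet> u) *\<^sub>R u) > \<rho> * \<bar>x \<bullet> u\<bar>} - {0})" (is "_ = ?X \<inter> P ` (?D - {0})")
    proof
      show "?X - N u \<subseteq> ?X \<inter> P ` (?D - {0})"
      proof
        fix q assume q: "q \<in> ?X - N u"
        then obtain x where x: "x \<noteq> 0" "f x = 0" "q = P x" by (auto simp: proj_zero_set_def P_def)
        then have "x \<notin> double_cone \<rho> u" using q by (auto simp: N_def)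
        moreover have "norm (x - (x \<bullet> u) *\<^sub>R u) \<noteq> \<rho> * \<bar>x \<bullet> u\<bar>" using boundary[OF u x(1)] x(2) by blast
        ultimately have "x \<in> ?D" by (auto simp: double_cone_def)
        then show "q \<in> ?X \<inter> P ` (?D - {0})" using x q by auto
      qed
      show "?X \<inter> P ` (?D - {0}) \<subseteq> ?X - N u"
      proof
        fix q assume q: "q \<in> ?X \<inter> P ` (?D - {0})"
        then obtain x where "x \<in> ?D - {0}" "q = P x" by blast
        then have x: "x \<noteq> 0" "x \<in> ?D" "q = P x" by auto
        then have "x \<notin> double_cone \<rho> u" by (auto simp: double_cone_def)
        then show "q \<in> ?X - N u" using q x Piff[OF x(1)] by (auto simp: N_def)
      qed
    qed
    then have "openin ?T (?X - N u)" unfolding openin_subtopology using cP by blast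
    moreover have "topspace ?T = ?X" using XP by (simp add: Int_absorb1)
    ultimately show "closedin ?T (N u)" unfolding closedin_def by (auto simp: N_def)
    obtain x where "x \<noteq> 0" "x \<in> double_cone \<rho> u" "f x = 0" using zero[OF u] by blast
    then have "P x \<in> N u" using Xiff[of x] by (auto simp: N_def)
    then show "N u \<noteq> {}" by blast
  next
    fix u u' assume uu: "u \<in> U" "u' \<in> U" "u \<noteq> u'"
    show "N u \<inter> N u' = {}"
    proof (rule ccontr)
      assume "N u \<inter> N u' \<noteq> {}"
      then obtain q where q: "q \<in> N u" "q \<in> N u'" by blast
      then obtain x where x: "x \<noteq> 0" "q = P x" "x \<in> double_cone \<rho> u" by (auto simp: N_def)
      then have "x \<in> double_cone \<rho> u'" using q Piff[OF x(1)] by (auto simp: N_def)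
      then show False using disj uu x unfolding disjoint_cones_def by blast
    qed
  qed
  then show ?thesis by (simp add: b0_def)
qed

text \<open>
  Only unit vectors, and only the half of the cone that contains \<open>u\<close>: homogeneity extends a sign
  condition on the rim to that half of the boundary and, up to a sign, to the other one.
\<close>

definition cone_rim :: "real \<Rightarrow> 'a::euclidean_space \<Rightarrow> 'a set" where
  "cone_rim \<rho> u = {y. norm y = 1 \<and> y \<bullet> u > 0 \<and> norm (y - (y \<bullet> u) *\<^sub>R u) = \<rho> * (y \<bullet> u)}"

text \<open>
  In the affine chart \<open>x \<bullet> e = 1\<close>, a point of a cone is close to the line through its centre. If \<open>x\<close>
  is in both cones then \<open>s *\<^sub>R (e + v)\<close> and \<open>s' *\<^sub>R (e + v')\<close> are both within \<open>\<rho> * norm x\<close> of \<open>x\<close>.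
  The component along \<open>e\<close> forces \<open>s\<close> and \<open>s'\<close> to be close, and then \<open>v\<close> and \<open>v'\<close> are close as well.
\<close>

lemma cones_disjoint:
  fixes e v v' :: "'a::euclidean_space"
  assumes e: "norm e = 1" and v: "v \<bullet> e = 0" "v' \<bullet> e = 0" "norm v \<le> 1" "norm v' \<le> 1"
    and \<rho>: "0 < \<rho>" "\<rho> \<le> 1 / 2" and far: "norm (v - v') \<ge> 24 * \<rho>" and x: "x \<noteq> 0"
    and in1: "x \<in> double_cone \<rho> ((e + v) /\<^sub>R norm (e + v))" and in2: "x \<in> double_cone \<rho> ((e + v') /\<^sub>R norm (e + v'))"
  shows False
proof -
  have ee: "e \<bullet> e = 1" using e by (simp add: dot_square_norm)
  have nv: "1 \<le> norm (e + w)" "norm (e + w) \<le> 2" if "w \<bullet> e = 0" "norm w \<le> 1" for w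
  proof -
    have "(norm (e + w))\<^sup>2 = 1 + (norm w)\<^sup>2"
      unfolding power2_norm_eq_inner using that(1) ee inner_commute[of e w]
      by (simp only: inner_add_left inner_add_right)
    then have "1\<^sup>2 \<le> (norm (e + w))\<^sup>2" by simp
    then show "1 \<le> norm (e + w)" by (rule power2_le_imp_le) simp
    show "norm (e + w) \<le> 2" using norm_triangle_ineq[of e w] that e by simp
  qed
  \<comment> \<open>The multiple of \<open>e + w\<close> closest to \<open>x\<close>. The lower bound on \<open>s\<close> uses \<open>\<rho> \<le> 1 / 2\<close> and
    \<open>norm (e + w) \<le> 2\<close>.\<close>
  have approx: "\<exists>s. norm (x - s *\<^sub>R (e + w)) < \<rho> * norm x \<and> \<bar>s\<bar> \<ge> norm x / 4"
    if w: "w \<bullet> e = 0" "norm w \<le> 1" and xc: "x \<in> double_cone \<rho> ((e + w) /\<^sub>R norm (e + w))" for w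
  proof -
    let ?u = "(e + w) /\<^sub>R norm (e + w)" and ?N = "norm (e + w)"
    have "?N \<noteq> 0" using nv[OF w] by linarith
    then have nu: "norm ?u = 1" by simp
    let ?t = "x \<bullet> ?u"
    have lt: "norm (x - ?t *\<^sub>R ?u) < \<rho> * \<bar>?t\<bar>" using xc by (simp add: double_cone_def)
    have tx: "\<bar>?t\<bar> \<le> norm x" using Cauchy_Schwarz_ineq2[of x ?u] nu by simp
    have "norm x \<le> norm (x - ?t *\<^sub>R ?u) + norm (?t *\<^sub>R ?u)" using norm_triangle_ineq[of "x - ?t *\<^sub>R ?u" "?t *\<^sub>R ?u"] by simp
    also have "norm (?t *\<^sub>R ?u) = \<bar>?t\<bar>" using nu by (simp only: norm_scaleR mult_1_right)
    also have "norm (x - ?t *\<^sub>R ?u) \<le> (1 / 2) * \<bar>?t\<bar>"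
      using lt mult_right_mono[OF \<rho>(2), of "\<bar>?t\<bar>"] by linarith
    finally have xt: "norm x \<le> 3 / 2 * \<bar>?t\<bar>" by simp
    have "\<bar>?t / ?N\<bar> \<ge> norm x / 4"
    proof -
      have "norm x / 4 \<le> \<bar>?t\<bar> / 2" using xt by linarith
      also have "\<dots> \<le> \<bar>?t\<bar> / ?N" using nv[OF w] by (intro divide_left_mono) auto
      finally show ?thesis using nv[OF w] by (simp add: abs_divide)
    qed
    moreover have "?t *\<^sub>R ?u = (?t / ?N) *\<^sub>R (e + w)" by (simp add: divide_inverse)
    moreover have "\<rho> * \<bar>?t\<bar> \<le> \<rho> * norm x" using tx \<rho> by simp
    ultimately show ?thesis using lt by (intro exI[of _ "?t / ?N"]) auto
  qed
  obtain s where s: "norm (x - s *\<^sub>R (e + v)) < \<rho> * norm x" "\<bar>s\<bar> \<ge> norm x / 4" using approx[OF v(1,3) in1] by blast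
  obtain s' where s': "norm (x - s' *\<^sub>R (e + v')) < \<rho> * norm x" using approx[OF v(2,4) in2] by blast
  have "s *\<^sub>R (e + v) - s' *\<^sub>R (e + v') = (x - s' *\<^sub>R (e + v')) - (x - s *\<^sub>R (e + v))" by simp
  then have d: "norm (s *\<^sub>R (e + v) - s' *\<^sub>R (e + v')) < 2 * \<rho> * norm x"
    using s(1) s' norm_triangle_ineq4[of "x - s' *\<^sub>R (e + v')" "x - s *\<^sub>R (e + v)"] by simp
  have "(s *\<^sub>R (e + v) - s' *\<^sub>R (e + v')) \<bullet> e = s - s'"
    using v ee by (simp add: inner_diff_left inner_add_left)
  then have "\<bar>s - s'\<bar> \<le> norm (s *\<^sub>R (e + v) - s' *\<^sub>R (e + v'))"
    using Cauchy_Schwarz_ineq2[of "s *\<^sub>R (e + v) - s' *\<^sub>R (e + v')" e] e by simp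
  with d have ss: "\<bar>s - s'\<bar> < 2 * \<rho> * norm x" by simp
  have "s *\<^sub>R (v - v') = (s *\<^sub>R (e + v) - s' *\<^sub>R (e + v')) - (s - s') *\<^sub>R (e + v')"
    by (simp add: algebra_simps)
  then have "\<bar>s\<bar> * norm (v - v') \<le> norm (s *\<^sub>R (e + v) - s' *\<^sub>R (e + v')) + \<bar>s - s'\<bar> * norm (e + v')"
    by (metis norm_scaleR norm_triangle_ineq4)
  also have "\<dots> < 2 * \<rho> * norm x + (2 * \<rho> * norm x) * 2"
  proof -
    have "\<bar>s - s'\<bar> * norm (e + v') \<le> (2 * \<rho> * norm x) * 2"
      using ss nv[OF v(2,4)] by (intro mult_mono) auto
    then show ?thesis using d by linarith
  qed
  finally have "\<bar>s\<bar> * norm (v - v') < 6 * \<rho> * norm x" by simp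
  moreover have "\<bar>s\<bar> * norm (v - v') \<ge> (norm x / 4) * (24 * \<rho>)"
    using s(2) far \<rho> by (intro mult_mono) auto
  ultimately show False by simp
qed

text \<open>
  Centres are taken over the points of a cubic grid in the unit ball of the affine chart.
\<close>

lemma disjoint_cones_packing:
  fixes \<rho> :: real
  assumes dim: "DIM('a::euclidean_space) = Suc n" and n: "n \<ge> 1" and \<rho>: "0 < \<rho>" "\<rho> \<le> 1 / 2"
  obtains U :: "'a::euclidean_space set" where "finite U" "\<And>u. u \<in> U \<Longrightarrow> norm u = 1"
    "disjoint_cones \<rho> U"
    "(1 / (24 * \<rho> * real n)) ^ n \<le> real (card U)"
proof -
  obtain e :: 'a where e: "e \<in> Basis" using nonempty_Basis by blast
  define B where "B = (Basis - {e} :: 'a set)"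
  have B: "finite B" "card B = n" using e dim by (simp_all add: B_def)
  \<comment> \<open>The mesh is the distance required for disjointness, and \<open>N\<close> steps along each of the \<open>n\<close> axes
    stay within the unit ball.\<close>
  define s where "s = 24 * \<rho>"
  have s: "s > 0" using \<rho> by (simp add: s_def)
  define N where "N = nat \<lfloor>1 / (s * real n)\<rfloor>"
  have N: "real N \<le> 1 / (s * real n)" "1 / (s * real n) < real N + 1"
    using s n by (auto simp: N_def)
  define G where "G = (B \<rightarrow>\<^sub>E {..N})"
  define v where "v k = (\<Sum>b\<in>B. (s * real (k b)) *\<^sub>R b)" for k :: "'a \<Rightarrow> nat"
  define u where "u k = (e + v k) /\<^sub>R norm (e + v k)" for k
  have v_e: "v k \<bullet> e = 0" for k
    unfolding v_def inner_sum_left using e by (intro sum.neutral) (auto simp: B_def inner_Basis)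
  have v_norm: "norm (v k) \<le> 1" if k: "k \<in> G" for k
  proof -
    have "norm (v k) \<le> (\<Sum>b\<in>B. norm ((s * real (k b)) *\<^sub>R b))" unfolding v_def by (rule norm_sum)
    also have "\<dots> \<le> (\<Sum>b\<in>B. s * real N)"
    proof (rule sum_mono)
      fix b assume b: "b \<in> B"
      then have "k b \<le> N" using k by (auto simp: G_def)
      then show "norm ((s * real (k b)) *\<^sub>R b) \<le> s * real N"
        using b s by (auto simp: B_def)
    qed
    also have "\<dots> = (s * real n) * real N" using B by simp
    also have "\<dots> \<le> 1" using N(1) s n by (simp add: field_simps)
    finally show ?thesis .
  qed
  have far: "norm (v k - v k') \<ge> 24 * \<rho>" if k: "k \<in> G" "k' \<in> G" "k \<noteq> k'" for k k'
  proof -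
    obtain b where b: "b \<in> B" "k b \<noteq> k' b" using k unfolding G_def by (metis PiE_ext)
    have coord: "v k \<bullet> b = s * real (k b)" for k
    proof -
      have "v k \<bullet> b = (\<Sum>b'\<in>B. (s * real (k b')) * (if b' = b then 1 else 0))"
        unfolding v_def inner_sum_left using b(1) by (intro sum.cong refl) (auto simp: B_def inner_Basis)
      also have "\<dots> = s * real (k b)" using b(1) B by (simp add: if_distrib sum.delta cong: if_cong)
      finally show ?thesis .
    qed
    have "1 \<le> \<bar>real (k b) - real (k' b)\<bar>" using b(2) by linarith
    then have "s \<le> \<bar>s * real (k b) - s * real (k' b)\<bar>"
      using s by (simp add: right_diff_distrib[symmetric] abs_mult)
    also have "\<dots> = \<bar>(v k - v k') \<bullet> b\<bar>" by (simp add: inner_diff_left coord)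
    also have "\<dots> \<le> norm (v k - v k')" using b by (intro Basis_le_norm) (auto simp: B_def)
    finally show ?thesis by (simp add: s_def)
  qed
  have disj: False if "k \<in> G" "k' \<in> G" "k \<noteq> k'" "x \<noteq> 0" "x \<in> double_cone \<rho> (u k)" "x \<in> double_cone \<rho> (u k')" for k k' x
    using cones_disjoint[OF norm_Basis[OF e] v_e v_e v_norm v_norm \<rho> far] that by (simp add: u_def)
  have u_norm: "norm (u k) = 1" for k
  proof -
    have "(e + v k) \<bullet> e = 1" using e v_e by (simp add: inner_add_left inner_Basis)
    then have "e + v k \<noteq> 0" by auto
    then show ?thesis by (simp add: u_def)
  qed
  have self: "u k \<in> double_cone \<rho> (u k)" "u k \<noteq> 0" for k
  proof -
    have "u k \<bullet> u k = 1" using u_norm[of k] by (simp add: dot_square_norm)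
    then show "u k \<in> double_cone \<rho> (u k)" using \<rho> by (simp add: double_cone_def)
    show "u k \<noteq> 0" using u_norm[of k] by auto
  qed
  have inj: "inj_on u G"
    by (rule inj_onI, rule ccontr) (metis disj self)
  have "card (u ` G) = (N + 1) ^ n"
    using card_image[OF inj] B by (simp add: G_def card_PiE)
  moreover have "(1 / (s * real n)) ^ n \<le> (real N + 1) ^ n"
    using N s by (intro power_mono) auto
  ultimately have "(1 / (24 * \<rho> * real n)) ^ n \<le> real (card (u ` G))"
    by (simp add: s_def add.commute)
  moreover have "finite (u ` G)" unfolding G_def using B by (intro finite_imageI finite_PiE) auto
  moreover have "disjoint_cones \<rho> (u ` G)"
    unfolding disjoint_cones_def using disj by blast
  ultimately show ?thesis using that[of "u ` G"] u_norm by blast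
qed

section \<open>Estimates for the weights\<close>

text \<open>
  The explicit constant comes from \<open>1 + x \<le> exp x\<close> and from completing the square.
\<close>

lemma gaussian_beats_power:
  fixes a b :: real
  assumes a: "a > 0" and x: "x \<ge> 0"
  shows "exp (- a * x\<^sup>2 + b * x) \<le> exp ((b + real m)\<^sup>2 / (4 * a)) / (1 + x) ^ m"
proof -
  have "(1 + x) ^ m \<le> exp x ^ m" using x by (intro power_mono exp_ge_add_one_self) auto
  also have "\<dots> = exp (real m * x)" by (simp add: exp_of_nat_mult)
  finally have "exp (- a * x\<^sup>2 + b * x) * (1 + x) ^ m \<le> exp (- a * x\<^sup>2 + b * x) * exp (real m * x)"
    by (intro mult_left_mono) auto
  also have "\<dots> = exp (- a * x\<^sup>2 + (b + real m) * x)" by (simp add: exp_add[symmetric] algebra_simps)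
  also have "\<dots> \<le> exp ((b + real m)\<^sup>2 / (4 * a))"
  proof -
    have "0 \<le> (2 * a * x - (b + real m))\<^sup>2" by simp
    then have "4 * a * (- a * x\<^sup>2 + (b + real m) * x) \<le> (b + real m)\<^sup>2"
      by (simp add: power2_eq_square algebra_simps)
    then show ?thesis using a by (simp add: field_simps)
  qed
  finally show ?thesis using x by (simp add: field_simps)
qed

lemma sum_inverse_square_tail:
  fixes D :: real
  assumes D: "D \<ge> 1" and fin: "finite L"
  shows "(\<Sum>l\<in>L. D\<^sup>2 / (D + real l)\<^sup>2) \<le> 2 * D"
proof -
  have *: "(\<Sum>l\<le>N. 1 / (D + real l)\<^sup>2) \<le> 2 / D - 1 / (D + real N)" for N
  proof (induction N)
    case 0
    then show ?case using D by (simp add: field_simps power2_eq_square)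
  next
    case (Suc N)
    have "1 / (D + real (Suc N))\<^sup>2 \<le> 1 / (D + real N) - 1 / (D + real (Suc N))"
    proof -
      define y where "y = D + real N"
      have y: "y > 0" using D by (simp add: y_def)
      have "1 / (y + 1)\<^sup>2 \<le> 1 / (y * (y + 1))"
        using y by (intro divide_left_mono mult_pos_pos) (auto simp: power2_eq_square)
      also have "\<dots> = 1 / y - 1 / (y + 1)" using y by (simp add: field_simps)
      finally show ?thesis by (simp add: y_def add_ac)
    qed
    then show ?case using Suc by simp
  qed
  obtain N where N: "L \<subseteq> {..N}" using fin finite_nat_set_iff_bounded_le by (metis atMost_iff subsetI)
  have "(\<Sum>l\<in>L. 1 / (D + real l)\<^sup>2) \<le> (\<Sum>l\<le>N. 1 / (D + real l)\<^sup>2)"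
    using N by (intro sum_mono2) auto
  also have "\<dots> \<le> 2 / D" using *[of N] D by (intro order_trans[OF *]) simp
  finally have "D\<^sup>2 * (\<Sum>l\<in>L. 1 / (D + real l)\<^sup>2) \<le> D\<^sup>2 * (2 / D)" by (intro mult_left_mono) auto
  then show ?thesis using D by (simp add: sum_distrib_left power2_eq_square)
qed

lemma sum_Un_le_nonneg:
  fixes f :: "'b \<Rightarrow> real"
  assumes "finite A" "finite B" "\<And>x. x \<in> A \<inter> B \<Longrightarrow> 0 \<le> f x"
  shows "sum f (A \<union> B) \<le> sum f A + sum f B"
  using sum.union_inter[of A B f] sum_nonneg[of "A \<inter> B" f] assms by simp

text \<open>
  What a coherent family provides for a single degree \<open>d\<close>, with \<open>L\<close> the degrees of its harmonics and
  \<open>D = d powr \<lambda>\<close>.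
\<close>

definition gaussian_weights :: "real \<Rightarrow> real \<Rightarrow> real \<Rightarrow> nat set \<Rightarrow> (nat \<Rightarrow> real) \<Rightarrow> bool" where
  "gaussian_weights a1 a2 D L q \<longleftrightarrow> finite L \<and> (\<forall>l\<in>L. 0 \<le> q l) \<and> (\<Sum>l\<in>L. q l) = 1 \<and>
     (\<forall>l\<in>L. D * q l \<le> a1 * exp (- a2 * (real l / D)\<^sup>2))"

definition band :: "nat set \<Rightarrow> real \<Rightarrow> real \<Rightarrow> nat set" where
  "band L \<delta> A = {l \<in> L. A \<le> real l \<and> real l \<le> (1 + \<delta>) * A}"

text \<open>
  In the application \<open>\<mu> l\<close> is the value of the kernel of degree \<open>l\<close> on the diagonal. The band starting
  at \<open>A\<close> supports the barrier; the first sum is the height of the barrier, the second one the squared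
  norm of its coefficients, and the third one bounds the variance of the random function at distance
  up to \<open>(\<kappa> + 1) / D\<close> from the sphere. All constants are independent of \<open>D\<close>.
  
  Each weight is at most \<open>a1 / D\<close>, so degrees below \<open>\<epsilon> * D\<close> carry a small part of the total weight \<open>1\<close>;
  so do degrees above \<open>R * D\<close>, by the Gaussian decay. The interval in between is covered by a number
  of bands that does not depend on \<open>D\<close>, and one of them carries its share.
\<close>

lemma weight_estimates:
  fixes a1 a2 \<delta> A0 c C x :: real and \<mu> :: "nat \<Rightarrow> real"
  assumes n: "n \<ge> 1" and a: "a1 > 0" "a2 > 0" and \<delta>: "\<delta> > 0" and A0: "A0 \<ge> 1" and c: "c > 0" and C: "C > 0" and x: "x > 0"
    and \<mu>1: "\<And>l. l \<ge> 1 \<Longrightarrow> c * real l ^ (n - 1) \<le> \<mu> l" and \<mu>0: "\<And>l. 0 \<le> \<mu> l"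
    and \<mu>2: "\<And>l. \<mu> l \<le> C * (real l + 1) ^ (n - 1)"
  obtains \<kappa> D0 w B t where "\<kappa> > 0" "D0 \<ge> 1" "w > 0" "B > 0" "t > 0"
    "\<And>D L q. D \<ge> D0 \<Longrightarrow> gaussian_weights a1 a2 D L q \<Longrightarrow>
       \<exists>A. A \<ge> A0 \<and> x / A \<le> \<kappa> / D \<and>
         w * D ^ (n - 1) \<le> (\<Sum>l\<in>band L \<delta> A. q l * \<mu> l) \<and>
         (\<Sum>l\<in>band L \<delta> A. \<mu> l) \<le> B * D ^ n \<and>
         (\<Sum>l\<in>L. (q l)\<^sup>2 * \<mu> l * (1 + (\<kappa> + 1) / D) ^ (2 * l)) \<le> t * (D ^ n / D\<^sup>2)"
proof -
  \<comment> \<open>The constants \<open>\<epsilon>\<close> and \<open>R\<close> leave at most a quarter of the weight on either side of the interval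
    from \<open>\<epsilon> * D\<close> to \<open>R * D\<close>, which \<open>K + 1\<close> bands cover up to \<open>R2 * D\<close>. The smallest possible band starts
    at \<open>\<epsilon> * D\<close>, whence \<open>\<kappa>\<close>; the factor \<open>2 * K + 2\<close> in \<open>w\<close> is the share of one band in the remaining half.
    The constants \<open>C4\<close> and \<open>C5\<close> compare Gaussians with negative powers.\<close>
  define \<epsilon> where "\<epsilon> = 1 / (8 * a1)"
  define \<kappa> where "\<kappa> = x / \<epsilon>"
  define C4 where "C4 = exp ((0 + real 3)\<^sup>2 / (4 * a2))"
  define R where "R = 8 * a1 * C4"
  obtain K where K: "R / \<epsilon> < (1 + \<delta>) ^ K" using real_arch_pow[of "1 + \<delta>" "R / \<epsilon>"] \<delta> by auto
  define R2 where "R2 = \<epsilon> * (1 + \<delta>) ^ Suc K"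
  define C5 where "C5 = exp ((2 * (\<kappa> + 1) + real (n + 1))\<^sup>2 / (4 * (2 * a2)))"
  define t where "t = 2 * a1\<^sup>2 * C * C5"
  define B where "B = C * (R2 + 1) ^ n"
  define w where "w = c * \<epsilon> ^ (n - 1) / (2 * real (Suc K))"
  define D0 where "D0 = max (max 1 (8 * a1)) (A0 / \<epsilon>)"
  have \<epsilon>: "\<epsilon> > 0" "a1 * \<epsilon> = 1 / 8" using a by (simp_all add: \<epsilon>_def)
  have \<kappa>: "\<kappa> > 0" using x \<epsilon> by (simp add: \<kappa>_def)
  have R: "R > 0" using a by (simp add: R_def C4_def)
  have R2: "R2 > 0" using \<epsilon> \<delta> by (simp add: R2_def)
  show ?thesis
  proof (rule that[of \<kappa> D0 w B t])
    show "\<kappa> > 0" by (rule \<kappa>)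
    show "D0 \<ge> 1" by (simp add: D0_def)
    show "w > 0" using c \<epsilon> by (simp add: w_def)
    show "B > 0" using C R2 by (simp add: B_def)
    show "t > 0" using a C by (simp add: t_def C5_def)
    fix D :: real and L :: "nat set" and q :: "nat \<Rightarrow> real"
    assume D: "D \<ge> D0" and "gaussian_weights a1 a2 D L q"
    then have L: "finite L" and q0: "\<And>l. l \<in> L \<Longrightarrow> 0 \<le> q l" and q1: "(\<Sum>l\<in>L. q l) = 1"
      and q2: "\<And>l. l \<in> L \<Longrightarrow> D * q l \<le> a1 * exp (- a2 * (real l / D)\<^sup>2)"
      by (simp_all add: gaussian_weights_def)
    have D1: "D \<ge> 1" "D \<ge> 8 * a1" "D * \<epsilon> \<ge> A0" using D \<epsilon> by (auto simp: D0_def field_simps)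
    have qD: "q l \<le> a1 / D * exp (- a2 * (real l / D)\<^sup>2)" if "l \<in> L" for l
      using q2[OF that] D1 by (simp add: field_simps)
    have frac: "1 + real l / D = (D + real l) / D" for l using D1 by (simp add: field_simps)
    have low: "(\<Sum>l | l \<in> L \<and> real l < \<epsilon> * D. q l) \<le> 1 / 4"
    proof -
      have "(\<Sum>l | l \<in> L \<and> real l < \<epsilon> * D. q l) \<le> (\<Sum>l | l \<in> L \<and> real l < \<epsilon> * D. a1 / D)"
      proof (rule sum_mono)
        fix l assume "l \<in> {l. l \<in> L \<and> real l < \<epsilon> * D}"
        then have "q l \<le> a1 / D * exp (- a2 * (real l / D)\<^sup>2)" using qD by simp
        also have "\<dots> \<le> a1 / D * 1" using a D1 by (intro mult_left_mono) auto
        finally show "q l \<le> a1 / D" by simp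
      qed
      also have "\<dots> \<le> (\<Sum>l \<in> {..<nat \<lceil>\<epsilon> * D\<rceil>}. a1 / D)"
        using a D1 \<epsilon> by (intro sum_mono2) (auto simp: less_ceiling_iff zless_nat_eq_int_zless)
      also have "\<dots> = real (nat \<lceil>\<epsilon> * D\<rceil>) * (a1 / D)" by simp
      also have "\<dots> \<le> (\<epsilon> * D + 1) * (a1 / D)"
      proof (rule mult_right_mono)
        have "real (nat \<lceil>\<epsilon> * D\<rceil>) = of_int \<lceil>\<epsilon> * D\<rceil>" using \<epsilon> D1 by simp
        then show "real (nat \<lceil>\<epsilon> * D\<rceil>) \<le> \<epsilon> * D + 1" using of_int_ceiling_le_add_one[of "\<epsilon> * D"] by simp
      qed (use a D1 in simp)
      also have "\<dots> = a1 * \<epsilon> + a1 / D" using D1 by (simp add: field_simps)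
      also have "\<dots> \<le> 1 / 4" unfolding \<epsilon>(2) using D1 a by (simp add: divide_le_eq field_simps)
      finally show ?thesis .
    qed
    have high: "(\<Sum>l | l \<in> L \<and> real l > R * D. q l) \<le> 1 / 4"
    proof -
      have "(\<Sum>l | l \<in> L \<and> real l > R * D. q l) \<le> (\<Sum>l | l \<in> L \<and> real l > R * D. (a1 * C4 / (D * R)) * (D\<^sup>2 / (D + real l)\<^sup>2))"
      proof (rule sum_mono)
        fix l assume l: "l \<in> {l. l \<in> L \<and> real l > R * D}"
        let ?x = "real l / D"
        have x: "?x \<ge> R" "?x \<ge> 0" using l D1 by (auto simp: le_divide_eq)
        have "q l \<le> a1 / D * exp (- a2 * ?x\<^sup>2)" using qD l by simp
        also have "\<dots> \<le> a1 / D * (C4 / (1 + ?x) ^ 3)"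
          using gaussian_beats_power[OF a(2) x(2), of 0 3] a D1 unfolding C4_def by (intro mult_left_mono) auto
        also have "\<dots> \<le> a1 / D * (C4 / (R * (1 + ?x)\<^sup>2))"
        proof (intro mult_left_mono divide_left_mono)
          show "R * (1 + ?x)\<^sup>2 \<le> (1 + ?x) ^ 3"
            using x mult_right_mono[of R "1 + ?x" "(1 + ?x)\<^sup>2"] by (simp add: power3_eq_cube power2_eq_square)
          show "0 < (1 + ?x) ^ 3 * (R * (1 + ?x)\<^sup>2)" using x R by (intro mult_pos_pos zero_less_power) auto
        qed (use a D1 in \<open>auto simp: C4_def\<close>)
        also have "\<dots> = (a1 * C4 / (D * R)) * (D\<^sup>2 / (D + real l)\<^sup>2)"
          using D1 by (simp add: frac power_divide)
        finally show "q l \<le> \<dots>" .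
      qed
      also have "\<dots> \<le> (a1 * C4 / (D * R)) * (2 * D)"
        unfolding sum_distrib_left[symmetric]
        using a R D1 L by (intro mult_left_mono sum_inverse_square_tail) (auto simp: C4_def)
      also have "\<dots> = 1 / 4" using D1 a by (simp add: R_def C4_def)
      finally show ?thesis .
    qed
    \<comment> \<open>Bands in geometric progression: the next one starts where the previous one ends.\<close>
    define A where "A i = \<epsilon> * (1 + \<delta>) ^ i * D" for i :: nat
    have A_ge: "A i \<ge> \<epsilon> * D" for i using \<epsilon> \<delta> D1 by (simp add: A_def)
    define Bd where "Bd i = {l \<in> L. A i \<le> real l \<and> real l \<le> (1 + \<delta>) * A i}" for i
    have finB: "finite (Bd i)" for i using L by (simp add: Bd_def)
    have mid: "1 / 2 \<le> (\<Sum>i\<le>K. \<Sum>l\<in>Bd i. q l)"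
    proof -
      let ?lo = "{l. l \<in> L \<and> real l < \<epsilon> * D}" and ?hi = "{l. l \<in> L \<and> real l > R * D}"
      let ?mid = "L - (?lo \<union> ?hi)"
      have "1 \<le> (\<Sum>l\<in>?lo. q l) + (\<Sum>l\<in>?hi. q l) + (\<Sum>l\<in>?mid. q l)"
      proof -
        have "1 = (\<Sum>l\<in>?lo \<union> ?hi. q l) + (\<Sum>l\<in>?mid. q l)"
          unfolding q1[symmetric] using L by (subst sum.subset_diff[of "?lo \<union> ?hi"]) (auto simp: add.commute)
        also have "(\<Sum>l\<in>?lo \<union> ?hi. q l) \<le> (\<Sum>l\<in>?lo. q l) + (\<Sum>l\<in>?hi. q l)"
          using L q0 by (intro sum_Un_le_nonneg) auto
        finally show ?thesis by simp
      qed
      moreover have "(\<Sum>l\<in>?mid. q l) \<le> (\<Sum>i\<le>K. \<Sum>l\<in>Bd i. q l)"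
      proof -
        have cover: "?mid \<subseteq> (\<Union>i\<le>K. Bd i)"
        proof
          fix l assume l: "l \<in> ?mid"
          then have lL: "l \<in> L" "\<epsilon> * D \<le> real l" "real l \<le> R * D" by auto
          define i where "i = (LEAST i. real l < A (Suc i))"
          have ex: "real l < A (Suc K)"
          proof -
            have "R * D < A K" using K \<epsilon> D1 by (simp add: A_def field_simps)
            also have "A K \<le> A (Suc K)" using \<epsilon> \<delta> D1 by (simp add: A_def mult_left_mono)
            finally show ?thesis using lL by simp
          qed
          have i1: "real l < A (Suc i)" unfolding i_def by (rule LeastI[of _ K]) (rule ex)
          have i2: "i \<le> K" unfolding i_def by (rule Least_le) (rule ex)
          have i3: "A i \<le> real l"
          proof (cases i)
            case 0
            then show ?thesis using lL by (simp add: A_def)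
          next
            case (Suc j)
            then have "\<not> real l < A (Suc j)" using not_less_Least[of j "\<lambda>i. real l < A (Suc i)"] by (simp add: i_def)
            then show ?thesis using Suc by simp
          qed
          have "A (Suc i) = (1 + \<delta>) * A i" by (simp add: A_def)
          then show "l \<in> (\<Union>i\<le>K. Bd i)" using i1 i2 i3 lL by (auto simp: Bd_def)
        qed
        have "(\<Sum>l\<in>?mid. q l) \<le> (\<Sum>l\<in>(\<Union>i\<le>K. Bd i). q l)"
          using cover finB q0 by (intro sum_mono2) (auto simp: Bd_def)
        also have "\<dots> \<le> (\<Sum>i\<le>K. \<Sum>l\<in>Bd i. q l)"
        proof -
          have "(\<Sum>l\<in>(\<Union>i\<le>k. Bd i). q l) \<le> (\<Sum>i\<le>k. \<Sum>l\<in>Bd i. q l)" for k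
          proof (induction k)
            case (Suc k)
            have "(\<Sum>l\<in>(\<Union>i\<le>k. Bd i) \<union> Bd (Suc k). q l) \<le> (\<Sum>l\<in>(\<Union>i\<le>k. Bd i). q l) + (\<Sum>l\<in>Bd (Suc k). q l)"
              using finB q0 by (intro sum_Un_le_nonneg) (auto simp: Bd_def)
            moreover have "(\<Union>i\<le>Suc k. Bd i) = (\<Union>i\<le>k. Bd i) \<union> Bd (Suc k)" by (auto simp: atMost_Suc)
            ultimately show ?case using Suc by simp
          qed simp
          then show ?thesis .
        qed
        finally show ?thesis .
      qed
      ultimately show ?thesis using low high by linarith
    qed
    obtain i where i: "i \<le> K" "1 / (2 * real (Suc K)) \<le> (\<Sum>l\<in>Bd i. q l)"
    proof (rule ccontr)
      assume "\<not> thesis"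
      then have "\<And>i. i \<le> K \<Longrightarrow> (\<Sum>l\<in>Bd i. q l) < 1 / (2 * real (Suc K))" using that not_le by blast
      then have "(\<Sum>i\<le>K. \<Sum>l\<in>Bd i. q l) < (\<Sum>i\<le>K. 1 / (2 * real (Suc K)))"
        by (intro sum_strict_mono) auto
      also have "\<dots> = 1 / 2" by (simp add: field_simps)
      finally show False using mid by simp
    qed
    have Ai: "A i \<ge> A0" using A_ge[of i] D1 by (simp add: mult.commute)
    have l_band: "\<epsilon> * D \<le> real l" "1 \<le> l" if "l \<in> Bd i" for l
    proof -
      have "A i \<le> real l" using that by (simp add: Bd_def)
      then show "\<epsilon> * D \<le> real l" "1 \<le> l" using A_ge[of i] Ai A0 by linarith+
    qed
    have 1: "x / A i \<le> \<kappa> / D"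
    proof -
      have "A i > 0" using Ai A0 by linarith
      then have "x / A i \<le> x / (\<epsilon> * D)" using x A_ge[of i] \<epsilon> D1 by (intro divide_left_mono mult_pos_pos) auto
      then show ?thesis by (simp add: \<kappa>_def)
    qed
    have 2: "w * D ^ (n - 1) \<le> (\<Sum>l\<in>Bd i. q l * \<mu> l)"
    proof -
      have "w * D ^ (n - 1) = 1 / (2 * real (Suc K)) * (c * (\<epsilon> * D) ^ (n - 1))"
        by (simp add: w_def power_mult_distrib)
      also have "\<dots> \<le> (\<Sum>l\<in>Bd i. q l) * (c * (\<epsilon> * D) ^ (n - 1))"
        using i c \<epsilon> D1 by (intro mult_right_mono) auto
      also have "\<dots> \<le> (\<Sum>l\<in>Bd i. q l * \<mu> l)"
        unfolding sum_distrib_right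
      proof (rule sum_mono)
        fix l assume l: "l \<in> Bd i"
        have "c * (\<epsilon> * D) ^ (n - 1) \<le> c * real l ^ (n - 1)"
          using c \<epsilon> D1 l_band[OF l] by (intro mult_left_mono power_mono) auto
        also have "\<dots> \<le> \<mu> l" using l_band[OF l] by (intro \<mu>1)
        finally show "q l * (c * (\<epsilon> * D) ^ (n - 1)) \<le> q l * \<mu> l"
          using q0 l by (intro mult_left_mono) (auto simp: Bd_def)
      qed
      finally show ?thesis .
    qed
    have 3: "(\<Sum>l\<in>Bd i. \<mu> l) \<le> B * D ^ n"
    proof -
      have le: "real l \<le> R2 * D" if "l \<in> Bd i" for l
      proof -
        have "real l \<le> (1 + \<delta>) * A i" using that by (simp add: Bd_def)
        also have "\<dots> = \<epsilon> * (1 + \<delta>) ^ Suc i * D" by (simp add: A_def)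
        also have "\<dots> \<le> R2 * D"
          unfolding R2_def using i \<epsilon> \<delta> D1 by (intro mult_right_mono mult_left_mono power_increasing) auto
        finally show ?thesis .
      qed
      have "Bd i \<subseteq> {..nat \<lfloor>R2 * D\<rfloor>}" using le by (auto simp: le_nat_floor)
      then have "card (Bd i) \<le> nat \<lfloor>R2 * D\<rfloor> + 1" using card_mono[of "{..nat \<lfloor>R2 * D\<rfloor>}" "Bd i"] by simp
      then have card: "real (card (Bd i)) \<le> (R2 + 1) * D"
      proof -
        have "real (nat \<lfloor>R2 * D\<rfloor>) \<le> R2 * D" using R2 D1 by simp
        then show ?thesis using \<open>card (Bd i) \<le> nat \<lfloor>R2 * D\<rfloor> + 1\<close> D1 by (simp add: distrib_right)
      qed
      have "(\<Sum>l\<in>Bd i. \<mu> l) \<le> (\<Sum>l\<in>Bd i. C * ((R2 + 1) * D) ^ (n - 1))"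
      proof (rule sum_mono)
        fix l assume l: "l \<in> Bd i"
        have "C * (real l + 1) ^ (n - 1) \<le> C * ((R2 + 1) * D) ^ (n - 1)"
          using le[OF l] C D1 by (intro mult_left_mono power_mono) (auto simp: distrib_right)
        then show "\<mu> l \<le> C * ((R2 + 1) * D) ^ (n - 1)" using \<mu>2[of l] by simp
      qed
      also have "\<dots> = real (card (Bd i)) * (C * ((R2 + 1) * D) ^ (n - 1))" by simp
      also have "\<dots> \<le> ((R2 + 1) * D) * (C * ((R2 + 1) * D) ^ (n - 1))"
        using card C R2 D1 by (intro mult_right_mono) auto
      also have "\<dots> = B * D ^ n" using n by (cases n) (simp_all add: B_def power_mult_distrib)
      finally show ?thesis .
    qed
    have 4: "(\<Sum>l\<in>L. (q l)\<^sup>2 * \<mu> l * (1 + (\<kappa> + 1) / D) ^ (2 * l)) \<le> t * (D ^ n / D\<^sup>2)"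
    proof -
      have "(\<Sum>l\<in>L. (q l)\<^sup>2 * \<mu> l * (1 + (\<kappa> + 1) / D) ^ (2 * l)) \<le>
          (\<Sum>l\<in>L. (a1\<^sup>2 * C * C5 * D ^ (n - 1) / D\<^sup>2) * (D\<^sup>2 / (D + real l)\<^sup>2))"
      proof (rule sum_mono)
        fix l assume l: "l \<in> L"
        let ?x = "real l / D"
        have x: "?x \<ge> 0" using D1 by simp
        have p1: "(q l)\<^sup>2 \<le> (a1 / D * exp (- a2 * ?x\<^sup>2))\<^sup>2" using qD[OF l] q0[OF l] by (rule power_mono)
        have p2: "\<mu> l \<le> C * (D * (1 + ?x)) ^ (n - 1)"
        proof -
          have "C * (real l + 1) ^ (n - 1) \<le> C * (D * (1 + ?x)) ^ (n - 1)"
            using C D1 by (intro mult_left_mono power_mono) (auto simp: distrib_left)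
          then show ?thesis using \<mu>2[of l] by simp
        qed
        \<comment> \<open>Off the sphere the harmonics grow by at most \<open>exp\<close> of a multiple of \<open>l / D\<close>, which the Gaussian
          weight absorbs.\<close>
        have p3: "(1 + (\<kappa> + 1) / D) ^ (2 * l) \<le> exp (2 * (\<kappa> + 1) * ?x)"
        proof -
          have "(1 + (\<kappa> + 1) / D) ^ (2 * l) \<le> exp ((\<kappa> + 1) / D) ^ (2 * l)"
            using \<kappa> D1 by (intro power_mono exp_ge_add_one_self) auto
          also have "\<dots> = exp (real (2 * l) * ((\<kappa> + 1) / D))" by (rule exp_of_nat_mult[symmetric])
          finally show ?thesis by (simp add: mult_ac)
        qed
        have "(q l)\<^sup>2 * \<mu> l * (1 + (\<kappa> + 1) / D) ^ (2 * l) \<le>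
            (a1 / D * exp (- a2 * ?x\<^sup>2))\<^sup>2 * (C * (D * (1 + ?x)) ^ (n - 1)) * exp (2 * (\<kappa> + 1) * ?x)"
          using \<mu>0[of l] C D1 \<kappa> by (intro mult_mono p1 p2 p3) auto
        also have "\<dots> = (a1\<^sup>2 * C * D ^ (n - 1) / D\<^sup>2) * (1 + ?x) ^ (n - 1) * exp (- (2 * a2) * ?x\<^sup>2 + 2 * (\<kappa> + 1) * ?x)"
        proof -
          have "(exp (- a2 * ?x\<^sup>2))\<^sup>2 = exp (- (2 * a2) * ?x\<^sup>2)"
            using exp_of_nat_mult[of 2 "- a2 * ?x\<^sup>2"] by (simp add: mult.assoc)
          then show ?thesis by (simp only: exp_add power_mult_distrib power_divide) (simp only: mult_ac times_divide_eq_right times_divide_eq_left)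
        qed
        also have "\<dots> \<le> (a1\<^sup>2 * C * D ^ (n - 1) / D\<^sup>2) * (1 + ?x) ^ (n - 1) * (C5 / (1 + ?x) ^ (n + 1))"
          using gaussian_beats_power[of "2 * a2" ?x "2 * (\<kappa> + 1)" "n + 1"] a C D1 x unfolding C5_def
          by (intro mult_left_mono) auto
        also have "\<dots> = (a1\<^sup>2 * C * C5 * D ^ (n - 1) / D\<^sup>2) * (1 / (1 + ?x)\<^sup>2)"
        proof -
          have "(1 + ?x) ^ (n + 1) = (1 + ?x) ^ (n - 1) * (1 + ?x)\<^sup>2"
            using n by (simp add: power_add[symmetric])
          moreover have "(1 + ?x) ^ (n - 1) \<noteq> 0" using x by (simp add: add_nonneg_eq_0_iff)
          ultimately show ?thesis by simp
        qed
        also have "1 / (1 + ?x)\<^sup>2 = D\<^sup>2 / (D + real l)\<^sup>2" by (simp add: frac power_divide)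
        finally show "(q l)\<^sup>2 * \<mu> l * (1 + (\<kappa> + 1) / D) ^ (2 * l) \<le>
          (a1\<^sup>2 * C * C5 * D ^ (n - 1) / D\<^sup>2) * (D\<^sup>2 / (D + real l)\<^sup>2)" .
      qed
      also have "\<dots> \<le> (a1\<^sup>2 * C * C5 * D ^ (n - 1) / D\<^sup>2) * (2 * D)"
        unfolding sum_distrib_left[symmetric] using a C D1 L
        by (intro mult_left_mono sum_inverse_square_tail) (auto simp: C5_def)
      also have "\<dots> = t * (D ^ n / D\<^sup>2)"
        using n by (cases n) (simp_all add: t_def)
      finally show ?thesis .
    qed
    show "\<exists>A. A \<ge> A0 \<and> x / A \<le> \<kappa> / D \<and>
         w * D ^ (n - 1) \<le> (\<Sum>l\<in>band L \<delta> A. q l * \<mu> l) \<and>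
         (\<Sum>l\<in>band L \<delta> A. \<mu> l) \<le> B * D ^ n \<and>
         (\<Sum>l\<in>L. (q l)\<^sup>2 * \<mu> l * (1 + (\<kappa> + 1) / D) ^ (2 * l)) \<le> t * (D ^ n / D\<^sup>2)"
      using Ai 1 2 3 4 unfolding Bd_def band_def by blast
  qed
qed

section \<open>The barrier\<close>

context harmonic_basis
begin

text \<open>
  The random polynomial with every spherical harmonic replaced by its solid harmonic. The two agree on
  the sphere. The random polynomial itself has the additional factor \<open>norm x ^ (d - l)\<close> on the part of
  degree \<open>l\<close> and is not harmonic.
\<close>

definition harmonic_field :: "(nat \<Rightarrow> real) \<Rightarrow> nat set \<Rightarrow> (nat \<times> 'j \<Rightarrow> real) \<Rightarrow> 'a \<Rightarrow> real" where
  "harmonic_field q L a x = (\<Sum>(l, j)\<in>Sigma L J. a (l, j) * (q l * h l j x))"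

lemma finite_index: "finite L \<Longrightarrow> finite (Sigma L J)"
  using finite_J by simp

lemma harmonic_field_eq: "harmonic_field q L a = (\<lambda>x. \<Sum>p\<in>Sigma L J. (a p * q (fst p)) * h (fst p) (snd p) x)"
  unfolding harmonic_field_def by (intro ext sum.cong) (auto simp: mult_ac)

lemma harmonic_index: "p \<in> Sigma L J \<Longrightarrow> h (fst p) (snd p) \<in> solid_harmonics (fst p)"
  by (rule harmonic) auto

lemma harmonic_field_polynomial: "finite L \<Longrightarrow> real_polynomial_function (harmonic_field q L a)"
  unfolding harmonic_field_eq
  by (intro real_polynomial_function_sum real_polynomial_function.intros(2,4) finite_index
      solid_harmonicsD(1)[OF harmonic_index])

lemma laplacian_harmonic_field: "laplacian (harmonic_field q L a) x = 0"
proof -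
  have "laplacian (harmonic_field q L a) x = (\<Sum>p\<in>Sigma L J. (a p * q (fst p)) * laplacian (h (fst p) (snd p)) x)"
    unfolding harmonic_field_eq by (intro laplacian_linear_combination solid_harmonicsD(1)[OF harmonic_index])
  also have "\<dots> = 0"
    by (intro sum.neutral ballI) (simp add: solid_harmonicsD(3)[OF harmonic_index])
  finally show ?thesis .
qed

lemma harmonic_field_diff: "harmonic_field q L (\<lambda>p. a p - b p) x = harmonic_field q L a x - harmonic_field q L b x"
  unfolding harmonic_field_def sum_subtractf[symmetric] by (intro sum.cong) (auto simp: algebra_simps)

text \<open>
  Within each degree, evaluation at \<open>u\<close> is the inner product of the coefficients with the values of
  the basis at \<open>u\<close>. Coefficients proportional to these values give the largest value at \<open>u\<close> for a
  given norm, and the resulting function is a multiple of the kernel.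
\<close>

definition barrier_coeff :: "real \<Rightarrow> nat set \<Rightarrow> 'a \<Rightarrow> nat \<times> 'j \<Rightarrow> real" where
  "barrier_coeff g B u p = (if fst p \<in> B then g * h (fst p) (snd p) u else 0)"

lemma harmonic_field_barrier_coeff:
  assumes "finite L" "B \<subseteq> L"
  shows "harmonic_field q L (barrier_coeff g B u) x = g * (\<Sum>l\<in>B. q l * kernel l u x)"
proof -
  have "harmonic_field q L (barrier_coeff g B u) x = (\<Sum>l\<in>L. \<Sum>j\<in>J l. barrier_coeff g B u (l, j) * (q l * h l j x))"
    unfolding harmonic_field_def by (rule sum.Sigma[symmetric]) (auto simp: assms finite_J)
  also have "\<dots> = (\<Sum>l\<in>B. \<Sum>j\<in>J l. g * (q l * (h l j u * h l j x)))"
    using assms by (intro sum.mono_neutral_cong_right) (auto simp: barrier_coeff_def mult_ac finite_J intro!: sum.cong)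
  also have "\<dots> = g * (\<Sum>l\<in>B. q l * kernel l u x)"
    by (simp add: kernel_def sum_distrib_left)
  finally show ?thesis .
qed

lemma barrier_coeff_norm:
  assumes "finite L" "B \<subseteq> L" "norm u = 1"
  shows "(\<Sum>p\<in>Sigma L J. (barrier_coeff g B u p)\<^sup>2) = g\<^sup>2 * (\<Sum>l\<in>B. mass l)"
proof -
  have "(\<Sum>p\<in>Sigma L J. (barrier_coeff g B u p)\<^sup>2) = (\<Sum>l\<in>L. \<Sum>j\<in>J l. (barrier_coeff g B u (l, j))\<^sup>2)"
    by (subst sum.Sigma) (auto simp: assms finite_J intro!: sum.cong)
  also have "\<dots> = (\<Sum>l\<in>B. \<Sum>j\<in>J l. g\<^sup>2 * (h l j u * h l j u))"
    using assms by (intro sum.mono_neutral_cong_right)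
      (auto simp: barrier_coeff_def power_mult_distrib power2_eq_square finite_J intro!: sum.cong)
  also have "\<dots> = g\<^sup>2 * (\<Sum>l\<in>B. kernel l u u)"
    by (simp add: kernel_def sum_distrib_left)
  also have "\<dots> = g\<^sup>2 * (\<Sum>l\<in>B. mass l)" by (simp add: kernel_diag assms)
  finally show ?thesis .
qed

lemma boundary_geometry:
  fixes u y :: 'a
  assumes u: "norm u = 1" and rim: "y \<in> cone_rim \<rho> u" and \<rho>: "\<rho> > 0"
  shows "y \<bullet> u = 1 / sqrt (1 + \<rho>\<^sup>2)" "norm (y - u) \<le> \<rho>"
proof -
  have y: "norm y = 1" "y \<bullet> u > 0" "norm (y - (y \<bullet> u) *\<^sub>R u) = \<rho> * (y \<bullet> u)"
    using rim by (auto simp: cone_rim_def)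
  let ?s = "y \<bullet> u"
  have uu: "u \<bullet> u = 1" and yy: "y \<bullet> y = 1" using u y by (simp_all add: dot_square_norm)
  have "(norm (y - ?s *\<^sub>R u))\<^sup>2 = 1 - ?s\<^sup>2"
    unfolding power2_norm_eq_inner using uu yy
    by (simp add: inner_diff_left inner_diff_right inner_commute power2_eq_square)
  then have s2: "\<rho>\<^sup>2 * ?s\<^sup>2 = 1 - ?s\<^sup>2" unfolding y(3) by (simp add: power_mult_distrib)
  then have "?s\<^sup>2 * (1 + \<rho>\<^sup>2) = 1" by (simp add: algebra_simps)
  then have "?s * sqrt (1 + \<rho>\<^sup>2) = 1"
    using y(2) by (metis abs_of_pos real_sqrt_abs real_sqrt_mult real_sqrt_one)
  moreover have sq: "sqrt (1 + \<rho>\<^sup>2) > 0" by (simp add: add_pos_nonneg)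
  ultimately show "?s = 1 / sqrt (1 + \<rho>\<^sup>2)" by (simp add: eq_divide_eq)
  have s1: "?s \<le> 1" using Cauchy_Schwarz_ineq2[of y u] u y by simp
  have "(norm (y - u))\<^sup>2 * ?s\<^sup>2 = 2 * (1 - ?s) * ?s\<^sup>2"
    unfolding power2_norm_eq_inner using uu yy by (simp add: inner_diff_left inner_diff_right inner_commute)
  also have "\<dots> \<le> (1 - ?s) * (1 + ?s)"
  proof -
    have "?s\<^sup>2 \<le> ?s" using s1 y(2) by (simp add: power2_eq_square mult_left_le)
    then have "2 * ?s\<^sup>2 \<le> 1 + ?s" using s1 by linarith
    then have "(1 - ?s) * (2 * ?s\<^sup>2) \<le> (1 - ?s) * (1 + ?s)" using s1 by (intro mult_left_mono) auto
    then show ?thesis by (simp only: mult_ac)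
  qed
  also have "\<dots> = \<rho>\<^sup>2 * ?s\<^sup>2" unfolding s2 by (simp add: power2_eq_square algebra_simps)
  finally have "(norm (y - u))\<^sup>2 \<le> \<rho>\<^sup>2" using y(2) by simp
  then show "norm (y - u) \<le> \<rho>" using \<rho> by (simp add: power2_le_iff_abs_le)
qed

text \<open>
  On the rim the height \<open>y \<bullet> u\<close> is the cosine of \<open>arctan \<rho>\<close>, and the argument of the profile is the
  squared tangent of the same angle.
\<close>

lemma kernel_boundary:
  fixes u y :: 'a
  assumes u: "norm u = 1" and rim: "y \<in> cone_rim \<rho> u" and \<rho>: "\<rho> > 0"
  shows "kernel l u y = mass l * ((1 / sqrt (1 + \<rho>\<^sup>2)) ^ l * zonal_profile n l (\<rho>\<^sup>2))"
proof -
  have y: "norm y = 1" "y \<bullet> u > 0" "norm (y - (y \<bullet> u) *\<^sub>R u) = \<rho> * (y \<bullet> u)"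
    using rim by (auto simp: cone_rim_def)
  let ?T = "reflection (u - pole)" and ?s = "y \<bullet> u"
  have s: "?s = 1 / sqrt (1 + \<rho>\<^sup>2)" by (rule boundary_geometry[OF assms])
  have T: "?T u = pole" by (rule reflection_swaps) (simp add: u)
  have Ty: "?T y \<bullet> pole = ?s"
    using orthogonal_reflection[of "u - pole"] unfolding orthogonal_transformation_def by (metis T)
  have "kernel l u y = kernel l pole (?T y)" using kernel_reflection[of l "u - pole" u y] T by simp
  also have "\<dots> = mass l * ?s ^ l * zonal_profile n l (((norm (?T y))\<^sup>2 - ?s\<^sup>2) / ?s\<^sup>2)"
    using kernel_zonal[of "?T y" l] y(2) by (simp add: Ty)
  also have "((norm (?T y))\<^sup>2 - ?s\<^sup>2) / ?s\<^sup>2 = \<rho>\<^sup>2"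
    unfolding s by (simp add: y(1) power_divide add_nonneg_eq_0_iff field_simps)
  finally show ?thesis by (simp only: s mult.assoc)
qed

text \<open>
  The parameter \<open>\<tau>\<close> bounds the variance of the field on the ball of radius \<open>R\<close> around \<open>u\<close>. Passing from
  the mean square over this ball to the values at points within \<open>\<rho>\<close> of \<open>u\<close> costs the ratio of the
  volumes of the balls of radii \<open>R\<close> and \<open>r\<close>. Assumption \<open>big\<close> says that the resulting bound for the
  fluctuation is smaller than the barrier, which is at least \<open>g * c0 * (\<Sum>l\<in>B. q l * mass l)\<close> in absolute
  value at \<open>u\<close> and on the rim.
\<close>

lemma barrier_event:
  fixes u :: 'a
  assumes X: "iid_standard_gaussian M (Sigma L J) X" and L: "finite L" and ne: "Sigma L J \<noteq> {}"
    and q: "\<And>l. l \<in> L \<Longrightarrow> 0 \<le> q l" and u: "norm u = 1"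
    and \<rho>: "\<rho> > 0" and r: "r > 0" and R: "\<rho> + r \<le> R"
    and \<tau>: "(\<Sum>l\<in>L. (q l)\<^sup>2 * mass l * (1 + R) ^ (2 * l)) \<le> \<tau>" "\<tau> > 0"
    and B: "B \<subseteq> L" and c0: "0 < c0" "c0 \<le> 1"
    and neg: "\<And>l. l \<in> B \<Longrightarrow> (1 / sqrt (1 + \<rho>\<^sup>2)) ^ l * zonal_profile n l (\<rho>\<^sup>2) \<le> - c0"
    and g: "g > 0" "g\<^sup>2 * (\<Sum>l\<in>B. mass l) \<le> \<beta>\<^sup>2" "\<beta> > 0"
    and big: "4 * (R / r) ^ DIM('a) * \<tau> < (g * c0 * (\<Sum>l\<in>B. q l * mass l))\<^sup>2"
  obtains E where "E \<in> sets M" "exp (- 2 * \<beta> - \<beta>\<^sup>2 / 2) / 2 \<le> measure M E"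
    "\<And>\<omega>. \<omega> \<in> E \<Longrightarrow> harmonic_field q L (\<lambda>p. X p \<omega>) u > 0"
    "\<And>\<omega> y. \<omega> \<in> E \<Longrightarrow> y \<in> cone_rim \<rho> u \<Longrightarrow> harmonic_field q L (\<lambda>p. X p \<omega>) y < 0"
proof -
  let ?I = "Sigma L J" and ?b = "barrier_coeff g B u"
  define \<phi> where "\<phi> p x = q (fst p) * h (fst p) (snd p) x" for p and x :: 'a
  \<comment> \<open>The integral of the squared field over the ball is a quadratic form in the coefficients.\<close>
  define G where "G i k = (\<integral>x\<in>ball u R. \<phi> i x * \<phi> k x \<partial>lborel)" for i k
  define v where "v s = measure lborel (ball u s)" for s
  define V where "V = 4 * v R * \<tau>"
  define W where "W = (\<Sum>l\<in>B. q l * mass l)"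
  have R0: "R > 0" using \<rho> r R by linarith
  have v: "v R = R ^ DIM('a) * v 1" "v r = r ^ DIM('a) * v 1" "v 1 > 0"
    using content_ball_conv_unit_ball[of R u] content_ball_conv_unit_ball[of r u]
      content_ball_conv_unit_ball[of 1 u] content_ball_pos[of 1 u] R0 r by (simp_all add: v_def)
  have finI: "finite ?I" by (rule finite_index[OF L])
  have \<phi>_cont: "continuous_on UNIV (\<phi> p)" if "p \<in> ?I" for p
    unfolding \<phi>_def[abs_def] using that
    by (intro continuous_intros continuous_on_solid_harmonic[OF harmonic]) auto
  have field_sum: "harmonic_field q L a x = (\<Sum>p\<in>?I. a p * \<phi> p x)" for a x
    unfolding harmonic_field_def \<phi>_def by (intro sum.cong) auto
  have \<phi>_int: "set_integrable lborel (ball u R) (\<lambda>x. \<phi> i x * \<phi> k x)" if "i \<in> ?I" "k \<in> ?I" for i k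
    using that by (intro set_integrable_ball_continuous continuous_intros \<phi>_cont)
  have form: "(\<Sum>i\<in>?I. \<Sum>k\<in>?I. a i * a k * G i k) = (\<integral>x\<in>ball u R. (harmonic_field q L a x)\<^sup>2 \<partial>lborel)" for a
  proof -
    have "(\<integral>x\<in>ball u R. (harmonic_field q L a x)\<^sup>2 \<partial>lborel) =
        (\<integral>x. (\<Sum>i\<in>?I. \<Sum>k\<in>?I. a i * a k * (indicator (ball u R) x *\<^sub>R (\<phi> i x * \<phi> k x))) \<partial>lborel)"
      unfolding set_lebesgue_integral_def
      by (intro Bochner_Integration.integral_cong refl)
         (simp add: field_sum power2_eq_square sum_product sum_distrib_left mult_ac)
    also have "\<dots> = (\<Sum>i\<in>?I. \<Sum>k\<in>?I. \<integral>x. a i * a k * (indicator (ball u R) x *\<^sub>R (\<phi> i x * \<phi> k x)) \<partial>lborel)"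
      using \<phi>_int unfolding set_integrable_def
      by (subst Bochner_Integration.integral_sum)
         (auto intro!: Bochner_Integration.integrable_sum integrable_mult_right sum.cong Bochner_Integration.integral_sum)
    finally show ?thesis by (simp add: G_def set_lebesgue_integral_def)
  qed
  have trace: "4 * (\<Sum>i\<in>?I. G i i) \<le> V"
  proof -
    have "(\<Sum>i\<in>?I. G i i) = (\<integral>x\<in>ball u R. (\<Sum>i\<in>?I. \<phi> i x * \<phi> i x) \<partial>lborel)"
      unfolding G_def set_lebesgue_integral_def scaleR_sum_right
      using \<phi>_int unfolding set_integrable_def by (intro Bochner_Integration.integral_sum[symmetric]) auto
    also have "\<dots> \<le> (\<integral>x\<in>ball u R. \<tau> \<partial>lborel)"
    proof (rule set_integral_mono)
      show "set_integrable lborel (ball u R) (\<lambda>x. \<Sum>i\<in>?I. \<phi> i x * \<phi> i x)"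
        by (intro set_integrable_ball_continuous continuous_on_sum continuous_on_mult \<phi>_cont)
      show "set_integrable lborel (ball u R) (\<lambda>x. \<tau>)"
        by (intro set_integrable_ball_continuous continuous_intros)
      fix x assume x: "x \<in> ball u R"
      have "norm x \<le> norm u + norm (x - u)" using norm_triangle_ineq[of u "x - u"] by simp
      then have nx: "norm x \<le> 1 + R" using x u by (simp add: dist_norm norm_minus_commute)
      have "(\<Sum>i\<in>?I. \<phi> i x * \<phi> i x) = (\<Sum>l\<in>L. \<Sum>j\<in>J l. \<phi> (l, j) x * \<phi> (l, j) x)"
        by (subst sum.Sigma) (auto simp: L finite_J intro!: sum.cong)
      also have "\<dots> = (\<Sum>l\<in>L. (q l)\<^sup>2 * kernel l x x)"
        by (simp add: \<phi>_def kernel_def sum_distrib_left power2_eq_square mult_ac)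
      also have "\<dots> \<le> (\<Sum>l\<in>L. (q l)\<^sup>2 * mass l * (1 + R) ^ (2 * l))"
      proof (rule sum_mono)
        fix l assume "l \<in> L"
        have "norm x ^ (2 * l) \<le> (1 + R) ^ (2 * l)" using nx by (intro power_mono) auto
        then show "(q l)\<^sup>2 * kernel l x x \<le> (q l)\<^sup>2 * mass l * (1 + R) ^ (2 * l)"
          unfolding kernel_diag using mass_pos[of l] by (simp add: mult_left_mono mult_ac)
      qed
      also note \<tau>(1)
      finally show "(\<Sum>i\<in>?I. \<phi> i x * \<phi> i x) \<le> \<tau>" .
    qed
    also have "\<dots> = v R * \<tau>"
      using emeasure_lborel_ball_finite[of u R] by (simp add: set_lebesgue_integral_def v_def)
    finally show ?thesis by (simp add: V_def)
  qed
  have pos: "0 \<le> (\<Sum>i\<in>?I. \<Sum>k\<in>?I. a i * a k * G i k)" for a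
    unfolding form set_lebesgue_integral_def by (intro Bochner_Integration.integral_nonneg) simp
  have V: "V > 0" using v R0 \<tau>(2) by (simp add: V_def)
  have b: "(\<Sum>p\<in>?I. (?b p)\<^sup>2) \<le> \<beta>\<^sup>2" using g(2) by (simp add: barrier_coeff_norm[OF L B u])
  define E where "E = {\<omega> \<in> space M. (\<Sum>i\<in>?I. \<Sum>k\<in>?I. (X i \<omega> - ?b i) * (X k \<omega> - ?b k) * G i k) \<le> V}"
  note shifted = gaussian_shifted_small_ball[OF X finI ne pos trace V b g(3)]
  have W: "W \<ge> 0" unfolding W_def
    using q B mass_pos by (intro sum_nonneg mult_nonneg_nonneg) (auto intro: less_imp_le)
  then have gW: "g * c0 * W \<ge> 0" using g c0 by simp
  \<comment> \<open>On \<open>E\<close> the field is uniformly close to the barrier on the ball of radius \<open>\<rho>\<close>: the mean value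
    inequality is applied to their difference, which is again a harmonic field.\<close>
  have small: "\<bar>harmonic_field q L (\<lambda>p. X p \<omega>) y - harmonic_field q L ?b y\<bar> < g * c0 * W"
    if \<omega>: "\<omega> \<in> E" and y: "norm (y - u) \<le> \<rho>" for \<omega> y
  proof -
    let ?f = "harmonic_field q L (\<lambda>p. X p \<omega> - ?b p)"
    have "(?f y)\<^sup>2 * measure lborel (ball y r) \<le> (\<integral>x\<in>ball y r. (?f x)\<^sup>2 \<partial>lborel)"
      by (rule square_le_ball_average[OF harmonic_field_polynomial[OF L] laplacian_harmonic_field r])
    also have "\<dots> \<le> (\<integral>x\<in>ball u R. (?f x)\<^sup>2 \<partial>lborel)"
    proof -
      have "continuous_on UNIV ?f" using harmonic_field_polynomial[OF L]
        by (meson continuous_on_polymonial_function real_polynomial_function_eq)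
      then have i: "set_integrable lborel (ball z s) (\<lambda>x. (?f x)\<^sup>2)" for z s
        by (intro set_integrable_ball_continuous continuous_intros)
      have sub: "x \<in> ball u R" if "x \<in> ball y r" for x
      proof -
        have "norm (x - y) < r" using that by (simp add: dist_norm norm_minus_commute)
        then have "norm (x - u) < R" using norm_triangle_ineq[of "x - y" "y - u"] y R by simp
        then show ?thesis by (simp add: dist_norm norm_minus_commute)
      qed
      show ?thesis
        unfolding set_lebesgue_integral_def
        by (rule Bochner_Integration.integral_mono)
           (use i sub in \<open>auto simp: set_integrable_def indicator_def\<close>)
    qed
    also have "\<dots> \<le> V" using \<omega> unfolding E_def form[of "\<lambda>p. X p \<omega> - ?b p", symmetric] by simp
    also have "V = v r * (4 * (R / r) ^ DIM('a) * \<tau>)"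
      using r by (simp add: V_def v power_divide)
    also have "measure lborel (ball y r) = v r"
      using content_ball_conv_unit_ball[of r y] content_ball_conv_unit_ball[of 1 u] r v(2) by (simp add: v_def)
    finally have "(?f y)\<^sup>2 * v r \<le> v r * (4 * (R / r) ^ DIM('a) * \<tau>)" .
    moreover have "v r > 0" using v r by simp
    ultimately have "(?f y)\<^sup>2 \<le> 4 * (R / r) ^ DIM('a) * \<tau>" by (simp add: mult.commute)
    also have "\<dots> < (g * c0 * W)\<^sup>2" using big by (simp add: W_def)
    finally have "\<bar>?f y\<bar> < g * c0 * W" using gW by (simp add: power2_less_imp_less[of "\<bar>?f y\<bar>"])
    then show ?thesis by (simp add: harmonic_field_diff)
  qed
  show ?thesis
  proof (rule that[of E])
    show "E \<in> sets M" unfolding E_def by (rule shifted(1))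
    show "exp (- 2 * \<beta> - \<beta>\<^sup>2 / 2) / 2 \<le> measure M E" unfolding E_def by (rule shifted(2))
    show "harmonic_field q L (\<lambda>p. X p \<omega>) u > 0" if "\<omega> \<in> E" for \<omega>
    proof -
      have "harmonic_field q L ?b u = g * W"
        unfolding harmonic_field_barrier_coeff[OF L B] W_def by (simp add: kernel_diag u)
      moreover have "g * c0 * W \<le> g * W"
      proof -
        have "g * W \<ge> 0" using W g by simp
        then show ?thesis using c0 mult_right_mono[of c0 1 "g * W"] by (simp add: mult_ac)
      qed
      ultimately show ?thesis using small[OF that, of u] \<rho> by simp
    qed
    show "harmonic_field q L (\<lambda>p. X p \<omega>) y < 0"
      if \<omega>: "\<omega> \<in> E" and y: "y \<in> cone_rim \<rho> u" for \<omega> y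
    proof -
      have "harmonic_field q L ?b y = g * (\<Sum>l\<in>B. q l * (mass l * ((1 / sqrt (1 + \<rho>\<^sup>2)) ^ l * zonal_profile n l (\<rho>\<^sup>2))))"
        unfolding harmonic_field_barrier_coeff[OF L B] by (simp only: kernel_boundary[OF u y \<rho>])
      also have "\<dots> \<le> g * (\<Sum>l\<in>B. q l * (mass l * - c0))"
        using g q B mass_pos neg by (intro mult_left_mono sum_mono) (auto intro: less_imp_le)
      also have "\<dots> = - (g * c0 * W)" by (simp add: W_def sum_distrib_left sum_negf mult_ac)
      finally have "harmonic_field q L ?b y \<le> - (g * c0 * W)" .
      then show ?thesis using small[OF \<omega> boundary_geometry(2)[OF u y \<rho>]] by linarith
    qed
  qed
qed

end

section \<open>The expected number of components\<close>

context harmonic_basis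
begin

lemma unit_vector_orthogonal_to:
  fixes u :: 'a
  assumes u: "norm u = 1"
  obtains \<eta> where "norm \<eta> = 1" "\<eta> \<bullet> u = 0"
proof -
  obtain b where b: "b \<in> Basis" "b \<noteq> pole" by (rule obtain_orthogonal_Basis)
  let ?T = "reflection (pole - u)"
  have T: "?T pole = u" by (rule reflection_swaps) (simp add: u)
  have "?T b \<bullet> ?T pole = b \<bullet> pole"
    using orthogonal_reflection[of "pole - u"] unfolding orthogonal_transformation_def by blast
  also have "\<dots> = 0" using b pole_Basis by (simp add: inner_Basis)
  finally have "?T b \<bullet> u = 0" unfolding T .
  moreover have "norm (?T b) = 1" using b by simp
  ultimately show ?thesis by (rule that[rotated])
qed

text \<open>
  Between the centre and the rim there is a zero by the intermediate value theorem, and on the whole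
  boundary of the double cone there is none by homogeneity.
\<close>

lemma components_of_sign_pattern:
  fixes f F :: "'a \<Rightarrow> real"
  assumes f: "f \<in> homogeneous_polynomials d" and fF: "\<And>x. norm x = 1 \<Longrightarrow> f x = F x"
    and fin: "finite U" and U: "\<And>u. u \<in> U \<Longrightarrow> norm u = 1" and \<rho>: "\<rho> > 0"
    and disj: "disjoint_cones \<rho> U"
    and center: "\<And>u. u \<in> U \<Longrightarrow> F u > 0"
    and boundary: "\<And>u y. u \<in> U \<Longrightarrow> y \<in> cone_rim \<rho> u \<Longrightarrow> F y < 0"
  shows "enat (card U) \<le> b0 (proj_zero_set f)"
proof -
  have hom: "f (c *\<^sub>R x) = c ^ d * f x" for c x using f unfolding homogeneous_polynomials_def by blast
  have neg: "f x < 0" if u: "u \<in> U" and x: "x \<bullet> u > 0" "norm (x - (x \<bullet> u) *\<^sub>R u) = \<rho> * (x \<bullet> u)" for u x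
  proof -
    have nx: "norm x > 0" using x by auto
    let ?y = "(1 / norm x) *\<^sub>R x"
    have "norm (?y - (?y \<bullet> u) *\<^sub>R u) = norm ((1 / norm x) *\<^sub>R (x - (x \<bullet> u) *\<^sub>R u))"
      by (simp add: scaleR_diff_right)
    also have "\<dots> = \<bar>1 / norm x\<bar> * norm (x - (x \<bullet> u) *\<^sub>R u)" by (rule norm_scaleR)
    also have "\<dots> = \<rho> * (?y \<bullet> u)" unfolding x(2) using nx by simp
    finally have "F ?y < 0" using x nx by (intro boundary[OF u]) (auto simp: cone_rim_def)
    then have "f ?y < 0" using fF[of ?y] nx by simp
    moreover have "f x = norm x ^ d * f ?y" using hom[of "norm x" ?y] nx by simp
    ultimately show ?thesis using nx by (simp add: mult_pos_neg)
  qed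
  show ?thesis
  proof (rule b0_ge_card[OF f fin _ _ disj])
    fix u x assume u: "u \<in> U" and x: "x \<noteq> 0" "norm (x - (x \<bullet> u) *\<^sub>R u) = \<rho> * \<bar>x \<bullet> u\<bar>"
    have "x \<bullet> u \<noteq> 0" using x by auto
    then consider "x \<bullet> u > 0" | "(- 1 *\<^sub>R x) \<bullet> u > 0" by fastforce
    then show "f x \<noteq> 0"
    proof cases
      case 1
      then show ?thesis using neg[OF u 1] x by simp
    next
      case 2
      have "- 1 *\<^sub>R x - (- 1 *\<^sub>R x \<bullet> u) *\<^sub>R u = - (x - (x \<bullet> u) *\<^sub>R u)" by simp
      then have "norm (- 1 *\<^sub>R x - (- 1 *\<^sub>R x \<bullet> u) *\<^sub>R u) = \<rho> * (- 1 *\<^sub>R x \<bullet> u)"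
        using x(2) 2 by (simp only: norm_minus_cancel) simp
      then have "f (- 1 *\<^sub>R x) < 0" using neg[OF u 2] by blast
      then show ?thesis using hom[of "- 1" x] by auto
    qed
  next
    fix u assume u: "u \<in> U"
    have uu: "u \<bullet> u = 1" using U[OF u] by (simp add: dot_square_norm)
    obtain \<eta> where \<eta>: "norm \<eta> = 1" "\<eta> \<bullet> u = 0" using unit_vector_orthogonal_to[OF U[OF u]] by blast
    let ?p = "\<lambda>t. u + t *\<^sub>R \<eta>"
    have p: "?p t \<bullet> u = 1" "norm (?p t - (?p t \<bullet> u) *\<^sub>R u) = \<bar>t\<bar>" for t
      using uu \<eta> by (simp_all add: inner_add_left)
    have "continuous_on UNIV f" using f unfolding homogeneous_polynomials_def
      by (simp add: continuous_on_polymonial_function real_polynomial_function_eq)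
    then have "continuous_on {0..\<rho>} (\<lambda>t. f (?p t))"
      by (rule continuous_on_compose2) (auto intro!: continuous_intros)
    moreover have "f (?p \<rho>) < 0" using p[of \<rho>] \<rho> by (intro neg[OF u]) auto
    moreover have "f (?p 0) > 0" using center[OF u] fF[OF U[OF u]] by simp
    ultimately obtain t where t: "0 \<le> t" "t \<le> \<rho>" "f (?p t) = 0"
      using IVT2'[of "\<lambda>t. f (?p t)" \<rho> 0 0] \<rho> by (auto simp: less_imp_le)
    have "t \<noteq> \<rho>" using t(3) \<open>f (?p \<rho>) < 0\<close> by auto
    then have "?p t \<in> double_cone \<rho> u" unfolding double_cone_def mem_Collect_eq p using t \<eta>(1) by simp
    moreover have "?p t \<noteq> 0" using p(1)[of t] by auto
    ultimately show "\<exists>x. x \<noteq> 0 \<and> x \<in> double_cone \<rho> u \<and> f x = 0" using t(3) by blast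
  qed
qed

text \<open>
  The number of components is at least the number of those \<open>u\<close> whose event occurs, and the expectation
  of the latter is the sum of the probabilities.
\<close>

lemma expected_components_lower_bound:
  fixes U :: "'a set" and M :: "'w measure"
  assumes Y: "\<And>l j x. j \<in> J l \<Longrightarrow> norm x = 1 \<Longrightarrow> Y l j x = h l j x"
    and f: "\<And>a. invariant_polynomial d q J Y a \<in> homogeneous_polynomials d"
    and fin: "finite U" and U: "\<And>u. u \<in> U \<Longrightarrow> norm u = 1" and \<rho>: "\<rho> > 0"
    and disj: "disjoint_cones \<rho> U"
    and M: "prob_space M" and \<pi>: "\<pi> \<ge> 0"
    and events: "\<And>u. u \<in> U \<Longrightarrow> \<exists>E\<in>sets M. \<pi> \<le> measure M E \<and>
      (\<forall>\<omega>\<in>E. harmonic_field q (harmonic_degrees d) (\<lambda>p. X p \<omega>) u > 0) \<and>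
      (\<forall>\<omega>\<in>E. \<forall>y\<in>cone_rim \<rho> u.
         harmonic_field q (harmonic_degrees d) (\<lambda>p. X p \<omega>) y < 0)"
  shows "ennreal (real (card U) * \<pi>) \<le>
    (\<integral>\<^sup>+\<omega>. ennreal_of_enat (b0 (proj_zero_set (invariant_polynomial d q J Y (\<lambda>l j. X (l, j) \<omega>)))) \<partial>M)"
proof -
  interpret prob_space M by (rule M)
  let ?F = "\<lambda>\<omega>. harmonic_field q (harmonic_degrees d) (\<lambda>p. X p \<omega>)"
  define good where "good u E \<longleftrightarrow> E \<in> sets M \<and> \<pi> \<le> measure M E \<and> (\<forall>\<omega>\<in>E. ?F \<omega> u > 0) \<and>
    (\<forall>\<omega>\<in>E. \<forall>y\<in>cone_rim \<rho> u. ?F \<omega> y < 0)"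
    for u E
  have "\<forall>u\<in>U. \<exists>E. good u E" using events unfolding good_def by blast
  then obtain E where "\<forall>u\<in>U. good u (E u)" unfolding bchoice_iff by blast
  then have E: "\<And>u. u \<in> U \<Longrightarrow> E u \<in> sets M" "\<And>u. u \<in> U \<Longrightarrow> \<pi> \<le> measure M (E u)"
    "\<And>u \<omega>. u \<in> U \<Longrightarrow> \<omega> \<in> E u \<Longrightarrow> ?F \<omega> u > 0"
    "\<And>u \<omega> y. u \<in> U \<Longrightarrow> \<omega> \<in> E u \<Longrightarrow> y \<in> cone_rim \<rho> u \<Longrightarrow> ?F \<omega> y < 0"
    unfolding good_def by blast+
  have fin_deg: "finite (harmonic_degrees d)"
    by (rule finite_subset[of _ "{..d}"]) (auto simp: harmonic_degrees_def)
  have on_sphere: "invariant_polynomial d q J Y (\<lambda>l j. X (l, j) \<omega>) x = ?F \<omega> x" if x: "norm x = 1" for x \<omega>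
  proof -
    have "?F \<omega> x = (\<Sum>l\<in>harmonic_degrees d. \<Sum>j\<in>J l. X (l, j) \<omega> * (q l * h l j x))"
      unfolding harmonic_field_def by (rule sum.Sigma[symmetric]) (auto simp: fin_deg finite_J)
    also have "\<dots> = invariant_polynomial d q J Y (\<lambda>l j. X (l, j) \<omega>) x"
      unfolding invariant_polynomial_def sum_distrib_left
      by (intro sum.cong refl) (simp add: x Y mult_ac)
    finally show ?thesis by simp
  qed
  have pointwise: "(\<Sum>u\<in>U. indicator (E u) \<omega>) \<le>
      ennreal_of_enat (b0 (proj_zero_set (invariant_polynomial d q J Y (\<lambda>l j. X (l, j) \<omega>))))" for \<omega>
  proof -
    let ?U = "{u \<in> U. \<omega> \<in> E u}"
    have "enat (card ?U) \<le> b0 (proj_zero_set (invariant_polynomial d q J Y (\<lambda>l j. X (l, j) \<omega>)))"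
      by (rule components_of_sign_pattern[OF f on_sphere _ _ \<rho>])
         (use fin U disj E in \<open>auto simp: disjoint_cones_def\<close>)
    then have "ennreal_of_enat (enat (card ?U)) \<le>
        ennreal_of_enat (b0 (proj_zero_set (invariant_polynomial d q J Y (\<lambda>l j. X (l, j) \<omega>))))"
      by (simp only: ennreal_of_enat_le_iff)
    moreover have "(\<Sum>u\<in>U. indicator (E u) \<omega>) = (of_nat (card ?U) :: ennreal)"
      using fin by (simp add: indicator_def sum.If_cases Int_def)
    ultimately show ?thesis by (simp add: ennreal_of_enat_enat)
  qed
  have "ennreal (real (card U) * \<pi>) = (\<Sum>u\<in>U. ennreal \<pi>)"
    using \<pi> by (simp add: ennreal_mult ennreal_of_nat_eq_real_of_nat)
  also have "\<dots> \<le> (\<Sum>u\<in>U. emeasure M (E u))"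
    using E(2) by (intro sum_mono) (auto simp: emeasure_eq_measure)
  also have "\<dots> = (\<integral>\<^sup>+\<omega>. (\<Sum>u\<in>U. indicator (E u) \<omega>) \<partial>M)"
    using E(1) by (subst nn_integral_sum) auto
  also have "\<dots> \<le> (\<integral>\<^sup>+\<omega>. ennreal_of_enat (b0 (proj_zero_set (invariant_polynomial d q J Y (\<lambda>l j. X (l, j) \<omega>)))) \<partial>M)"
    by (intro nn_integral_mono pointwise)
  finally show ?thesis .
qed

end

theorem theorem11:
  fixes n :: nat
    and J :: "nat \<Rightarrow> 'j set"
    and Y :: "nat \<Rightarrow> 'j \<Rightarrow> real ^ 'm \<Rightarrow> real"
    and p :: "nat \<Rightarrow> nat \<Rightarrow> real"
    and lam :: real
    and psi :: "real \<Rightarrow> real"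
    and M :: "nat \<Rightarrow> 'w measure"
    and \<xi> :: "nat \<Rightarrow> nat \<Rightarrow> 'j \<Rightarrow> 'w \<Rightarrow> real"
  assumes "n \<ge> 1" and "CARD('m) = n + 1"
    and "\<And>l. orthonormal_harmonic_basis l (J l) (Y l)"
    and "coherent_family p lam psi"
    and "\<And>d. d \<ge> 1 \<Longrightarrow>
           iid_standard_gaussian (M d) (SIGMA l:harmonic_degrees d. J l) (\<lambda>(l, j). \<xi> d l j)"
  shows "\<exists>c>0. \<forall>\<^sub>F d in sequentially.
           (\<integral>\<^sup>+ \<omega>. ennreal_of_enat
               (b0 (proj_zero_set (invariant_polynomial d (p d) J Y (\<lambda>l j. \<xi> d l j \<omega>)))) \<partial>M d)
             \<ge> ennreal (c * real d powr (lam * real n))"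
proof -
  have dim: "DIM(real ^ 'm) = Suc n" using assms(2) by simp
  obtain h where hb: "harmonic_basis J h n"
    and hY: "\<And>l j x. j \<in> J l \<Longrightarrow> norm x = 1 \<Longrightarrow> Y l j x = h l j x"
    using solid_harmonic_basis_exists[OF assms(3) dim assms(1)] by blast
  interpret harmonic_basis J h n by (rule hb)
  obtain c C where c: "c > 0" and C: "C > 0"
    and mass_lower: "\<And>l. l \<ge> 1 \<Longrightarrow> c * real l ^ (n - 1) \<le> mass l"
    and mass_upper: "\<And>l. mass l \<le> C * (real l + 1) ^ (n - 1)"
    using mass_bounds by blast
  obtain x \<delta> c0' A0 where x: "x > 0" and \<delta>: "\<delta> > 0" and c0': "c0' > 0" and A0: "A0 \<ge> 1"
    and neg': "\<And>A l. A \<ge> A0 \<Longrightarrow> A \<le> real l \<Longrightarrow> real l \<le> (1 + \<delta>) * A \<Longrightarrow>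
       (1 / sqrt (1 + (x / A)\<^sup>2)) ^ l * zonal_profile n l ((x / A)\<^sup>2) \<le> - c0'"
    using zonal_profile_negative_band[OF n_pos] by blast
  define c0 where "c0 = min 1 c0'"
  have c0: "0 < c0" "c0 \<le> 1" "c0 \<le> c0'" using c0' by (auto simp: c0_def)
  note coherent = assms(4)[unfolded coherent_family_def]
  have p0: "p d l \<ge> 0" if "d \<ge> 1" "l \<in> harmonic_degrees d" for d l
    using coherent that by blast
  have p1: "(\<Sum>l\<in>harmonic_degrees d. p d l) = 1" if "d \<ge> 1" for d
    using coherent that by blast
  have lam: "0 < lam" using coherent by blast
  have "\<exists>Q. (\<forall>d\<ge>1. step_extension d (p d) (Q d)) \<and>
        (\<forall>x\<ge>0. (\<lambda>d. real d powr lam * Q d (real d powr lam * x)) \<longlonglongrightarrow> psi x) \<and>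
        (\<exists>a1>0. \<exists>a2>0. \<forall>d\<ge>1. \<forall>x\<ge>0.
           real d powr lam * Q d (real d powr lam * x) \<le> a1 * exp (- a2 * x\<^sup>2))"
    using coherent by (elim conjE) assumption
  then obtain Q where Q: "\<forall>d\<ge>1. step_extension d (p d) (Q d)"
    and "\<exists>a1>0. \<exists>a2>0. \<forall>d\<ge>1. \<forall>x\<ge>0. real d powr lam * Q d (real d powr lam * x) \<le> a1 * exp (- a2 * x\<^sup>2)"
    by blast
  then obtain a1 a2 where a: "a1 > 0" "a2 > 0"
    and Qb: "\<forall>d\<ge>1. \<forall>x\<ge>0. real d powr lam * Q d (real d powr lam * x) \<le> a1 * exp (- a2 * x\<^sup>2)"
    by blast
  obtain \<kappa> D0 w B t where \<kappa>: "\<kappa> > 0" and D0: "D0 \<ge> 1" and w: "w > 0" and B: "B > 0" and t: "t > 0"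
    and est: "\<And>D L q. D \<ge> D0 \<Longrightarrow> gaussian_weights a1 a2 D L q \<Longrightarrow>
       \<exists>A. A \<ge> A0 \<and> x / A \<le> \<kappa> / D \<and>
         w * D ^ (n - 1) \<le> (\<Sum>l\<in>band L \<delta> A. q l * mass l) \<and>
         (\<Sum>l\<in>band L \<delta> A. mass l) \<le> B * D ^ n \<and>
         (\<Sum>l\<in>L. (q l)\<^sup>2 * mass l * (1 + (\<kappa> + 1) / D) ^ (2 * l)) \<le> t * (D ^ n / D\<^sup>2)"
    using weight_estimates[OF n_pos a \<delta> A0 c C x mass_lower less_imp_le[OF mass_pos] mass_upper] by blast
  \<comment> \<open>The barrier has to exceed the fluctuation, whose square is \<open>4 * (\<kappa> + 1) ^ Suc n * t * (D ^ n / D\<^sup>2)\<close>.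
    The choice of \<open>T\<close> gives twice this value. The norm \<open>\<beta>\<close> of the barrier coefficients does not
    depend on \<open>d\<close>.\<close>
  define T where "T = sqrt (8 * (\<kappa> + 1) ^ Suc n * t) / (c0 * w)"
  have T: "T > 0" "(T * c0 * w)\<^sup>2 = 8 * (\<kappa> + 1) ^ Suc n * t"
    using \<kappa> t c0 w by (simp_all add: T_def)
  define \<beta> where "\<beta> = T * sqrt B"
  have \<beta>: "\<beta> > 0" "\<beta>\<^sup>2 = T\<^sup>2 * B" using T B by (simp_all add: \<beta>_def power_mult_distrib)
  define \<pi> where "\<pi> = exp (- 2 * \<beta> - \<beta>\<^sup>2 / 2) / 2"
  have \<pi>: "\<pi> > 0" by (simp add: \<pi>_def)
  define c1 where "c1 = (1 / (24 * \<kappa> * real n)) ^ n * \<pi>"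
  have c1: "c1 > 0" using \<kappa> n_pos \<pi> by (simp add: c1_def)
  let ?Z = "max D0 (2 * \<kappa>)"
  have "?Z \<le> real d powr lam" if "nat \<lceil>?Z powr (1 / lam)\<rceil> \<le> d" for d
  proof -
    have "?Z = (?Z powr (1 / lam)) powr lam" using D0 lam by (simp add: powr_powr)
    also have "\<dots> \<le> real d powr lam" using that lam by (intro powr_mono2) (auto simp: nat_le_iff ceiling_le_iff)
    finally show ?thesis .
  qed
  then have "\<forall>\<^sub>F d in sequentially. ?Z \<le> real d powr lam"
    unfolding eventually_sequentially by blast
  then have "\<forall>\<^sub>F d in sequentially. ennreal (c1 * real d powr (lam * real n)) \<le>
      (\<integral>\<^sup>+ \<omega>. ennreal_of_enat
               (b0 (proj_zero_set (invariant_polynomial d (p d) J Y (\<lambda>l j. \<xi> d l j \<omega>)))) \<partial>M d)"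
    using eventually_ge_at_top[of 1]
  proof eventually_elim
    case (elim d)
    define D where "D = real d powr lam"
    have D: "D \<ge> D0" "D \<ge> 1" "2 * \<kappa> \<le> D" using elim D0 by (auto simp: D_def)
    let ?L = "harmonic_degrees d" and ?X = "\<lambda>q \<omega>. case q of (l, j) \<Rightarrow> \<xi> d l j \<omega>"
    have fin: "finite ?L" by (rule finite_subset[of _ "{..d}"]) (auto simp: harmonic_degrees_def)
    have X: "iid_standard_gaussian (M d) (Sigma ?L J) (\<lambda>(l, j). \<xi> d l j)" by (rule assms(5)[OF elim(2)])
    have "D * p d l \<le> a1 * exp (- a2 * (real l / D)\<^sup>2)" if l: "l \<in> ?L" for l
    proof -
      have "Q d (real l) = p d l" using Q elim(2) l by (simp add: step_extension_def)
      then show ?thesis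
        using Qb[rule_format, of d "real l / D"] elim(2) D by (simp add: D_def[symmetric])
    qed
    then have weights: "gaussian_weights a1 a2 D ?L (p d)"
      using fin p0[OF elim(2)] p1[OF elim(2)] by (simp add: gaussian_weights_def)
    obtain A where A: "A \<ge> A0" "x / A \<le> \<kappa> / D"
      and W: "w * D ^ (n - 1) \<le> (\<Sum>l\<in>band ?L \<delta> A. p d l * mass l)"
      and S: "(\<Sum>l\<in>band ?L \<delta> A. mass l) \<le> B * D ^ n"
      and V: "(\<Sum>l\<in>?L. (p d l)\<^sup>2 * mass l * (1 + (\<kappa> + 1) / D) ^ (2 * l)) \<le> t * (D ^ n / D\<^sup>2)"
      using est[OF D(1) weights] by blast
    define Bd where "Bd = band ?L \<delta> A"
    define \<rho> where "\<rho> = x / A"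
    have \<rho>: "\<rho> > 0" "\<rho> \<le> \<kappa> / D" "\<rho> \<le> 1 / 2"
    proof -
      show "\<rho> > 0" "\<rho> \<le> \<kappa> / D" using x A A0 by (auto simp: \<rho>_def)
      moreover have "\<kappa> / D \<le> 1 / 2" using D by (simp add: divide_le_eq)
      ultimately show "\<rho> \<le> 1 / 2" by linarith
    qed
    obtain U :: "(real ^ 'm) set" where U: "finite U" "\<And>u. u \<in> U \<Longrightarrow> norm u = 1"
      and disj: "disjoint_cones \<rho> U"
      and card: "(1 / (24 * \<rho> * real n)) ^ n \<le> real (card U)"
      using disjoint_cones_packing[OF dim n_pos \<rho>(1,3)] by blast
    define g where "g = T / sqrt (D ^ n)"
    have g: "g > 0" "g\<^sup>2 = T\<^sup>2 / D ^ n" using T D by (simp_all add: g_def power_divide)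
    have event: "\<exists>E\<in>sets (M d). \<pi> \<le> measure (M d) E \<and>
      (\<forall>\<omega>\<in>E. harmonic_field (p d) ?L (\<lambda>q. ?X q \<omega>) u > 0) \<and>
      (\<forall>\<omega>\<in>E. \<forall>y\<in>cone_rim \<rho> u.
         harmonic_field (p d) ?L (\<lambda>q. ?X q \<omega>) y < 0)" if u: "u \<in> U" for u
    proof -
      have ne: "Sigma ?L J \<noteq> {}"
      proof
        assume e: "Sigma ?L J = {}"
        have "d \<in> ?L" by (simp add: harmonic_degrees_def)
        with e have "J d = {}" by auto
        then have "mass d = 0" by (simp add: mass_def kernel_def)
        then show False using mass_pos[of d] by simp
      qed
      have r: "(0::real) < 1 / D" using D by simp
      have R: "\<rho> + 1 / D \<le> (\<kappa> + 1) / D" using \<rho> by (simp add: add_divide_distrib)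
      have tau: "t * (D ^ n / D\<^sup>2) > 0" using t D by simp
      have Bd: "Bd \<subseteq> ?L" by (auto simp: Bd_def band_def)
      have neg: "(1 / sqrt (1 + \<rho>\<^sup>2)) ^ l * zonal_profile n l (\<rho>\<^sup>2) \<le> - c0" if "l \<in> Bd" for l
        using neg'[of A l] A that c0 unfolding \<rho>_def by (simp add: Bd_def band_def)
      have gS: "g\<^sup>2 * (\<Sum>l\<in>Bd. mass l) \<le> \<beta>\<^sup>2"
      proof -
        have "g\<^sup>2 * (\<Sum>l\<in>Bd. mass l) \<le> g\<^sup>2 * (B * D ^ n)" using S by (intro mult_left_mono) (auto simp: Bd_def)
        also have "\<dots> = \<beta>\<^sup>2" using D by (simp add: g \<beta>)
        finally show ?thesis .
      qed
      have big: "4 * ((\<kappa> + 1) / D / (1 / D)) ^ DIM(real ^ 'm) * (t * (D ^ n / D\<^sup>2)) <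
          (g * c0 * (\<Sum>l\<in>Bd. p d l * mass l))\<^sup>2"
      proof -
        have "4 * ((\<kappa> + 1) / D / (1 / D)) ^ DIM(real ^ 'm) * (t * (D ^ n / D\<^sup>2)) = 4 * (\<kappa> + 1) ^ Suc n * t * (D ^ n / D\<^sup>2)"
          unfolding dim using D by simp
        also have "\<dots> < 8 * (\<kappa> + 1) ^ Suc n * t * (D ^ n / D\<^sup>2)"
          using \<kappa> t D by (intro mult_strict_right_mono) auto
        also have "\<dots> = (T * c0 * w)\<^sup>2 * (D ^ n / D\<^sup>2)" by (simp only: T)
        also have "\<dots> = g\<^sup>2 * (c0 * (w * D ^ (n - 1)))\<^sup>2"
        proof -
          have "D ^ n = D ^ (n - 1) * D" using n_pos by (cases n) auto
          then have "D ^ n / D\<^sup>2 = (D ^ (n - 1))\<^sup>2 / D ^ n" using D by (simp add: power2_eq_square)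
          then show ?thesis unfolding g by (simp add: power_mult_distrib)
        qed
        also have "\<dots> = (g * c0 * (w * D ^ (n - 1)))\<^sup>2" by (simp add: power_mult_distrib)
        also have "\<dots> \<le> (g * c0 * (\<Sum>l\<in>Bd. p d l * mass l))\<^sup>2"
          using W g c0 w D by (intro power_mono mult_left_mono) (auto simp: Bd_def)
        finally show ?thesis .
      qed
      obtain E where "E \<in> sets (M d)" "exp (- 2 * \<beta> - \<beta>\<^sup>2 / 2) / 2 \<le> measure (M d) E"
        "\<And>\<omega>. \<omega> \<in> E \<Longrightarrow> harmonic_field (p d) ?L (\<lambda>q. ?X q \<omega>) u > 0"
        "\<And>\<omega> y. \<omega> \<in> E \<Longrightarrow> y \<in> cone_rim \<rho> u \<Longrightarrow> harmonic_field (p d) ?L (\<lambda>q. ?X q \<omega>) y < 0"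
        using barrier_event[OF X fin ne p0[OF elim(2)] U(2)[OF u] \<rho>(1) r R V tau Bd c0(1,2) neg g(1) gS \<beta>(1) big]
        by (auto simp: case_prod_beta)
      then show ?thesis unfolding \<pi>_def by blast
    qed
    have Mp: "prob_space (M d)" using X by (simp add: iid_standard_gaussian_def)
    have "ennreal (c1 * real d powr (lam * real n)) \<le> ennreal (real (card U) * \<pi>)"
    proof (rule ennreal_leI)
      have "real d powr (lam * real n) = D ^ n"
        using elim(2) by (simp add: D_def powr_powr[symmetric] powr_realpow)
      then have "c1 * real d powr (lam * real n) = (1 / (24 * (\<kappa> / D) * real n)) ^ n * \<pi>"
        using D by (simp add: c1_def power_divide power_mult_distrib)
      also have "\<dots> \<le> (1 / (24 * \<rho> * real n)) ^ n * \<pi>"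
        using \<rho> \<kappa> D n_pos \<pi> by (intro mult_right_mono power_mono divide_left_mono mult_pos_pos mult_left_mono) auto
      also have "\<dots> \<le> real (card U) * \<pi>" using card \<pi> by (intro mult_right_mono) auto
      finally show "c1 * real d powr (lam * real n) \<le> real (card U) * \<pi>" .
    qed
    also have "\<dots> \<le> (\<integral>\<^sup>+ \<omega>. ennreal_of_enat
               (b0 (proj_zero_set (invariant_polynomial d (p d) J Y (\<lambda>l j. ?X (l, j) \<omega>)))) \<partial>M d)"
      by (rule expected_components_lower_bound[OF hY invariant_polynomial_homogeneous[OF assms(3) elim(2)]
            U \<rho>(1) disj Mp less_imp_le[OF \<pi>] event])
    finally show ?case by simp
  qed
  with c1 show ?thesis by blast
qed

end
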